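(* Let $(\mathbb A,\{\!\{-,-\}\!\})$ be a double Poisson algebra. The jet algebra $J_\infty\mathbb A$ admits a unique structure of double Poisson vertex algebra satisfying, for any $a,b\in\mathbb A$, $$\{\!\{a_\lambda b\}\!\}=\{\!\{a,b\}\!\},\qquad\text{i.e.}\qquad a_{(\!(n)\!)}b=\delta_{n,0}\,\{\!\{a,b\}\!\}\quad\forall\,n\ge0 .$$
   Context: $\Bbbk$ is a field of characteristic $0$; algebras are unital associative over $\Bbbk$; $\otimes=\otimes_\Bbbk$. For $d=d'\otimes d''$ (sums omitted): $d^\sigma=d''\otimes d'$, $b\,d\,c=bd'\otimes d''c$, $b*_1d*_1c=d'c\otimes bd''$, $d\otimes_1c=d'\otimes c\otimes d''$. A double Poisson algebra is an algebra $\mathbb A$ with a linear map $\{\!\{-,-\}\!\}:\mathbb A\otimes\mathbb A\to\mathbb A\otimes\mathbb A$ such that $\{\!\{a,b\}\!\}=-\{\!\{b,a\}\!\}^\sigma$, $\{\!\{a,bc\}\!\}=\{\!\{a,b\}\!\}c+b\{\!\{a,c\}\!\}$, $\{\!\{ab,c\}\!\}=\{\!\{a,c\}\!\}*_1b+a*_1\{\!\{b,c\}\!\}$ and $\{\!\{a,\{\!\{b,c\}\!\}\}\!\}_L-\{\!\{b,\{\!\{a,c\}\!\}\}\!\}_R-\{\!\{\{\!\{a,b\}\!\},c\}\!\}_L=0$, where $\{\!\{a,b'\otimes b''\}\!\}_L=\{\!\{a,b'\}\!\}\otimes b''$, $\{\!\{a,b'\otimes b''\}\!\}_R=b'\otimes\{\!\{a,b''\}\!\}$,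 $\{\!\{a'\otimes a'',b\}\!\}_L=\{\!\{a',b\}\!\}\otimes_1a''$. A double Poisson vertex algebra is an algebra $\mathbb V$ with a derivation $\partial$ (extended to tensor powers by Leibniz) and a linear map $\{\!\{-_\lambda-\}\!\}:\mathbb V\otimes\mathbb V\to(\mathbb V\otimes\mathbb V)[\lambda]$ such that: $\{\!\{\partial a_\lambda b\}\!\}=-\lambda\{\!\{a_\lambda b\}\!\}$, $\{\!\{a_\lambda\partial b\}\!\}=(\partial+\lambda)\{\!\{a_\lambda b\}\!\}$; $\{\!\{a_\lambda bc\}\!\}=\{\!\{a_\lambda b\}\!\}c+b\{\!\{a_\lambda c\}\!\}$; if $\{\!\{a_\lambda c\}\!\}=\sum p_n\lambda^n$, $\{\!\{b_\lambda c\}\!\}=\sum q_n\lambda^n$ then $\{\!\{ab_\lambda c\}\!\}=\sum_n\sum_{k=0}^n\binom nk\lambda^{n-k}(p_n*_1\partial^k(b)+\partial^k(a)*_1q_n)$; if $\{\!\{b_\lambda a\}\!\}=\sum r_n\lambda^n$ then $\{\!\{a_\lambda b\}\!\}=-\sum_n(-\lambda-\partial)^n(r_n^\sigma)$; and $\{\!\{a_\lambda\{\!\{b_\mu c\}\!\}\}\!\}_L-\{\!\{b_\mu\{\!\{a_\lambda c\}\!\}\}\!\}_R-\{\!\{\{\!\{a_\lambda b\}\!\}_{\lambda+\mu}c\}\!\}_L=0$, where $\{\!\{a_\lambda b'\otimes b''\}\!\}_L=\{\!\{a_\lambda b'\}\!\}\otimes b''$, $\{\!\{a_\lambda b'\otimes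 b''\}\!\}_R=b'\otimes\{\!\{a_\lambda b''\}\!\}$, $\{\!\{a'\otimes a''{}_\lambda b\}\!\}_L=\sum_n\sum_k\binom nk\lambda^{n-k}s_n\otimes_1\partial^k(a'')$ if $\{\!\{a'_\lambda b\}\!\}=\sum s_n\lambda^n$. The double products are $a_{(\!(n)\!)}b=n!\cdot$(coefficient of $\lambda^n$ in $\{\!\{a_\lambda b\}\!\}$). The jet algebra $J_\infty\mathbb A$ is the algebra generated by symbols $\partial^k(a)$ ($a\in\mathbb A$, $k\ge0$) subject to linearity of $\partial^k$ and $\partial^k(ab)=\sum_j\binom kj\partial^j(a)\partial^{k-j}(b)$ (with unit $\partial^0(1)$), with derivation $\partial(\partial^k(a))=\partial^{k+1}(a)$; $\mathbb A$ is embedded via $a\mapsto\partial^0(a)$. *)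

theory Defs
  imports
    "HOL-Library.Poly_Mapping"
    "HOL-Algebra.Algebraic_Closure_Type"
    "HOL-Algebra.Algebra"
begin

section \<open>Associative algebras over a field\<close>

locale assoc_algebra =
  module "ring_of_type_algebra :: 'k ring" A + ring A
  for A :: "('k::field_char_0, 'v) module" (structure) +
  assumes smult_mult_left:
      "\<lbrakk>x \<in> carrier A; y \<in> carrier A\<rbrakk> \<Longrightarrow> (c \<odot> x) \<otimes> y = c \<odot> (x \<otimes> y)"
    and smult_mult_right:
      "\<lbrakk>x \<in> carrier A; y \<in> carrier A\<rbrakk> \<Longrightarrow> x \<otimes> (c \<odot> y) = c \<odot> (x \<otimes> y)"

locale derivation = assoc_algebra A
  for A :: "('k::field_char_0, 'v) module" (structure) and D :: "'v \<Rightarrow> 'v" +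
  assumes der_closed: "x \<in> carrier A \<Longrightarrow> D x \<in> carrier A"
    and der_add: "\<lbrakk>x \<in> carrier A; y \<in> carrier A\<rbrakk> \<Longrightarrow> D (x \<oplus> y) = D x \<oplus> D y"
    and der_smult: "x \<in> carrier A \<Longrightarrow> D (c \<odot> x) = c \<odot> D x"
    and der_mult: "\<lbrakk>x \<in> carrier A; y \<in> carrier A\<rbrakk> \<Longrightarrow> D (x \<otimes> y) = D x \<otimes> y \<oplus> x \<otimes> D y"


section \<open>Free modules, free algebras and quotients\<close>

text \<open>Lists form the free monoid, so that \<^typ>\<open>'x list \<Rightarrow>\<^sub>0 'k\<close> with the convolution
  product of \<^theory>\<open>HOL-Library.Poly_Mapping\<close> is the free associative algebra.\<close>

instantiation list :: (type) monoid_add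
begin
definition zero_list :: "'a list" where "zero_list = []"
definition plus_list :: "'a list \<Rightarrow> 'a list \<Rightarrow> 'a list" where "plus_list xs ys = xs @ ys"
instance by standard (simp_all add: zero_list_def plus_list_def)
end

text \<open>The free module on a set \<open>S\<close> of words.  For \<^term>\<open>S = lists B\<close> it is the free algebra on \<open>B\<close>;
  for sets of words not closed under concatenation only the module structure is meaningful.\<close>

definition pm_smult :: "'k::semiring_0 \<Rightarrow> ('x \<Rightarrow>\<^sub>0 'k) \<Rightarrow> ('x \<Rightarrow>\<^sub>0 'k)" where
  "pm_smult c p = Poly_Mapping.map ((*) c) p"

definition word_module :: "'x list set \<Rightarrow> ('k::field_char_0, 'x list \<Rightarrow>\<^sub>0 'k) module" where
  "word_module S = \<lparr>carrier = {p. Poly_Mapping.keys p \<subseteq> S},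
     monoid.mult = (*), one = 1, ring.zero = 0, add = (+), module.smult = pm_smult\<rparr>"

definition quot_module :: "('k, 'v) module \<Rightarrow> 'v set \<Rightarrow> ('k, 'v set) module" where
  "quot_module M N =
     ring.extend (M Quot N) (module.fields (\<lambda>c C. \<Union>x\<in>C. N +>\<^bsub>M\<^esub> (c \<odot>\<^bsub>M\<^esub> x)))"


section \<open>Tensor powers\<close>

text \<open>The \<open>n\<close>-th tensor power of \<open>V\<close> is the free module on the words of length \<open>n\<close> in
  elements of \<open>V\<close>, modulo multilinearity; the word \<open>[x\<^sub>1, \<dots>, x\<^sub>n]\<close> stands for
  \<open>x\<^sub>1 \<otimes> \<dots> \<otimes> x\<^sub>n\<close>.  Only the module structure of the record is meaningful.\<close>

type_synonym ('k, 'v) tensor = "('v list \<Rightarrow>\<^sub>0 'k) set"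

definition tensor_words :: "nat \<Rightarrow> ('k, 'v) module \<Rightarrow> 'v list set" where
  "tensor_words n V = {xs \<in> lists (carrier V). length xs = n}"

definition tensor_rels :: "nat \<Rightarrow> ('k::field_char_0, 'v) module \<Rightarrow> ('v list \<Rightarrow>\<^sub>0 'k) set" where
  "tensor_rels n V =
     {Poly_Mapping.single (xs[i := x \<oplus>\<^bsub>V\<^esub> y]) 1
        - Poly_Mapping.single (xs[i := x]) 1 - Poly_Mapping.single (xs[i := y]) 1
      | xs i x y. xs \<in> tensor_words n V \<and> i < n \<and> x \<in> carrier V \<and> y \<in> carrier V} \<union>
     {Poly_Mapping.single (xs[i := c \<odot>\<^bsub>V\<^esub> x]) 1 - Poly_Mapping.single (xs[i := x]) c
      | xs i c x. xs \<in> tensor_words n V \<and> i < n \<and> x \<in> carrier V}"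

definition tensor_null :: "nat \<Rightarrow> ('k::field_char_0, 'v) module \<Rightarrow> ('v list \<Rightarrow>\<^sub>0 'k) set" where
  "tensor_null n V = Modules.module.span pm_smult (tensor_rels n V)"

definition tensor_power ::
    "nat \<Rightarrow> ('k::field_char_0, 'v) module \<Rightarrow> ('k, ('k, 'v) tensor) module" where
  "tensor_power n V = quot_module (word_module (tensor_words n V)) (tensor_null n V)"

definition pure :: "('k::field_char_0, 'v) module \<Rightarrow> 'v list \<Rightarrow> ('k, 'v) tensor" where
  "pure V xs = tensor_null (length xs) V
     +>\<^bsub>word_module (tensor_words (length xs) V)\<^esub> Poly_Mapping.single xs 1"

text \<open>The linear map from a tensor power to \<open>M\<close> induced by a multilinear map \<open>f\<close>: all
  representatives of the class \<open>t\<close> give the same value, which is selected by \<^const>\<open>the_elem\<close>.\<close>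

definition tensor_lift ::
    "('k, 'w) module \<Rightarrow> ('v list \<Rightarrow> 'w) \<Rightarrow> ('k::field_char_0, 'v) tensor \<Rightarrow> 'w" where
  "tensor_lift M f t = the_elem
     ((\<lambda>p. \<Oplus>\<^bsub>M\<^esub>xs\<in>Poly_Mapping.keys p. Poly_Mapping.lookup p xs \<odot>\<^bsub>M\<^esub> f xs) ` t)"

definition tensor_lift2 ::
    "('k, 'w) module \<Rightarrow> ('v \<Rightarrow> 'v \<Rightarrow> 'w) \<Rightarrow> ('k::field_char_0, 'v) tensor \<Rightarrow> 'w" where
  "tensor_lift2 M f = tensor_lift M (\<lambda>xs. f (xs ! 0) (xs ! 1))"

definition tensor_map ::
    "nat \<Rightarrow> ('k::field_char_0, 'w) module \<Rightarrow> ('v \<Rightarrow> 'w) \<Rightarrow> ('k, 'v) tensor \<Rightarrow> ('k, 'w) tensor" where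
  "tensor_map n W f = tensor_lift (tensor_power n W) (\<lambda>xs. pure W (map f xs))"

text \<open>The extension of a derivation \<open>D\<close> of \<open>V\<close> to the \<open>n\<close>-th tensor power.\<close>

definition tensor_der ::
    "nat \<Rightarrow> ('k::field_char_0, 'v) module \<Rightarrow> ('v \<Rightarrow> 'v) \<Rightarrow> ('k, 'v) tensor \<Rightarrow> ('k, 'v) tensor" where
  "tensor_der n V D = tensor_lift (tensor_power n V)
     (\<lambda>xs. \<Oplus>\<^bsub>tensor_power n V\<^esub>i\<in>{..<n}. pure V (xs[i := D (xs ! i)]))"

text \<open>\<open>d\<^sup>\<sigma>\<close>; the bimodule structures \<open>b d\<close>, \<open>d c\<close>, \<open>b *\<^sub>1 d\<close>, \<open>d *\<^sub>1 c\<close> on the tensor square;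
  \<open>d \<otimes> c\<close>, \<open>c \<otimes> d\<close> and \<open>d \<otimes>\<^sub>1 c\<close>.\<close>

definition flip :: "('k::field_char_0, 'v) module \<Rightarrow> ('k, 'v) tensor \<Rightarrow> ('k, 'v) tensor" where
  "flip V = tensor_lift2 (tensor_power 2 V) (\<lambda>x y. pure V [y, x])"

definition outer_left :: "('k::field_char_0, 'v) module \<Rightarrow> 'v \<Rightarrow> ('k, 'v) tensor \<Rightarrow> ('k, 'v) tensor" where
  "outer_left V b = tensor_lift2 (tensor_power 2 V) (\<lambda>x y. pure V [b \<otimes>\<^bsub>V\<^esub> x, y])"

definition outer_right :: "('k::field_char_0, 'v) module \<Rightarrow> ('k, 'v) tensor \<Rightarrow> 'v \<Rightarrow> ('k, 'v) tensor" where
  "outer_right V d c = tensor_lift2 (tensor_power 2 V) (\<lambda>x y. pure V [x, y \<otimes>\<^bsub>V\<^esub> c]) d"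

definition inner_left :: "('k::field_char_0, 'v) module \<Rightarrow> 'v \<Rightarrow> ('k, 'v) tensor \<Rightarrow> ('k, 'v) tensor" where
  "inner_left V b = tensor_lift2 (tensor_power 2 V) (\<lambda>x y. pure V [x, b \<otimes>\<^bsub>V\<^esub> y])"

definition inner_right :: "('k::field_char_0, 'v) module \<Rightarrow> ('k, 'v) tensor \<Rightarrow> 'v \<Rightarrow> ('k, 'v) tensor" where
  "inner_right V d c = tensor_lift2 (tensor_power 2 V) (\<lambda>x y. pure V [x \<otimes>\<^bsub>V\<^esub> c, y]) d"

definition tensor_snoc :: "('k::field_char_0, 'v) module \<Rightarrow> ('k, 'v) tensor \<Rightarrow> 'v \<Rightarrow> ('k, 'v) tensor" where
  "tensor_snoc V d c = tensor_lift2 (tensor_power 3 V) (\<lambda>x y. pure V [x, y, c]) d"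

definition tensor_cons :: "('k::field_char_0, 'v) module \<Rightarrow> 'v \<Rightarrow> ('k, 'v) tensor \<Rightarrow> ('k, 'v) tensor" where
  "tensor_cons V c = tensor_lift2 (tensor_power 3 V) (\<lambda>x y. pure V [c, x, y])"

definition tensor_mid :: "('k::field_char_0, 'v) module \<Rightarrow> ('k, 'v) tensor \<Rightarrow> 'v \<Rightarrow> ('k, 'v) tensor" where
  "tensor_mid V d c = tensor_lift2 (tensor_power 3 V) (\<lambda>x y. pure V [x, c, y]) d"


section \<open>Double Poisson algebras\<close>

text \<open>\<open>{{a, d}}\<^sub>L\<close>, \<open>{{a, d}}\<^sub>R\<close> and \<open>{{d, b}}\<^sub>L\<close> for \<open>d\<close> in the tensor square.\<close>

definition bracket_L :: "('k::field_char_0, 'v) module \<Rightarrow> ('v \<Rightarrow> 'v \<Rightarrow> ('k, 'v) tensor) \<Rightarrow>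
    'v \<Rightarrow> ('k, 'v) tensor \<Rightarrow> ('k, 'v) tensor" where
  "bracket_L V br a = tensor_lift2 (tensor_power 3 V) (\<lambda>x y. tensor_snoc V (br a x) y)"

definition bracket_R :: "('k::field_char_0, 'v) module \<Rightarrow> ('v \<Rightarrow> 'v \<Rightarrow> ('k, 'v) tensor) \<Rightarrow>
    'v \<Rightarrow> ('k, 'v) tensor \<Rightarrow> ('k, 'v) tensor" where
  "bracket_R V br a = tensor_lift2 (tensor_power 3 V) (\<lambda>x y. tensor_cons V x (br a y))"

definition bracket_fst_L :: "('k::field_char_0, 'v) module \<Rightarrow> ('v \<Rightarrow> 'v \<Rightarrow> ('k, 'v) tensor) \<Rightarrow>
    ('k, 'v) tensor \<Rightarrow> 'v \<Rightarrow> ('k, 'v) tensor" where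
  "bracket_fst_L V br d b = tensor_lift2 (tensor_power 3 V) (\<lambda>x y. tensor_mid V (br x b) y) d"

text \<open>A linear map out of \<open>V \<otimes> V\<close> is given as a bilinear map on \<open>V\<close>.\<close>

definition bilinear_on :: "('k, 'v) module \<Rightarrow> ('k, 'w) module \<Rightarrow> ('v \<Rightarrow> 'v \<Rightarrow> 'w) \<Rightarrow> bool" where
  "bilinear_on V W f \<longleftrightarrow>
     (\<forall>x\<in>carrier V. \<forall>y\<in>carrier V. f x y \<in> carrier W) \<and>
     (\<forall>x\<in>carrier V. \<forall>x'\<in>carrier V. \<forall>y\<in>carrier V. f (x \<oplus>\<^bsub>V\<^esub> x') y = f x y \<oplus>\<^bsub>W\<^esub> f x' y) \<and>
     (\<forall>x\<in>carrier V. \<forall>y\<in>carrier V. \<forall>y'\<in>carrier V. f x (y \<oplus>\<^bsub>V\<^esub> y') = f x y \<oplus>\<^bsub>W\<^esub> f x y') \<and>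
     (\<forall>c. \<forall>x\<in>carrier V. \<forall>y\<in>carrier V. f (c \<odot>\<^bsub>V\<^esub> x) y = c \<odot>\<^bsub>W\<^esub> f x y) \<and>
     (\<forall>c. \<forall>x\<in>carrier V. \<forall>y\<in>carrier V. f x (c \<odot>\<^bsub>V\<^esub> y) = c \<odot>\<^bsub>W\<^esub> f x y)"

locale double_poisson_algebra = assoc_algebra A
  for A :: "('k::field_char_0, 'v) module" (structure)
    and br :: "'v \<Rightarrow> 'v \<Rightarrow> ('k, 'v) tensor" +
  assumes bilinear: "bilinear_on A (tensor_power 2 A) br"
    and skew: "\<lbrakk>a \<in> carrier A; b \<in> carrier A\<rbrakk> \<Longrightarrow>
      br a b = \<ominus>\<^bsub>tensor_power 2 A\<^esub> flip A (br b a)"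
    and leibniz_right: "\<lbrakk>a \<in> carrier A; b \<in> carrier A; c \<in> carrier A\<rbrakk> \<Longrightarrow>
      br a (b \<otimes> c) = outer_right A (br a b) c \<oplus>\<^bsub>tensor_power 2 A\<^esub> outer_left A b (br a c)"
    and leibniz_left: "\<lbrakk>a \<in> carrier A; b \<in> carrier A; c \<in> carrier A\<rbrakk> \<Longrightarrow>
      br (a \<otimes> b) c = inner_right A (br a c) b \<oplus>\<^bsub>tensor_power 2 A\<^esub> inner_left A a (br b c)"
    and jacobi: "\<lbrakk>a \<in> carrier A; b \<in> carrier A; c \<in> carrier A\<rbrakk> \<Longrightarrow>
      bracket_L A br a (br b c) \<ominus>\<^bsub>tensor_power 3 A\<^esub> bracket_R A br b (br a c)
        \<ominus>\<^bsub>tensor_power 3 A\<^esub> bracket_fst_L A br (br a b) c = \<zero>\<^bsub>tensor_power 3 A\<^esub>"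


section \<open>Polynomials with coefficients in a module\<close>

text \<open>\<open>M[\<lambda>]\<close>, with polynomials given by their coefficient sequences.  Only the module structure
  of the record is meaningful.\<close>

definition poly_module :: "('k, 'm) module \<Rightarrow> ('k, nat \<Rightarrow> 'm) module" where
  "poly_module M = \<lparr>carrier = up M, monoid.mult = undefined, one = undefined,
     ring.zero = (\<lambda>n. \<zero>\<^bsub>M\<^esub>), add = (\<lambda>p q n. p n \<oplus>\<^bsub>M\<^esub> q n),
     module.smult = (\<lambda>c p n. c \<odot>\<^bsub>M\<^esub> p n)\<rparr>"

text \<open>The monomial \<open>\<lambda>\<^sup>n m\<close>, and multiplication of a polynomial by \<open>\<lambda>\<close>.\<close>

definition poly_monom :: "('k, 'm) module \<Rightarrow> nat \<Rightarrow> 'm \<Rightarrow> nat \<Rightarrow> 'm" where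
  "poly_monom M n m = (\<lambda>i. if i = n then m else \<zero>\<^bsub>M\<^esub>)"

definition poly_var_mult :: "('k, 'm) module \<Rightarrow> (nat \<Rightarrow> 'm) \<Rightarrow> nat \<Rightarrow> 'm" where
  "poly_var_mult M p = (\<lambda>n. if n = 0 then \<zero>\<^bsub>M\<^esub> else p (n - 1))"

text \<open>For \<open>p = \<Sum> p\<^sub>n \<lambda>\<^sup>n\<close>, the sum \<open>\<Sum> g n p\<^sub>n\<close> over the \<open>n\<close> with \<open>p\<^sub>n \<noteq> 0\<close>.\<close>

definition poly_sum ::
    "('k, 'm) module \<Rightarrow> ('k, 'w) module \<Rightarrow> (nat \<Rightarrow> 'm) \<Rightarrow> (nat \<Rightarrow> 'm \<Rightarrow> 'w) \<Rightarrow> 'w" where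
  "poly_sum M W p g = (\<Oplus>\<^bsub>W\<^esub>n\<in>{n. p n \<noteq> \<zero>\<^bsub>M\<^esub>}. g n (p n))"

text \<open>The coefficients of \<open>\<lambda>\<^sup>i \<mu>\<^sup>j\<close> in \<open>p(\<lambda> + \<mu>)\<close>, by the binomial theorem.\<close>

definition poly_add_vars :: "('k::field_char_0, 'm) module \<Rightarrow> (nat \<Rightarrow> 'm) \<Rightarrow> nat \<Rightarrow> nat \<Rightarrow> 'm" where
  "poly_add_vars M p = (\<lambda>i j. of_nat ((i + j) choose i) \<odot>\<^bsub>M\<^esub> p (i + j))"


section \<open>Double Poisson vertex algebras\<close>

text \<open>\<^term>\<open>br a b n\<close> is the coefficient of \<open>\<lambda>\<^sup>n\<close> in \<open>{{a\<^sub>\<lambda> b}}\<close>.\<close>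

type_synonym ('k, 'v) lambda_bracket = "'v \<Rightarrow> 'v \<Rightarrow> nat \<Rightarrow> ('k, 'v) tensor"

abbreviation square_poly ::
    "('k::field_char_0, 'v) module \<Rightarrow> ('k, nat \<Rightarrow> ('k, 'v) tensor) module" where
  "square_poly V \<equiv> poly_module (tensor_power 2 V)"

text \<open>\<open>(\<partial> + \<lambda>) p\<close> for a polynomial \<open>p\<close> with coefficients in the tensor square.\<close>

definition der_plus_var :: "('k::field_char_0, 'v) module \<Rightarrow> ('v \<Rightarrow> 'v) \<Rightarrow>
    (nat \<Rightarrow> ('k, 'v) tensor) \<Rightarrow> nat \<Rightarrow> ('k, 'v) tensor" where
  "der_plus_var V D p =
     (\<lambda>n. tensor_der 2 V D (p n)) \<oplus>\<^bsub>square_poly V\<^esub> poly_var_mult (tensor_power 2 V) p"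

text \<open>\<open>\<Sum>\<^sub>n \<Sum>\<^sub>k\<^sub>\<le>\<^sub>n (n choose k) \<lambda>\<^sup>n\<^sup>-\<^sup>k h p\<^sub>n (\<partial>\<^sup>k v)\<close>, the expansion of \<open>h p\<^bsub>\<lambda>+\<partial>\<^esub> v\<close> with \<open>\<partial>\<close>
  acting on \<open>v\<close>; here \<open>p\<close> has coefficients in \<open>M\<close> and the values of \<open>h\<close> are in \<open>W\<close>.\<close>

definition shifted_sum :: "('k::field_char_0, 'm) module \<Rightarrow> ('k, 'w) module \<Rightarrow> ('v \<Rightarrow> 'v) \<Rightarrow>
    (nat \<Rightarrow> 'm) \<Rightarrow> ('m \<Rightarrow> 'v \<Rightarrow> 'w) \<Rightarrow> 'v \<Rightarrow> nat \<Rightarrow> 'w" where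
  "shifted_sum M W D p h v = poly_sum M (poly_module W) p
     (\<lambda>n m. \<Oplus>\<^bsub>poly_module W\<^esub>k\<in>{..n}.
        of_nat (n choose k) \<odot>\<^bsub>poly_module W\<^esub> poly_monom W (n - k) (h m ((D ^^ k) v)))"

text \<open>\<open>{{d\<^sub>\<lambda> b}}\<^sub>L\<close> for \<open>d\<close> in the tensor square.\<close>

definition lambda_bracket_fst_L :: "('k::field_char_0, 'v) module \<Rightarrow> ('v \<Rightarrow> 'v) \<Rightarrow>
    ('k, 'v) lambda_bracket \<Rightarrow> ('k, 'v) tensor \<Rightarrow> 'v \<Rightarrow> nat \<Rightarrow> ('k, 'v) tensor" where
  "lambda_bracket_fst_L V D br d b = tensor_lift2 (poly_module (tensor_power 3 V))
     (\<lambda>x y. shifted_sum (tensor_power 2 V) (tensor_power 3 V) D (br x b) (tensor_mid V) y) d"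

text \<open>The coefficient of \<open>\<lambda>\<^sup>i \<mu>\<^sup>j\<close> in \<open>{{a\<^sub>\<lambda> {{b\<^sub>\<mu> c}}}}\<^sub>L\<close>, in \<open>{{b\<^sub>\<mu> {{a\<^sub>\<lambda> c}}}}\<^sub>R\<close> and in
  \<open>{{{{a\<^sub>\<lambda> b}}\<^bsub>\<lambda>+\<mu>\<^esub> c}}\<^sub>L = \<Sum>\<^sub>n \<lambda>\<^sup>n {{(r\<^sub>n)\<^bsub>\<lambda>+\<mu>\<^esub> c}}\<^sub>L\<close>, where \<open>{{a\<^sub>\<lambda> b}} = \<Sum> r\<^sub>n \<lambda>\<^sup>n\<close>.\<close>

definition jacobi_1 :: "('k::field_char_0, 'v) module \<Rightarrow> ('k, 'v) lambda_bracket \<Rightarrow>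
    'v \<Rightarrow> 'v \<Rightarrow> 'v \<Rightarrow> nat \<Rightarrow> nat \<Rightarrow> ('k, 'v) tensor" where
  "jacobi_1 V br a b c i j = bracket_L V (\<lambda>x y. br x y i) a (br b c j)"

definition jacobi_2 :: "('k::field_char_0, 'v) module \<Rightarrow> ('k, 'v) lambda_bracket \<Rightarrow>
    'v \<Rightarrow> 'v \<Rightarrow> 'v \<Rightarrow> nat \<Rightarrow> nat \<Rightarrow> ('k, 'v) tensor" where
  "jacobi_2 V br a b c i j = bracket_R V (\<lambda>x y. br x y j) b (br a c i)"

definition jacobi_3 :: "('k::field_char_0, 'v) module \<Rightarrow> ('v \<Rightarrow> 'v) \<Rightarrow> ('k, 'v) lambda_bracket \<Rightarrow>
    'v \<Rightarrow> 'v \<Rightarrow> 'v \<Rightarrow> nat \<Rightarrow> nat \<Rightarrow> ('k, 'v) tensor" where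
  "jacobi_3 V D br a b c i j = (\<Oplus>\<^bsub>tensor_power 3 V\<^esub>n\<in>{..i}.
     poly_add_vars (tensor_power 3 V) (lambda_bracket_fst_L V D br (br a b n) c) (i - n) j)"

locale double_poisson_vertex_algebra = derivation V D
  for V :: "('k::field_char_0, 'v) module" (structure) and D :: "'v \<Rightarrow> 'v"
    and br :: "('k, 'v) lambda_bracket" +
  assumes bilinear: "bilinear_on V (square_poly V) br"
    and sesquilinear_left: "\<lbrakk>a \<in> carrier V; b \<in> carrier V\<rbrakk> \<Longrightarrow>
      br (D a) b = \<ominus>\<^bsub>square_poly V\<^esub> poly_var_mult (tensor_power 2 V) (br a b)"
    and sesquilinear_right: "\<lbrakk>a \<in> carrier V; b \<in> carrier V\<rbrakk> \<Longrightarrow>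
      br a (D b) = der_plus_var V D (br a b)"
    and leibniz_right: "\<lbrakk>a \<in> carrier V; b \<in> carrier V; c \<in> carrier V\<rbrakk> \<Longrightarrow>
      br a (b \<otimes> c) =
        (\<lambda>n. outer_right V (br a b n) c) \<oplus>\<^bsub>square_poly V\<^esub> (\<lambda>n. outer_left V b (br a c n))"
    and leibniz_left: "\<lbrakk>a \<in> carrier V; b \<in> carrier V; c \<in> carrier V\<rbrakk> \<Longrightarrow>
      br (a \<otimes> b) c =
        shifted_sum (tensor_power 2 V) (tensor_power 2 V) D (br a c) (inner_right V) b
        \<oplus>\<^bsub>square_poly V\<^esub>
        shifted_sum (tensor_power 2 V) (tensor_power 2 V) D (br b c) (\<lambda>q x. inner_left V x q) a"
    and skew: "\<lbrakk>a \<in> carrier V; b \<in> carrier V\<rbrakk> \<Longrightarrow>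
      br a b = \<ominus>\<^bsub>square_poly V\<^esub> poly_sum (tensor_power 2 V) (square_poly V) (br b a)
        (\<lambda>n r. ((\<lambda>p. \<ominus>\<^bsub>square_poly V\<^esub> der_plus_var V D p) ^^ n)
                 (poly_monom (tensor_power 2 V) 0 (flip V r)))"
    and jacobi: "\<lbrakk>a \<in> carrier V; b \<in> carrier V; c \<in> carrier V\<rbrakk> \<Longrightarrow>
      jacobi_1 V br a b c i j \<ominus>\<^bsub>tensor_power 3 V\<^esub> jacobi_2 V br a b c i j
        \<ominus>\<^bsub>tensor_power 3 V\<^esub> jacobi_3 V D br a b c i j = \<zero>\<^bsub>tensor_power 3 V\<^esub>"

definition double_product :: "('k::field_char_0, 'v) module \<Rightarrow> ('k, 'v) lambda_bracket \<Rightarrow>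
    nat \<Rightarrow> 'v \<Rightarrow> 'v \<Rightarrow> ('k, 'v) tensor" where
  "double_product V br n a b = fact n \<odot>\<^bsub>tensor_power 2 V\<^esub> br a b n"


section \<open>The jet algebra\<close>

text \<open>The letter \<^term>\<open>(a, k)\<close> stands for the symbol \<open>\<partial>\<^sup>k(a)\<close>.\<close>

type_synonym ('k, 'v) jet = "(('v \<times> nat) list \<Rightarrow>\<^sub>0 'k) set"

definition jet_free ::
    "('k::field_char_0, 'v) module \<Rightarrow> ('k, ('v \<times> nat) list \<Rightarrow>\<^sub>0 'k) module" where
  "jet_free A = word_module (lists (carrier A \<times> UNIV))"

definition jet_sym :: "'v \<Rightarrow> nat \<Rightarrow> ('v \<times> nat) list \<Rightarrow>\<^sub>0 'k::field_char_0" where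
  "jet_sym a k = Poly_Mapping.single [(a, k)] 1"

definition jet_rels :: "('k::field_char_0, 'v) module \<Rightarrow> (('v \<times> nat) list \<Rightarrow>\<^sub>0 'k) set" where
  "jet_rels A =
     {jet_sym (a \<oplus>\<^bsub>A\<^esub> b) k - (jet_sym a k + jet_sym b k)
      | a b k. a \<in> carrier A \<and> b \<in> carrier A} \<union>
     {jet_sym (c \<odot>\<^bsub>A\<^esub> a) k - pm_smult c (jet_sym a k) | c a k. a \<in> carrier A} \<union>
     {jet_sym (a \<otimes>\<^bsub>A\<^esub> b) k - (\<Sum>j\<le>k. of_nat (k choose j) * jet_sym a j * jet_sym b (k - j))
      | a b k. a \<in> carrier A \<and> b \<in> carrier A} \<union>
     {jet_sym \<one>\<^bsub>A\<^esub> 0 - 1}"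

definition jet_ideal :: "('k::field_char_0, 'v) module \<Rightarrow> (('v \<times> nat) list \<Rightarrow>\<^sub>0 'k) set" where
  "jet_ideal A = genideal (jet_free A) (jet_rels A)"

definition jet_algebra :: "('k::field_char_0, 'v) module \<Rightarrow> ('k, ('k, 'v) jet) module" where
  "jet_algebra A = quot_module (jet_free A) (jet_ideal A)"

text \<open>The derivation \<open>\<partial>\<^sup>k(a) \<mapsto> \<partial>\<^sup>k\<^sup>+\<^sup>1(a)\<close>, first on the free algebra and then on classes.\<close>

definition free_jet_der ::
    "(('v \<times> nat) list \<Rightarrow>\<^sub>0 'k::field_char_0) \<Rightarrow> (('v \<times> nat) list \<Rightarrow>\<^sub>0 'k)" where
  "free_jet_der p = (\<Sum>w\<in>Poly_Mapping.keys p. \<Sum>i<length w.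
     Poly_Mapping.single (w[i := (fst (w ! i), Suc (snd (w ! i)))]) (Poly_Mapping.lookup p w))"

definition jet_der :: "('k::field_char_0, 'v) module \<Rightarrow> ('k, 'v) jet \<Rightarrow> ('k, 'v) jet" where
  "jet_der A C = (\<Union>p\<in>C. jet_ideal A +>\<^bsub>jet_free A\<^esub> free_jet_der p)"

definition jet_embed :: "('k::field_char_0, 'v) module \<Rightarrow> 'v \<Rightarrow> ('k, 'v) jet" where
  "jet_embed A a = jet_ideal A +>\<^bsub>jet_free A\<^esub> jet_sym a 0"

definition jet_embed_square ::
    "('k::field_char_0, 'v) module \<Rightarrow> ('k, 'v) tensor \<Rightarrow> ('k, ('k, 'v) jet) tensor" where
  "jet_embed_square A = tensor_map 2 (jet_algebra A) (jet_embed A)"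

text \<open>\<open>{{a\<^sub>\<lambda> b}} = {{a, b}}\<close> on \<open>A\<close>.\<close>

definition extends_bracket :: "('k::field_char_0, 'v) module \<Rightarrow> ('v \<Rightarrow> 'v \<Rightarrow> ('k, 'v) tensor) \<Rightarrow>
    ('k, ('k, 'v) jet) lambda_bracket \<Rightarrow> bool" where
  "extends_bracket A br lbr \<longleftrightarrow> (\<forall>a\<in>carrier A. \<forall>b\<in>carrier A.
     lbr (jet_embed A a) (jet_embed A b) =
       poly_monom (tensor_power 2 (jet_algebra A)) 0 (jet_embed_square A (br a b)))"

end

theory Submission
  imports Defs "HOL-Library.Product_Plus"
begin

text \<open>
  The jet algebra \<open>J\<close> is a quotient of the free algebra \<open>F\<close> on the letters \<open>\<partial>\<^sup>k(a)\<close>.  Choose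
  representatives in \<open>F \<otimes> F\<close> of the brackets of elements of \<open>A\<close>; sesquilinearity and the two Leibniz
  rules then determine a bracket \<open>F \<times> F \<rightarrow> (F \<otimes> F)[\<lambda>]\<close>, for which these rules hold exactly.
  Reading \<open>\<lambda>\<close> as \<open>\<partial>\<close>, an element of \<open>(F \<otimes> F)[\<lambda>]\<close> is the symbol of a differential operator; the
  formal adjoint exchanges the outer with the inner bimodule structure, turns \<open>\<lambda>\<close> into \<open>-\<lambda>-\<partial>\<close>, and
  the vertex skew-symmetry says that the bracket is skew-adjoint.  Hence skew-symmetry modulo the ideal
  of \<open>J\<close> spreads from the letters \<open>\<partial>\<^sup>0(a)\<close> to all of \<open>F\<close>, and with it the fact that the bracket
  descends to \<open>J\<close>.  The Jacobiator satisfies an exact Leibniz rule in its last argument (the cross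
  terms cancel), and by skew-symmetry it is, modulo the ideal, invariant under the cyclic rotation
  \<open>\<lambda> \<mapsto> \<mu> \<mapsto> -\<lambda>-\<mu>-\<partial>\<close>; so its vanishing on \<open>A\<close> spreads to one argument after the other.
\<close>

section \<open>Linear maps between free modules\<close>

text \<open>On \<open>J\<close> the Leibniz rules cannot serve as a definition, since an element has
  many expressions as a product of symbols; on the free algebra every word has exactly one. The
  price is that the representatives of the brackets are picked without any linearity, so that
  skew-symmetry and Jacobi can only be expected modulo the ideal. This fixes the order of the
  argument: skew-symmetry modulo the ideal needs nothing but stability of the ideal under products,
  derivation and adjoint, so it is available before the bracket is known to descend. Descent in the
  first argument then rests on the generators of the ideal paired with letters of degree 0, and
  descent in the second follows by skew-symmetry. The left Leibniz rule, with its binomial shifts by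
  \<partial>, is the adjoint of a plain multiplication; taking this as the definition of the inner
  actions gives their module laws at once, and binomial sums reappear only when coefficients are
  compared with the axioms. The rotation is needed because only the last argument enters the
  Jacobiator through outer multiplications; rules in the other two would involve shifts.\<close>

definition klin :: "(('x \<Rightarrow>\<^sub>0 'k::comm_ring_1) \<Rightarrow> ('y \<Rightarrow>\<^sub>0 'k)) \<Rightarrow> bool" where
  "klin f \<longleftrightarrow> (\<forall>p q. f (p + q) = f p + f q) \<and> (\<forall>c p. f (pm_smult c p) = pm_smult c (f p))"

definition ext :: "('x \<Rightarrow> ('y \<Rightarrow>\<^sub>0 'k::comm_ring_1)) \<Rightarrow> ('x \<Rightarrow>\<^sub>0 'k) \<Rightarrow> ('y \<Rightarrow>\<^sub>0 'k)" where
  "ext f p = (\<Sum>x\<in>Poly_Mapping.keys p. pm_smult (Poly_Mapping.lookup p x) (f x))"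

definition push :: "('x \<Rightarrow> 'y) \<Rightarrow> ('x \<Rightarrow>\<^sub>0 'k::comm_ring_1) \<Rightarrow> ('y \<Rightarrow>\<^sub>0 'k)" where
  "push h = ext (\<lambda>x. Poly_Mapping.single (h x) 1)"

lemma lookup_pm_smult [simp]:
  "Poly_Mapping.lookup (pm_smult c p) x = c * Poly_Mapping.lookup p x"
  by (simp add: pm_smult_def Poly_Mapping.map.rep_eq when_def)

lemma pm_smult_add_right: "pm_smult c (p + q) = pm_smult c p + pm_smult c q"
  by (rule poly_mapping_eqI) (simp add: lookup_add distrib_left)

lemma pm_smult_add_left: "pm_smult (c + d) p = pm_smult c p + pm_smult d p"
  by (rule poly_mapping_eqI) (simp add: lookup_add distrib_right)

lemma pm_smult_smult: "pm_smult c (pm_smult d p) = pm_smult (c * d) p"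
  by (rule poly_mapping_eqI) (simp add: mult.assoc)

lemma pm_smult_one [simp]: "pm_smult (1::'k::comm_ring_1) p = p"
  by (rule poly_mapping_eqI) simp

lemma pm_smult_zero_left [simp]: "pm_smult 0 p = 0"
  by (rule poly_mapping_eqI) simp

lemma pm_smult_zero_right [simp]: "pm_smult c 0 = 0"
  by (rule poly_mapping_eqI) simp

lemma pm_smult_single [simp]: "pm_smult c (Poly_Mapping.single x d) = Poly_Mapping.single x (c * d)"
  by (simp add: pm_smult_def)

lemma poly_mapping_sum_singles:
  "p = (\<Sum>x\<in>Poly_Mapping.keys p. Poly_Mapping.single x (Poly_Mapping.lookup p x))"
  by (rule poly_mapping_eqI)
    (simp add: lookup_sum lookup_single when_def in_keys_iff)

lemma poly_mapping_single_add_induct [case_names zero single add]: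
  fixes p :: "'x \<Rightarrow>\<^sub>0 'a::comm_monoid_add"
  assumes "P 0" "\<And>x c. P (Poly_Mapping.single x c)" "\<And>p q. P p \<Longrightarrow> P q \<Longrightarrow> P (p + q)"
  shows "P p"
proof -
  have "P (\<Sum>x\<in>S. Poly_Mapping.single x (Poly_Mapping.lookup p x))" for S
    by (induction S rule: infinite_finite_induct) (auto intro: assms)
  then show ?thesis
    using poly_mapping_sum_singles[of p] by metis
qed

interpretation pm: Modules.module "pm_smult :: 'k::comm_ring_1 \<Rightarrow> ('x \<Rightarrow>\<^sub>0 'k) \<Rightarrow> _"
  by standard (simp_all add: pm_smult_add_right pm_smult_add_left pm_smult_smult)

lemma keys_pm_smult: "Poly_Mapping.keys (pm_smult c p) \<subseteq> Poly_Mapping.keys p"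
  by (auto simp: in_keys_iff)

lemma pm_smult_conv_mult: "pm_smult c p = Poly_Mapping.single 0 c * p"
  by (simp add: pm_smult_def mult_map_scale_conv_mult)

lemma single_zero_central: "Poly_Mapping.single 0 c * p = p * Poly_Mapping.single 0 (c::'k::comm_ring_1)"
  by (induction p rule: poly_mapping_single_add_induct)
    (simp_all add: mult_single mult.commute distrib_left distrib_right)

lemma pm_smult_mult_left: "pm_smult c p * q = pm_smult c (p * q)"
  by (simp add: pm_smult_conv_mult mult.assoc)

lemma pm_smult_mult_right: "p * pm_smult c q = pm_smult (c::'k::comm_ring_1) (p * q)"
  using single_zero_central[of c p] by (simp add: pm_smult_conv_mult flip: mult.assoc)

lemma of_nat_mult_conv_smult: "of_nat n * p = pm_smult (of_nat n) (p :: 'x::monoid_add \<Rightarrow>\<^sub>0 'k::comm_ring_1)"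
  by (simp add: pm_smult_conv_mult)

lemma klinI: "(\<And>p q. f (p + q) = f p + f q) \<Longrightarrow> (\<And>c p. f (pm_smult c p) = pm_smult c (f p)) \<Longrightarrow> klin f"
  by (simp add: klin_def)

lemma klin_add: "klin f \<Longrightarrow> f (p + q) = f p + f q"
  by (simp add: klin_def)

lemma klin_smult: "klin f \<Longrightarrow> f (pm_smult c p) = pm_smult c (f p)"
  by (simp add: klin_def)

lemma klin_zero: "klin f \<Longrightarrow> f 0 = 0"
  using klin_add[of f 0 0] by simp

lemma klin_minus: "klin f \<Longrightarrow> f (- p) = - f p"
  using klin_smult[of f "- 1" p] by simp

lemma klin_diff: "klin f \<Longrightarrow> f (p - q) = f p - f q"
  using klin_add[of f p "- q"] by (simp add: klin_minus)

lemma klin_sum: "klin f \<Longrightarrow> f (\<Sum>x\<in>S. g x) = (\<Sum>x\<in>S. f (g x))"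
  by (induction S rule: infinite_finite_induct) (auto simp: klin_zero klin_add)

lemmas klin_simps = klin_add klin_smult klin_zero klin_minus klin_diff

named_theorems klin_intros

lemma klin_id [klin_intros]: "klin (\<lambda>p. p)"
  by (rule klinI) auto

lemma klin_0 [klin_intros]: "klin (\<lambda>p. 0)"
  by (rule klinI) auto

lemma klin_plus [klin_intros]: "klin f \<Longrightarrow> klin g \<Longrightarrow> klin (\<lambda>p. f p + g p)"
  by (rule klinI) (simp_all add: klin_simps algebra_simps pm_smult_add_right)

lemma klin_uminus [klin_intros]: "klin f \<Longrightarrow> klin (\<lambda>p. - f p)"
  by (rule klinI) (simp_all add: klin_simps pm.scale_minus_right)

lemma klin_minus' [klin_intros]: "klin f \<Longrightarrow> klin g \<Longrightarrow> klin (\<lambda>p. f p - g p)"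
  by (rule klinI) (simp_all add: klin_simps algebra_simps pm.scale_right_diff_distrib)

lemma klin_mult_left [klin_intros]: "klin f \<Longrightarrow> klin (\<lambda>p. x * f p)"
  by (rule klinI) (simp_all add: klin_simps distrib_left pm_smult_mult_right)

lemma klin_mult_right [klin_intros]: "klin f \<Longrightarrow> klin (\<lambda>p. f p * x)"
  by (rule klinI) (simp_all add: klin_simps distrib_right pm_smult_mult_left)

lemma klin_pm_smult [klin_intros]: "klin f \<Longrightarrow> klin (\<lambda>p. pm_smult c (f p))"
  by (rule klinI) (simp_all add: klin_simps pm_smult_add_right pm_smult_smult mult.commute)

lemma klin_setsum [klin_intros]: "(\<And>x. x \<in> S \<Longrightarrow> klin (f x)) \<Longrightarrow> klin (\<lambda>p. \<Sum>x\<in>S. f x p)"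
  by (rule klinI) (simp_all add: klin_simps sum.distrib pm.scale_sum_right)

lemma klin_compose: "klin f \<Longrightarrow> klin g \<Longrightarrow> klin (\<lambda>p. f (g p))"
  by (rule klinI) (simp_all add: klin_simps)

lemma klin_funpow: "klin f \<Longrightarrow> klin (f ^^ n)" for f :: "('x \<Rightarrow>\<^sub>0 'k::comm_ring_1) \<Rightarrow> ('x \<Rightarrow>\<^sub>0 'k)"
  by (induction n) (auto simp: klin_def)

lemma klin_ext: "klin (ext f)"
proof (rule klinI)
  fix p q :: "'a \<Rightarrow>\<^sub>0 'b"
  show "ext f (p + q) = ext f p + ext f q"
    unfolding ext_def
    by (rule setsum_keys_plus_distrib) (auto simp: pm_smult_add_left)
next
  fix c and p :: "'a \<Rightarrow>\<^sub>0 'b"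
  have "ext f (pm_smult c p) = (\<Sum>x\<in>Poly_Mapping.keys p. pm_smult (Poly_Mapping.lookup (pm_smult c p) x) (f x))"
    unfolding ext_def
    by (rule sum.mono_neutral_left) (auto simp: keys_pm_smult in_keys_iff)
  then show "ext f (pm_smult c p) = pm_smult c (ext f p)"
    by (simp add: ext_def pm.scale_sum_right pm_smult_smult)
qed

lemma klin_ext_comp [klin_intros]: "klin g \<Longrightarrow> klin (\<lambda>p. ext f (g p))"
  by (rule klin_compose[OF klin_ext])

lemma ext_single [simp]: "ext f (Poly_Mapping.single x c) = pm_smult c (f x)"
  by (simp add: ext_def)

lemma klin_ext_param [klin_intros]: "(\<And>x. klin (\<lambda>p. f x p)) \<Longrightarrow> klin (\<lambda>p. ext (\<lambda>x. f x p) q)"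
  unfolding ext_def by (intro klin_intros)

lemma klin_eqI:
  assumes "klin f" "klin g" and "\<And>x. f (Poly_Mapping.single x 1) = g (Poly_Mapping.single x 1)"
  shows "f p = g p"
proof (induction p rule: poly_mapping_single_add_induct)
  case (single k v)
  show ?case
    using klin_smult[OF assms(1), of v "Poly_Mapping.single k 1"]
      klin_smult[OF assms(2), of v "Poly_Mapping.single k 1"] by (simp add: assms(3))
qed (simp_all add: klin_add klin_zero assms(1,2))

section \<open>Subspaces, and membership tested on generators\<close>

definition ksubspace :: "('x \<Rightarrow>\<^sub>0 'k::comm_ring_1) set \<Rightarrow> bool" where
  "ksubspace S \<longleftrightarrow> 0 \<in> S \<and> (\<forall>p\<in>S. \<forall>q\<in>S. p + q \<in> S) \<and> (\<forall>c. \<forall>p\<in>S. pm_smult c p \<in> S)"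

lemma subspace_add: "ksubspace S \<Longrightarrow> p \<in> S \<Longrightarrow> q \<in> S \<Longrightarrow> p + q \<in> S"
  and subspace_smult: "ksubspace S \<Longrightarrow> p \<in> S \<Longrightarrow> pm_smult c p \<in> S"
  and subspace_zero: "ksubspace S \<Longrightarrow> 0 \<in> S"
  by (auto simp: ksubspace_def)

lemma subspace_minus: "ksubspace S \<Longrightarrow> p \<in> S \<Longrightarrow> - p \<in> S"
  using subspace_smult[of S p "- 1"] by simp

lemma subspace_diff: "ksubspace S \<Longrightarrow> p \<in> S \<Longrightarrow> q \<in> S \<Longrightarrow> p - q \<in> S"
  using subspace_add[of S p "- q"] by (simp add: subspace_minus)

lemma subspace_sum: "ksubspace S \<Longrightarrow> (\<And>x. x \<in> I \<Longrightarrow> f x \<in> S) \<Longrightarrow> (\<Sum>x\<in>I. f x) \<in> S"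
  by (induction I rule: infinite_finite_induct) (auto intro: subspace_zero subspace_add)

lemma subspace_span: "ksubspace (pm.span R)"
  by (simp add: ksubspace_def pm.span_zero pm.span_add pm.span_scale)

lemma klin_memI:
  assumes "klin f" "ksubspace S" and "\<And>x. f (Poly_Mapping.single x 1) \<in> S"
  shows "f p \<in> S"
proof (induction p rule: poly_mapping_single_add_induct)
  case (single k v)
  show ?case
    using klin_smult[OF assms(1), of v "Poly_Mapping.single k 1"]
      subspace_smult[OF assms(2) assms(3), of v k] by simp
qed (simp_all add: klin_add klin_zero subspace_add subspace_zero assms(1,2))

lemma subspace_vimage: "klin f \<Longrightarrow> ksubspace S \<Longrightarrow> ksubspace {p. f p \<in> S}"
  by (auto simp: ksubspace_def klin_simps)

lemma span_mem_vimage: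
  assumes "p \<in> pm.span R" "klin f" "ksubspace S" "\<And>r. r \<in> R \<Longrightarrow> f r \<in> S"
  shows "f p \<in> S"
  using assms(1)
  by (induction rule: pm.span_induct_alt)
    (use assms(2-) in \<open>auto simp: klin_simps intro: subspace_zero subspace_add subspace_smult\<close>)

lemma klin_push: "klin (push h)"
  by (simp add: push_def klin_ext)

lemma klin_push_comp [klin_intros]: "klin g \<Longrightarrow> klin (\<lambda>p. push h (g p))"
  by (rule klin_compose[OF klin_push])

lemma push_single [simp]: "push h (Poly_Mapping.single x c) = Poly_Mapping.single (h x) c"
  by (simp add: push_def)

text \<open>Convolution adds the indices of singles, so a map of index monoids that respects
  addition induces a multiplicative map.\<close>

lemma push_mult:
  assumes "\<And>x y. h (x + y) = h x + h y"
  shows "push h (p * q) = push h p * push h q"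
proof (rule klin_eqI[where f = "\<lambda>p. push h (p * q)" and g = "\<lambda>p. push h p * push h q"])
  fix x
  show "push h (Poly_Mapping.single x 1 * q) = push h (Poly_Mapping.single x 1) * push h q"
    by (rule klin_eqI[of "\<lambda>q. push h (Poly_Mapping.single x 1 * q)"
          "\<lambda>q. push h (Poly_Mapping.single x 1) * push h q"])
      (auto intro!: klin_intros simp: mult_single assms)
qed (intro klin_intros)+

lemma push_one: "h 0 = 0 \<Longrightarrow> push h 1 = 1"
  using push_single[of h 0 1] by simp

lemma ext_ext: "ext f (ext g p) = ext (\<lambda>x. ext f (g x)) p"
  by (rule klin_eqI[where f = "\<lambda>p. ext f (ext g p)" and g = "ext (\<lambda>x. ext f (g x))"])
    (auto intro!: klin_intros klin_ext)

lemma ext_cong: "(\<And>x. x \<in> Poly_Mapping.keys p \<Longrightarrow> f x = g x) \<Longrightarrow> ext f p = ext g p"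
  by (simp add: ext_def)

section \<open>The free algebra and its tensor powers\<close>

abbreviation bas :: "'x \<Rightarrow> ('x \<Rightarrow>\<^sub>0 'k::comm_ring_1)" where
  "bas x \<equiv> Poly_Mapping.single x 1"

lemma klin2_eqI:
  assumes "\<And>q. klin (\<lambda>p. f p q)" "\<And>p. klin (\<lambda>q. f p q)" "\<And>q. klin (\<lambda>p. g p q)" "\<And>p. klin (\<lambda>q. g p q)"
    and "\<And>x y. f (bas x) (bas y) = g (bas x) (bas y)"
  shows "f p q = g p q"
  by (rule klin_eqI[where f = "\<lambda>p. f p q"], fact, fact, rule klin_eqI[where f = "f _"], fact, fact, fact)

lemma klin_funpow_comp [klin_intros]:
  "klin f \<Longrightarrow> klin g \<Longrightarrow> klin (\<lambda>p. (f ^^ n) (g p))" for f :: "('x \<Rightarrow>\<^sub>0 'k::comm_ring_1) \<Rightarrow> ('x \<Rightarrow>\<^sub>0 'k)"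
  by (rule klin_compose[OF klin_funpow])

text \<open>The basis elements \<open>(u, v, n)\<close> and \<open>(u, v, w, m, n)\<close> stand for \<open>u \<otimes> v \<lambda>\<^sup>n\<close> and
  \<open>u \<otimes> v \<otimes> w \<lambda>\<^sup>m \<mu>\<^sup>n\<close>.  The convolution product is componentwise, so that all outer and inner
  module structures are multiplications in one ring.\<close>

type_synonym ('l, 'k) free1 = "'l list \<Rightarrow>\<^sub>0 'k"
type_synonym ('l, 'k) free2 = "('l list \<times> 'l list \<times> nat) \<Rightarrow>\<^sub>0 'k"
type_synonym ('l, 'k) free3 = "('l list \<times> 'l list \<times> 'l list \<times> nat \<times> nat) \<Rightarrow>\<^sub>0 'k"

section \<open>The derivation of the free algebra F\<close>

definition word_der :: "('v \<times> nat) list \<Rightarrow> ('v \<times> nat, 'k::comm_ring_1) free1" where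
  "word_der w = (\<Sum>i<length w. bas (w[i := (fst (w ! i), Suc (snd (w ! i)))]))"

lemma word_der_Nil [simp]: "word_der [] = 0"
  by (simp add: word_der_def)

lemma bas_Nil: "bas [] = 1"
  by (simp flip: zero_list_def)

lemma bas_Cons: "bas (x # u) = bas [x] * bas u"
  by (simp add: mult_single plus_list_def)

lemma word_der_Cons: "word_der (x # u) = bas [(fst x, Suc (snd x))] * bas u + bas [x] * word_der u"
  unfolding word_der_def length_Cons sum.lessThan_Suc_shift
  by (simp add: sum_distrib_left mult_single plus_list_def)

lemma word_der_append: "word_der (u @ v) = word_der u * bas v + bas u * word_der v"
proof (induction u)
  case Nil
  then show ?case by (simp add: bas_Nil)
next
  case (Cons x u)
  have "bas (u @ v) = bas u * (bas v :: ('a \<times> nat, 'b) free1)"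
    by (simp add: mult_single plus_list_def)
  then show ?case
    using Cons by (simp add: word_der_Cons bas_Cons[of x u] distrib_left distrib_right mult.assoc)
qed

lemma free_jet_der_eq: "free_jet_der = ext word_der"
  by (rule ext[THEN fun_cong, rotated] HOL.ext)
    (simp add: free_jet_der_def ext_def word_der_def pm.scale_sum_right)

lemma klin_free_jet_der [klin_intros]: "klin f \<Longrightarrow> klin (\<lambda>p. free_jet_der (f p))"
  unfolding free_jet_der_eq by (intro klin_intros)

lemma free_jet_der_mult: "free_jet_der (p * q) = free_jet_der p * q + p * free_jet_der q"
  by (rule klin2_eqI[where f = "\<lambda>p q. free_jet_der (p * q)"], (intro klin_intros)+)
    (simp add: free_jet_der_eq mult_single plus_list_def word_der_append)

lemma free_jet_der_letter: "free_jet_der (bas [(a, k)]) = bas [(a, Suc k)]"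
  using word_der_Cons[of "(a, k)" "[]"] by (simp add: free_jet_der_eq bas_Nil)

lemma free_jet_der_one: "free_jet_der 1 = 0"
  using free_jet_der_mult[of 1 1] by simp

section \<open>The ring of polynomials in \<lambda> over F \<otimes> F\<close>

definition e1 :: "('l, 'k::comm_ring_1) free1 \<Rightarrow> ('l, 'k) free2" where "e1 = push (\<lambda>u. (u, 0, 0))"
definition e2 :: "('l, 'k::comm_ring_1) free1 \<Rightarrow> ('l, 'k) free2" where "e2 = push (\<lambda>v. (0, v, 0))"
definition lam :: "('l, 'k::comm_ring_1) free2" where "lam = bas (0, 0, 1)"
definition t2 :: "('l, 'k::comm_ring_1) free1 \<Rightarrow> ('l, 'k) free1 \<Rightarrow> nat \<Rightarrow> ('l, 'k) free2" where
  "t2 f g n = e1 f * e2 g * lam ^ n"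

lemma klin_e1 [klin_intros]: "klin f \<Longrightarrow> klin (\<lambda>p. e1 (f p))"
  and klin_e2 [klin_intros]: "klin f \<Longrightarrow> klin (\<lambda>p. e2 (f p))"
  unfolding e1_def e2_def by (intro klin_intros, assumption)+

lemma e1_mult: "e1 (f * g) = e1 f * e1 g" and e2_mult: "e2 (f * g) = e2 f * e2 g"
  unfolding e1_def e2_def by (auto intro!: push_mult)

lemma e1_one [simp]: "e1 1 = 1" and e2_one [simp]: "e2 1 = 1"
  unfolding e1_def e2_def by (auto intro!: push_one simp: zero_prod_def)

lemma e1_e2_commute: "e2 g * e1 f = e1 f * e2 g"
  by (rule klin2_eqI[where f = "\<lambda>f g. e2 g * e1 f"], (intro klin_intros)+)
    (simp add: e1_def e2_def mult_single)

lemma lam_central: "p * lam = lam * p"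
  by (rule klin_eqI[where f = "\<lambda>p. p * lam"], (intro klin_intros)+)
    (auto simp: lam_def mult_single)

lemma lam_left: "p * (lam * q) = lam * (p * q)"
  by (simp flip: mult.assoc add: lam_central[of p])

lemma lam_power_central: "p * lam ^ n = lam ^ n * p"
  by (rule power_commuting_commutes[symmetric]) (simp add: lam_central)

lemma lam_power: "lam ^ n = bas (0, 0, n)"
  by (induction n) (simp_all add: lam_def mult_single flip: zero_prod_def)

lemma t2_bas: "t2 (bas u) (bas v) n = bas (u, v, n)"
  by (simp add: t2_def e1_def e2_def lam_power mult_single)

lemma klin_t2_1 [klin_intros]: "klin f \<Longrightarrow> klin (\<lambda>p. t2 (f p) g n)"
  and klin_t2_2 [klin_intros]: "klin f \<Longrightarrow> klin (\<lambda>p. t2 h (f p) n)"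
  unfolding t2_def by (intro klin_intros, assumption)+

lemma t2_mult: "t2 f g m * t2 f' g' n = t2 (f * f') (g * g') (m + n)"
proof -
  have "t2 f g m * t2 f' g' n = e1 f * (e2 g * ((lam ^ m * (e1 f' * e2 g')) * lam ^ n))"
    by (simp add: t2_def mult.assoc)
  also have "\<dots> = e1 f * (e2 g * (((e1 f' * e2 g') * lam ^ m) * lam ^ n))"
    by (subst lam_power_central[of "e1 f' * e2 g'"]) (rule refl)
  also have "\<dots> = e1 f * ((e2 g * e1 f') * (e2 g' * lam ^ (m + n)))"
    by (simp add: mult.assoc power_add)
  also have "\<dots> = t2 (f * f') (g * g') (m + n)"
    by (simp add: e1_e2_commute t2_def e1_mult e2_mult mult.assoc)
  finally show ?thesis .
qed

lemma t2_lam_power: "lam ^ n * t2 f g 0 = t2 f g n"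
  by (simp add: t2_def lam_power_central)

lemma e1_conv_t2: "e1 f = t2 f 1 0" and e2_conv_t2: "e2 f = t2 1 f 0" and lam_conv_t2: "lam = t2 1 1 1"
  by (simp_all add: t2_def)

lemma t2_arith: "e1 b * t2 f g n = t2 (b * f) g n" "t2 f g n * e1 b = t2 (f * b) g n"
  "e2 b * t2 f g n = t2 f (b * g) n" "t2 f g n * e2 b = t2 f (g * b) n"
  "lam * t2 f g n = t2 f g (Suc n)" "t2 f g n * lam = t2 f g (Suc n)"
  by (simp_all add: e1_conv_t2 e2_conv_t2 lam_conv_t2 t2_mult)

text \<open>Testing on \<open>t2 f g n\<close> with arbitrary \<open>f\<close> and \<open>g\<close>,
  rather than on words, keeps products and derivatives within one family, so that
  \<open>t2_arith\<close> and \<open>der2_t2\<close> can rewrite them.\<close>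

lemma free2_eqI:
  assumes "klin F" "klin G" "\<And>f g n. F (t2 f g n) = G (t2 f g n)"
  shows "F p = G p"
proof (rule klin_eqI[OF assms(1,2)])
  fix x show "F (bas x) = G (bas x)"
    by (cases x rule: prod_cases3) (simp add: assms(3) flip: t2_bas)
qed

lemma free2_memI:
  assumes "klin F" "ksubspace S" "\<And>f g n. F (t2 f g n) \<in> S"
  shows "F p \<in> S"
proof (rule klin_memI[OF assms(1,2)])
  fix x show "F (bas x) \<in> S"
    by (cases x rule: prod_cases3) (simp add: assms(3) flip: t2_bas)
qed

text \<open>Here \<open>F\<close> is evaluated on words only; where it is linear in its first two
  arguments, \<open>ext2_t2\<close> recovers its values at arbitrary elements.\<close>

definition ext2 :: "(('l, 'k::comm_ring_1) free1 \<Rightarrow> ('l, 'k) free1 \<Rightarrow> nat \<Rightarrow> ('y \<Rightarrow>\<^sub>0 'k)) \<Rightarrow> ('l, 'k) free2 \<Rightarrow> ('y \<Rightarrow>\<^sub>0 'k)" where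
  "ext2 F = ext (\<lambda>(u, v, n). F (bas u) (bas v) n)"

lemma klin_ext2 [klin_intros]: "klin f \<Longrightarrow> klin (\<lambda>p. ext2 F (f p))"
  unfolding ext2_def by (intro klin_intros)

lemma klin_ext2_param [klin_intros]:
  "(\<And>f g n. klin (\<lambda>p. F p f g n)) \<Longrightarrow> klin (\<lambda>p. ext2 (F p) q)"
  unfolding ext2_def split_def by (intro klin_intros)

lemma ext2_t2:
  assumes "\<And>g n. klin (\<lambda>f. F f g n)" "\<And>f n. klin (\<lambda>g. F f g n)"
  shows "ext2 F (t2 f g n) = F f g n"
  by (rule klin2_eqI[where f = "\<lambda>f g. ext2 F (t2 f g n)"], (intro klin_intros assms)+)
    (simp add: t2_bas ext2_def)

type_synonym 'v letter = "'v \<times> nat"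

definition der2 :: "('v letter, 'k::field_char_0) free2 \<Rightarrow> ('v letter, 'k) free2" where
  "der2 = ext2 (\<lambda>f g n. t2 (free_jet_der f) g n + t2 f (free_jet_der g) n)"

lemma klin_der2 [klin_intros]: "klin f \<Longrightarrow> klin (\<lambda>p. der2 (f p))"
  unfolding der2_def by (intro klin_intros)

lemma der2_t2: "der2 (t2 f g n) = t2 (free_jet_der f) g n + t2 f (free_jet_der g) n"
  unfolding der2_def by (rule ext2_t2) (intro klin_intros)+

lemma t2_add: "t2 (f + f') g n = t2 f g n + t2 f' g n" "t2 f (g + g') n = t2 f g n + t2 f g' n"
  by (simp_all add: t2_def klin_add[OF klin_e1[OF klin_id]] klin_add[OF klin_e2[OF klin_id]] algebra_simps)

lemma der2_mult: "der2 (p * q) = der2 p * q + p * der2 q"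
proof (rule free2_eqI[where F = "\<lambda>p. der2 (p * q)"], (intro klin_intros)+, rename_tac f g n)
  fix f g n
  show "der2 (t2 f g n * q) = der2 (t2 f g n) * q + t2 f g n * der2 q"
    by (rule free2_eqI[where F = "\<lambda>q. der2 (t2 f g n * q)"], (intro klin_intros)+)
      (simp add: der2_t2 t2_mult free_jet_der_mult t2_add algebra_simps)
qed

lemma der2_e1: "der2 (e1 f) = e1 (free_jet_der f)" and der2_e2: "der2 (e2 f) = e2 (free_jet_der f)"
  and der2_lam: "der2 lam = 0"
  by (simp_all add: e1_conv_t2 e2_conv_t2 lam_conv_t2 der2_t2 free_jet_der_one)
    (simp_all add: t2_def klin_zero[OF klin_e1[OF klin_id]] klin_zero[OF klin_e2[OF klin_id]])

text \<open>The operator \<partial> + \<lambda> by which the bracket answers a derivative of its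
  second argument.\<close>

definition dlam :: "('v letter, 'k::field_char_0) free2 \<Rightarrow> ('v letter, 'k) free2" where
  "dlam p = der2 p + lam * p"

lemma klin_dlam [klin_intros]: "klin f \<Longrightarrow> klin (\<lambda>p. dlam (f p))"
  unfolding dlam_def by (intro klin_intros)

lemma klin_dlam': "klin dlam"
  by (rule klin_dlam[OF klin_id])

lemma dlam_e1_mult: "dlam (e1 f * p) = e1 f * dlam p + e1 (free_jet_der f) * p"
  by (simp add: dlam_def der2_mult der2_e1 algebra_simps lam_left[of "e1 f"])

lemma dlam_mult_e2: "dlam (p * e2 f) = dlam p * e2 f + p * e2 (free_jet_der f)"
  by (simp add: dlam_def der2_mult der2_e2 algebra_simps)

lemma dlam_lam: "dlam (lam * p) = lam * dlam p"
  by (simp add: dlam_def der2_mult der2_lam algebra_simps)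

abbreviation ndlam :: "('v letter, 'k::field_char_0) free2 \<Rightarrow> ('v letter, 'k) free2" where
  "ndlam \<equiv> \<lambda>p. - dlam p"

lemma ndlam_pow_lam: "(ndlam ^^ n) (lam * p) = lam * (ndlam ^^ n) p"
  by (induction n arbitrary: p) (simp_all add: dlam_lam)

lemma ndlam_pow_neg: "(ndlam ^^ n) (- p) = - (ndlam ^^ n) p"
  by (rule klin_minus[where f = "ndlam ^^ n"]) (intro klin_funpow klin_intros)

lemma ndlam_pow_dlam: "dlam ((ndlam ^^ n) p) = (ndlam ^^ n) (dlam p)"
  using funpow_swap1[of ndlam n p] by (simp add: ndlam_pow_neg)

text \<open>The formal adjoint \<open>\<Sum> d\<^sub>n \<lambda>\<^sup>n \<mapsto> \<Sum> (-\<lambda>-\<partial>)\<^sup>n d\<^sub>n\<^sup>\<sigma>\<close>.\<close>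

definition star :: "('v letter, 'k::field_char_0) free2 \<Rightarrow> ('v letter, 'k) free2" where
  "star = ext2 (\<lambda>f g n. (ndlam ^^ n) (t2 g f 0))"

lemma klin_star [klin_intros]: "klin f \<Longrightarrow> klin (\<lambda>p. star (f p))"
  unfolding star_def by (intro klin_intros)

lemma star_t2: "star (t2 f g n) = (ndlam ^^ n) (t2 g f 0)"
  unfolding star_def by (rule ext2_t2) (intro klin_intros)+

lemma star_e1_e2: "star (t2 f g 0) = t2 g f 0"
  by (simp add: star_t2)

lemma star_lam: "star (lam * p) = - dlam (star p)"
  by (rule free2_eqI[where F = "\<lambda>p. star (lam * p)"], (intro klin_intros)+)
    (simp add: t2_arith star_t2)

text \<open>The derivatives of the two factors cancel against those contained in \<partial> +
  \<lambda>, and only -\<lambda> survives. Thus the adjoint exchanges left and right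
  sesquilinearity.\<close>

lemma star_dlam: "star (dlam p) = - (lam * star p)"
proof (rule free2_eqI[where F = "\<lambda>p. star (dlam p)"], (intro klin_intros)+, rename_tac f g n)
  fix f g n
  have "star (dlam (t2 f g n)) = (ndlam ^^ n) (t2 g (free_jet_der f) 0) + (ndlam ^^ n) (t2 (free_jet_der g) f 0)
     + (ndlam ^^ Suc n) (t2 g f 0)"
    unfolding dlam_def der2_t2 t2_arith klin_add[OF klin_star[OF klin_id]] star_t2 ..
  also have "\<dots> = (ndlam ^^ n) (t2 g (free_jet_der f) 0 + t2 (free_jet_der g) f 0 - dlam (t2 g f 0))"
    by (simp add: ndlam_pow_dlam klin_simps[OF klin_funpow[OF klin_uminus[OF klin_dlam']]])
  also have "t2 g (free_jet_der f) 0 + t2 (free_jet_der g) f 0 - dlam (t2 g f 0) = - (lam * t2 g f 0)"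
    by (simp add: dlam_def der2_t2)
  finally show "star (dlam (t2 f g n)) = - (lam * star (t2 f g n))"
    by (simp add: ndlam_pow_neg ndlam_pow_lam star_t2)
qed

lemma star_ndlam_pow: "star ((ndlam ^^ n) p) = lam ^ n * star p"
  by (induction n) (simp_all add: klin_minus[OF klin_star[OF klin_id]] star_dlam mult.assoc)

text \<open>By \<open>star_dlam\<close> the second adjoint turns each factor \<open>ndlam\<close>
  produced by the first one back into \<open>lam\<close>.\<close>

lemma star_star [simp]: "star (star p) = p"
proof (rule free2_eqI[where F = "\<lambda>p. star (star p)" and G = "\<lambda>p. p"], (intro klin_intros)+, rename_tac f g n)
  fix f g n
  show "star (star (t2 f g n)) = t2 f g n"
    by (simp add: star_t2[of f] star_ndlam_pow star_e1_e2 t2_lam_power)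
qed

text \<open>The twisted inner actions \<open>p\<^bsub>\<lambda>+\<partial>\<^esub> *\<^sub>1 b\<close> and \<open>a *\<^sub>1 p\<^bsub>\<lambda>+\<partial>\<^esub>\<close>, where \<open>\<partial>\<close> acts on \<open>b\<close> and \<open>a\<close>: they
  are the adjoints of the outer actions.\<close>

definition inr :: "('v letter, 'k::field_char_0) free1 \<Rightarrow> ('v letter, 'k) free2 \<Rightarrow> ('v letter, 'k) free2" where
  "inr b p = star (star p * e2 b)"

definition inl :: "('v letter, 'k::field_char_0) free1 \<Rightarrow> ('v letter, 'k) free2 \<Rightarrow> ('v letter, 'k) free2" where
  "inl a p = star (e1 a * star p)"

lemma klin_inr [klin_intros]: "klin f \<Longrightarrow> klin (\<lambda>p. inr b (f p))"
  and klin_inr' [klin_intros]: "klin g \<Longrightarrow> klin (\<lambda>p. inr (g p) q)"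
  and klin_inl [klin_intros]: "klin f \<Longrightarrow> klin (\<lambda>p. inl b (f p))"
  and klin_inl' [klin_intros]: "klin g \<Longrightarrow> klin (\<lambda>p. inl (g p) q)"
  unfolding inr_def inl_def by (intro klin_intros, assumption)+

text \<open>Adjacent adjoints cancel by \<open>star_star\<close>, which leaves associativity of the
  ring; the shifts by \<partial> require no computation.\<close>

lemma inr_inr: "inr b (inr a p) = inr (a * b) p"
  and inl_inl: "inl a (inl b p) = inl (a * b) p"
  and inl_inr: "inl a (inr b p) = inr b (inl a p)"
  by (simp_all add: inr_def inl_def e1_mult e2_mult mult.assoc)

lemma inr_one [simp]: "inr 1 p = p" and inl_one [simp]: "inl 1 p = p"
  by (simp_all add: inr_def inl_def)

lemma star_e1_mult: "star (e1 b * p) = inl b (star p)" and star_mult_e2: "star (p * e2 b) = inr b (star p)"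
  by (simp_all add: inl_def inr_def)

lemma inr_t2: "inr b (t2 f g 0) = t2 (f * b) g 0"
  and inl_t2: "inl b (t2 f g 0) = t2 f (b * g) 0"
  by (simp_all add: inr_def inl_def star_e1_e2 t2_arith)

text \<open>Moving a single \<lambda> past an inner action costs one derivative of the acting
  element. Iterated, this is the binomial sum of the left Leibniz axiom
  (\<open>shift_binomial\<close>).\<close>

lemma inr_lam: "inr b (lam * p) = lam * inr b p + inr (free_jet_der b) p"
  and inl_lam: "inl b (lam * p) = lam * inl b p + inl (free_jet_der b) p"
  for p :: "('v letter, 'k::field_char_0) free2"
proof -
  \<comment> \<open>Multiplication by \<lambda> is conjugate under \<open>star\<close> to
    -\<lambda>-\<partial>, so the claim becomes the product rule for \<open>dlam\<close>.\<close>
  have *: "lam * p = star (- dlam (star p))" for p :: "('v letter, 'k) free2"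
    by (simp add: klin_simps[OF klin_star[OF klin_id]] star_dlam)
  show "inr b (lam * p) = lam * inr b p + inr (free_jet_der b) p"
    by (simp add: inr_def star_lam *[of "star _"] dlam_mult_e2 klin_simps[OF klin_star[OF klin_id]])
  show "inl b (lam * p) = lam * inl b p + inl (free_jet_der b) p"
    by (simp add: inl_def star_lam *[of "star _"] dlam_e1_mult klin_simps[OF klin_star[OF klin_id]] algebra_simps)
qed

lemma inr_dlam: "inr b (dlam p) = dlam (inr b p)" and inl_dlam: "inl b (dlam p) = dlam (inl b p)"
  for p :: "('v letter, 'k::field_char_0) free2"
proof -
  have *: "dlam (star p) = - star (lam * p)" for p :: "('v letter, 'k) free2"
    by (simp add: star_lam)
  show "inr b (dlam p) = dlam (inr b p)" "inl b (dlam p) = dlam (inl b p)"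
    by (simp_all add: inr_def inl_def * star_dlam klin_simps[OF klin_star[OF klin_id]] mult.assoc
        lam_left[of "e1 _"])
qed

text \<open>The derivatives hidden in an inner action fall on the acting element alone, so the outer
  actions commute with it. This is what makes the two Leibniz rules compatible.\<close>

lemma inr_e1_mult: "inr b (e1 c * p) = e1 c * inr b p"
  and inr_mult_e2: "inr b (p * e2 c) = inr b p * e2 c"
  and inl_e1_mult: "inl b (e1 c * p) = e1 c * inl b p"
  and inl_mult_e2: "inl b (p * e2 c) = inl b p * e2 c"
  for p :: "('v letter, 'k::field_char_0) free2"
proof -
  have Suc: "t2 f g (Suc n) = lam * t2 f g n" for f g :: "('v letter, 'k) free1" and n
    by (simp add: t2_arith)
  \<comment> \<open>The acting element is generalised because \<open>inr_lam\<close> replaces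
    \<open>b\<close> by its derivative in the step from \<open>n\<close> to
    \<open>Suc n\<close>.\<close>
  have 1: "inr b (e1 c * t2 f g n) = e1 c * inr b (t2 f g n)" for b f g n
    by (induction n arbitrary: b) (simp_all add: t2_arith(1) inr_t2 Suc lam_left[of "e1 c"] inr_lam mult.assoc distrib_left)
  have 2: "inr b (t2 f g n * e2 c) = inr b (t2 f g n) * e2 c" for b f g n
    by (induction n arbitrary: b) (simp_all add: t2_arith(4) inr_t2 Suc inr_lam mult.assoc distrib_right)
  have 3: "inl b (e1 c * t2 f g n) = e1 c * inl b (t2 f g n)" for b f g n
    by (induction n arbitrary: b) (simp_all add: t2_arith(1) inl_t2 Suc lam_left[of "e1 c"] inl_lam mult.assoc distrib_left)
  have 4: "inl b (t2 f g n * e2 c) = inl b (t2 f g n) * e2 c" for b f g n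
    by (induction n arbitrary: b) (simp_all add: t2_arith(4) inl_t2 Suc inl_lam mult.assoc distrib_right)
  show "inr b (e1 c * p) = e1 c * inr b p"
    by (rule free2_eqI[where F = "\<lambda>p. inr b (e1 c * p)"]) (intro klin_intros 1)+
  show "inr b (p * e2 c) = inr b p * e2 c"
    by (rule free2_eqI[where F = "\<lambda>p. inr b (p * e2 c)"]) (intro klin_intros 2)+
  show "inl b (e1 c * p) = e1 c * inl b p"
    by (rule free2_eqI[where F = "\<lambda>p. inl b (e1 c * p)"]) (intro klin_intros 3)+
  show "inl b (p * e2 c) = inl b p * e2 c"
    by (rule free2_eqI[where F = "\<lambda>p. inl b (p * e2 c)"]) (intro klin_intros 4)+
qed

section \<open>The ring of polynomials in \<lambda> and \<mu> over F \<otimes> F \<otimes> F\<close>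

definition j12 :: "('l, 'k::comm_ring_1) free2 \<Rightarrow> ('l, 'k) free3" where
  "j12 = push (\<lambda>(u, v, m). (u, v, 0, m, 0))"
definition i3 :: "('l, 'k::comm_ring_1) free1 \<Rightarrow> ('l, 'k) free3" where
  "i3 = push (\<lambda>w. (0, 0, w, 0, 0))"
definition mu :: "('l, 'k::comm_ring_1) free3" where "mu = bas (0, 0, 0, 0, 1)"
definition t3 :: "('l, 'k::comm_ring_1) free1 \<Rightarrow> ('l, 'k) free1 \<Rightarrow> ('l, 'k) free1 \<Rightarrow> nat \<Rightarrow> nat \<Rightarrow> ('l, 'k) free3" where
  "t3 f g h m n = j12 (t2 f g m) * i3 h * mu ^ n"
definition i1 :: "('l, 'k::comm_ring_1) free1 \<Rightarrow> ('l, 'k) free3" where "i1 f = j12 (e1 f)"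
definition i2 :: "('l, 'k::comm_ring_1) free1 \<Rightarrow> ('l, 'k) free3" where "i2 f = j12 (e2 f)"
definition lam3 :: "('l, 'k::comm_ring_1) free3" where "lam3 = j12 lam"

lemma klin_j12 [klin_intros]: "klin f \<Longrightarrow> klin (\<lambda>p. j12 (f p))"
  and klin_i3 [klin_intros]: "klin g \<Longrightarrow> klin (\<lambda>p. i3 (g p))"
  unfolding j12_def i3_def by (intro klin_intros, assumption)+

lemma j12_mult: "j12 (p * q) = j12 p * j12 q" and i3_mult: "i3 (f * g) = i3 f * i3 g"
  unfolding j12_def i3_def by (auto intro!: push_mult)

lemma j12_one [simp]: "j12 1 = 1" and i3_one [simp]: "i3 1 = 1"
  unfolding j12_def i3_def by (auto intro!: push_one simp: zero_prod_def)

lemma i3_j12_commute: "i3 h * j12 p = j12 p * i3 h"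
  by (rule klin2_eqI[where f = "\<lambda>h p. i3 h * j12 p"], (intro klin_intros)+)
    (auto simp: j12_def i3_def mult_single)

lemma mu_central: "p * mu = mu * p"
  by (rule klin_eqI[where f = "\<lambda>p. p * mu"], (intro klin_intros)+)
    (auto simp: mu_def mult_single)

lemma mu_power_central: "p * mu ^ n = mu ^ n * p"
  by (rule power_commuting_commutes[symmetric]) (simp add: mu_central)

lemma mu_power: "mu ^ n = bas (0, 0, 0, 0, n)"
  by (induction n) (simp_all add: mu_def mult_single flip: zero_prod_def)

lemma t3_bas: "t3 (bas u) (bas v) (bas w) m n = bas (u, v, w, m, n)"
  by (simp add: t3_def t2_bas j12_def i3_def mu_power mult_single)

lemma klin_t3 [klin_intros]:
  "klin f \<Longrightarrow> klin (\<lambda>p. t3 (f p) g h m n)"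
  "klin f \<Longrightarrow> klin (\<lambda>p. t3 g (f p) h m n)"
  "klin f \<Longrightarrow> klin (\<lambda>p. t3 g h (f p) m n)"
  unfolding t3_def by (intro klin_intros, assumption)+

lemma t3_mult: "t3 f g h m n * t3 f' g' h' m' n' = t3 (f * f') (g * g') (h * h') (m + m') (n + n')"
proof -
  let ?p = "t2 f g m" and ?q = "t2 f' g' m'"
  have "t3 f g h m n * t3 f' g' h' m' n' = j12 ?p * (i3 h * ((mu ^ n * (j12 ?q * i3 h')) * mu ^ n'))"
    by (simp add: t3_def mult.assoc)
  also have "\<dots> = j12 ?p * (i3 h * (((j12 ?q * i3 h') * mu ^ n) * mu ^ n'))"
    by (subst mu_power_central[of "j12 ?q * i3 h'"]) (rule refl)
  also have "\<dots> = j12 ?p * ((i3 h * j12 ?q) * (i3 h' * mu ^ (n + n')))"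
    by (simp add: mult.assoc power_add)
  also have "\<dots> = t3 (f * f') (g * g') (h * h') (m + m') (n + n')"
    by (simp add: i3_j12_commute t3_def j12_mult i3_mult mult.assoc flip: t2_mult)
  finally show ?thesis .
qed

lemma conv_t3: "i1 f = t3 f 1 1 0 0" "i2 f = t3 1 f 1 0 0" "i3 f = t3 1 1 f 0 0"
  "lam3 = t3 1 1 1 1 0" "mu = t3 1 1 1 0 1"
  by (simp_all add: t3_def t2_def i1_def i2_def lam3_def)

lemma t3_arith:
  "i1 b * t3 f g h m n = t3 (b * f) g h m n" "t3 f g h m n * i1 b = t3 (f * b) g h m n"
  "i2 b * t3 f g h m n = t3 f (b * g) h m n" "t3 f g h m n * i2 b = t3 f (g * b) h m n"
  "i3 b * t3 f g h m n = t3 f g (b * h) m n" "t3 f g h m n * i3 b = t3 f g (h * b) m n"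
  "lam3 * t3 f g h m n = t3 f g h (Suc m) n" "t3 f g h m n * lam3 = t3 f g h (Suc m) n"
  "mu * t3 f g h m n = t3 f g h m (Suc n)" "t3 f g h m n * mu = t3 f g h m (Suc n)"
  by (simp_all add: conv_t3 t3_mult)

lemma t3_powers: "lam3 ^ k * t3 f g h m n = t3 f g h (k + m) n" "mu ^ k * t3 f g h m n = t3 f g h m (k + n)"
  by (induction k) (simp_all add: mult.assoc t3_arith)

lemma j12_t2: "j12 (t2 f g n) = t3 f g 1 n 0"
  by (simp add: t3_def)

lemma free3_eqI:
  assumes "klin F" "klin G" "\<And>f g h m n. F (t3 f g h m n) = G (t3 f g h m n)"
  shows "F p = G p"
proof (rule klin_eqI[OF assms(1,2)])
  fix x show "F (bas x) = G (bas x)"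
    by (cases x rule: prod_cases5) (simp add: assms(3) flip: t3_bas)
qed

lemma free3_memI:
  assumes "klin F" "ksubspace S" "\<And>f g h m n. F (t3 f g h m n) \<in> S"
  shows "F p \<in> S"
proof (rule klin_memI[OF assms(1,2)])
  fix x show "F (bas x) \<in> S"
    by (cases x rule: prod_cases5) (simp add: assms(3) flip: t3_bas)
qed

lemma lam3_central: "p * lam3 = lam3 * p"
  by (rule free3_eqI[where F = "\<lambda>p. p * lam3"], (intro klin_intros)+) (simp add: t3_arith)

lemma lam3_power_central: "p * lam3 ^ n = lam3 ^ n * p"
  by (rule power_commuting_commutes[symmetric]) (simp add: lam3_central)

lemma lam3_left: "p * (lam3 * q) = lam3 * (p * q)" and mu_left: "p * (mu * q) = mu * (p * q)"
  by (simp_all flip: mult.assoc add: lam3_central[of p] mu_central[of p])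

lemma lam3_pow_left: "p * (lam3 ^ n * q) = lam3 ^ n * (p * q)"
  by (simp flip: mult.assoc add: lam3_power_central[of p])

definition ext3 :: "(('l, 'k::comm_ring_1) free1 \<Rightarrow> ('l, 'k) free1 \<Rightarrow> ('l, 'k) free1 \<Rightarrow> nat \<Rightarrow> nat \<Rightarrow> ('y \<Rightarrow>\<^sub>0 'k))
    \<Rightarrow> ('l, 'k) free3 \<Rightarrow> ('y \<Rightarrow>\<^sub>0 'k)" where
  "ext3 F = ext (\<lambda>(u, v, w, m, n). F (bas u) (bas v) (bas w) m n)"

lemma klin_ext3 [klin_intros]: "klin f \<Longrightarrow> klin (\<lambda>p. ext3 F (f p))"
  unfolding ext3_def by (intro klin_intros)

lemma ext3_t3:
  assumes "\<And>g h m n. klin (\<lambda>f. F f g h m n)" "\<And>f h m n. klin (\<lambda>g. F f g h m n)"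
    "\<And>f g m n. klin (\<lambda>h. F f g h m n)"
  shows "ext3 F (t3 f g h m n) = F f g h m n"
proof -
  have 1: "ext3 F (t3 (bas u) (bas v) h m n) = F (bas u) (bas v) h m n" for u v h
    by (rule klin_eqI[where f = "\<lambda>h. ext3 F (t3 (bas u) (bas v) h m n)"], (intro klin_intros assms)+)
      (simp add: t3_bas ext3_def)
  show ?thesis
    by (rule klin2_eqI[where f = "\<lambda>f g. ext3 F (t3 f g h m n)"]) (intro klin_intros assms 1)+
qed

text \<open>The variable is renamed to \<mu> because a bracket in the last two factors occurs as
  \<open>{{b\<^sub>\<mu> -}}\<close>.\<close>

definition j23 :: "('l, 'k::comm_ring_1) free2 \<Rightarrow> ('l, 'k) free3" where
  "j23 = ext2 (\<lambda>f g n. t3 1 f g 0 n)"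

lemma klin_j23 [klin_intros]: "klin f \<Longrightarrow> klin (\<lambda>p. j23 (f p))"
  unfolding j23_def by (intro klin_intros)

lemma j23_t2: "j23 (t2 f g n) = t3 1 f g 0 n"
  unfolding j23_def by (rule ext2_t2) (intro klin_intros)+

lemma j23_mult: "j23 (p * q) = j23 p * j23 q"
proof (rule free2_eqI[where F = "\<lambda>p. j23 (p * q)"], (intro klin_intros)+, rename_tac f g n)
  fix f g n
  show "j23 (t2 f g n * q) = j23 (t2 f g n) * j23 q"
    by (rule free2_eqI[where F = "\<lambda>q. j23 (t2 f g n * q)"], (intro klin_intros)+)
      (simp add: j23_t2 t2_mult t3_mult)
qed

lemma j12_e1: "j12 (e1 f) = i1 f" and j12_e2: "j12 (e2 f) = i2 f" and j12_lam: "j12 lam = lam3"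
  and j23_e1: "j23 (e1 f) = i2 f" and j23_e2: "j23 (e2 f) = i3 f" and j23_lam: "j23 lam = mu"
  by (simp_all add: i1_def i2_def lam3_def) (simp_all add: e1_conv_t2 e2_conv_t2 lam_conv_t2 j23_t2 conv_t3 j12_t2)

definition der3 :: "('v letter, 'k::field_char_0) free3 \<Rightarrow> ('v letter, 'k) free3" where
  "der3 = ext3 (\<lambda>f g h m n. t3 (free_jet_der f) g h m n + t3 f (free_jet_der g) h m n + t3 f g (free_jet_der h) m n)"

lemma klin_der3 [klin_intros]: "klin f \<Longrightarrow> klin (\<lambda>p. der3 (f p))"
  unfolding der3_def by (intro klin_intros)

lemma der3_t3:
  "der3 (t3 f g h m n) = t3 (free_jet_der f) g h m n + t3 f (free_jet_der g) h m n + t3 f g (free_jet_der h) m n"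
  unfolding der3_def by (rule ext3_t3) (intro klin_intros)+

lemma t3_add: "t3 (f + f') g h m n = t3 f g h m n + t3 f' g h m n"
  "t3 f (g + g') h m n = t3 f g h m n + t3 f g' h m n"
  "t3 f g (h + h') m n = t3 f g h m n + t3 f g h' m n"
  by (rule klin_add[OF klin_t3(1)[OF klin_id]] klin_add[OF klin_t3(2)[OF klin_id]] klin_add[OF klin_t3(3)[OF klin_id]])+

lemma t3_zero: "t3 0 g h m n = 0" "t3 f 0 h m n = 0" "t3 f g 0 m n = 0"
  by (rule klin_zero[OF klin_t3(1)[OF klin_id]] klin_zero[OF klin_t3(2)[OF klin_id]] klin_zero[OF klin_t3(3)[OF klin_id]])+

lemma der3_mult: "der3 (p * q) = der3 p * q + p * der3 q"
proof (rule free3_eqI[where F = "\<lambda>p. der3 (p * q)"], (intro klin_intros)+, rename_tac f g h m n)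
  fix f g h m n
  show "der3 (t3 f g h m n * q) = der3 (t3 f g h m n) * q + t3 f g h m n * der3 q"
    by (rule free3_eqI[where F = "\<lambda>q. der3 (t3 f g h m n * q)"], (intro klin_intros)+)
      (simp add: der3_t3 t3_mult free_jet_der_mult t3_add algebra_simps)
qed

lemma der3_gens: "der3 (i1 f) = i1 (free_jet_der f)" "der3 (i2 f) = i2 (free_jet_der f)"
  "der3 (i3 f) = i3 (free_jet_der f)" "der3 lam3 = 0" "der3 mu = 0"
  by (simp_all add: conv_t3 der3_t3 free_jet_der_one t3_zero)

lemma der3_j12: "der3 (j12 p) = j12 (der2 p)" and der3_j23: "der3 (j23 p) = j23 (der2 p)"
  for p :: "('v letter, 'k::field_char_0) free2"
  by (rule free2_eqI[where F = "\<lambda>p. der3 (j12 p)"], (intro klin_intros)+)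
    (simp add: j12_t2 der2_t2 der3_t3 klin_add[OF klin_j12[OF klin_id]] free_jet_der_one t3_zero,
     rule free2_eqI[where F = "\<lambda>p. der3 (j23 p)"], (intro klin_intros)+,
     simp add: j23_t2 der2_t2 der3_t3 klin_add[OF klin_j23[OF klin_id]] free_jet_der_one t3_zero)

lemma j23_t2_prod: "j23 (t2 x y n) = i2 x * i3 y * mu ^ n"
  by (simp add: j23_t2 t3_def i2_def e2_conv_t2)

lemma der3_one: "der3 1 = 0"
  using der3_mult[of 1 1] by simp

lemma der3_powers: "der3 (lam3 ^ n) = 0" "der3 (mu ^ n) = 0"
  by (induction n) (simp_all add: der3_one der3_mult der3_gens)

section \<open>The operator -\<lambda>-\<mu>-\<partial> and the cyclic rotation\<close>

definition xi :: "('v letter, 'k::field_char_0) free3 \<Rightarrow> ('v letter, 'k) free3" where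
  "xi p = - (lam3 * p) - mu * p - der3 p"

lemma klin_xi [klin_intros]: "klin f \<Longrightarrow> klin (\<lambda>p. xi (f p))"
  unfolding xi_def by (intro klin_intros)

lemma klin_xi': "klin xi"
  by (rule klin_xi[OF klin_id])

lemma der3_lam3: "der3 (lam3 * p) = lam3 * der3 p" and der3_mu: "der3 (mu * p) = mu * der3 p"
  by (simp_all add: der3_mult der3_gens)

lemma xi_lam3: "xi (lam3 * p) = lam3 * xi p" and xi_mu: "xi (mu * p) = mu * xi p"
  and xi_der3: "xi (der3 p) = der3 (xi p)"
  by (simp_all add: xi_def der3_lam3 der3_mu algebra_simps lam3_left[of mu] klin_simps[OF klin_der3[OF klin_id]])

lemma xi_lam3_pow: "xi (lam3 ^ n * p) = lam3 ^ n * xi p"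
  by (induction n) (simp_all add: xi_lam3 mult.assoc)

lemma xi_pow_der3: "(xi ^^ n) (der3 p) = der3 ((xi ^^ n) p)"
  by (induction n) (simp_all add: xi_lam3 xi_mu xi_der3)

text \<open>The cyclic rotation, with \<open>\<lambda> \<mapsto> \<mu> \<mapsto> -\<lambda>-\<mu>-\<partial>\<close>.\<close>

definition tau :: "('v letter, 'k::field_char_0) free3 \<Rightarrow> ('v letter, 'k) free3" where
  "tau = ext3 (\<lambda>f g h m n. mu ^ m * (xi ^^ n) (t3 h f g 0 0))"

lemma klin_tau [klin_intros]: "klin f \<Longrightarrow> klin (\<lambda>p. tau (f p))"
  unfolding tau_def by (intro klin_intros)

lemma klin_tau': "klin tau"
  by (rule klin_tau[OF klin_id])

lemma tau_t3: "tau (t3 f g h m n) = mu ^ m * (xi ^^ n) (t3 h f g 0 0)"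
  unfolding tau_def by (rule ext3_t3) (intro klin_intros klin_xi')+

lemma tau_lam3: "tau (lam3 * p) = mu * tau p"
  by (rule free3_eqI[where F = "\<lambda>p. tau (lam3 * p)"], (intro klin_intros)+)
    (simp add: t3_arith tau_t3 mult.assoc)

lemma xi_mu_pow: "xi (mu ^ m * p) = mu ^ m * xi p"
  by (induction m) (simp_all add: xi_mu mult.assoc)

lemma tau_mu: "tau (mu * p) = xi (tau p)"
  by (rule free3_eqI[where F = "\<lambda>p. tau (mu * p)"], (intro klin_intros)+)
    (simp add: t3_arith tau_t3 xi_mu_pow)

lemma der3_mu_pow: "der3 (mu ^ m * p) = mu ^ m * der3 p"
  by (induction m) (simp_all add: der3_mu mult.assoc)

lemma tau_der3: "tau (der3 p) = der3 (tau p)"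
  by (rule free3_eqI[where F = "\<lambda>p. tau (der3 p)"], (intro klin_intros)+)
    (simp add: der3_t3 tau_t3 der3_mu_pow klin_add[OF klin_tau'] flip: xi_pow_der3 distrib_left,
     simp add: klin_add[OF klin_funpow[OF klin_xi']] distrib_left)

text \<open>The operators \<lambda>, \<mu> and \<open>xi\<close> add up to -\<partial>, which
  commutes with the rotation; hence the images of \<lambda> and \<mu> determine that of
  \<open>xi\<close>, and the three are permuted cyclically.\<close>

lemma tau_xi: "tau (xi p) = lam3 * tau p"
  by (simp add: xi_def[of p] klin_simps[OF klin_tau'] tau_lam3 tau_mu tau_der3) (simp add: xi_def)

lemma tau_pow: "tau (lam3 ^ n * p) = mu ^ n * tau p" "tau (mu ^ n * p) = (xi ^^ n) (tau p)"
  "tau ((xi ^^ n) p) = lam3 ^ n * tau p"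
  by (induction n) (simp_all add: tau_lam3 tau_mu tau_xi mult.assoc)

lemma tau_tau_t3: "tau (tau (t3 f g h m n)) = lam3 ^ n * (xi ^^ m) (t3 g h f 0 0)"
proof -
  have "tau (tau (t3 f g h m n)) = (xi ^^ m) (lam3 ^ n * t3 g h f 0 0)"
    by (simp add: tau_t3 tau_pow)
  also have "\<dots> = lam3 ^ n * (xi ^^ m) (t3 g h f 0 0)"
    by (induction m) (simp_all add: xi_lam3_pow)
  finally show ?thesis .
qed

lemma tau_tau_tau [simp]: "tau (tau (tau p)) = p"
  by (rule free3_eqI[where F = "\<lambda>p. tau (tau (tau p))" and G = "\<lambda>p. p"], (intro klin_intros)+)
    (simp add: tau_tau_t3 tau_pow tau_t3[of _ _ _ 0 0] t3_powers)

lemma tau_j12_i3: "tau (j12 q * i3 y) = i1 y * j23 q"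
  by (rule free2_eqI[where F = "\<lambda>q. tau (j12 q * i3 y)"], (intro klin_intros)+)
    (simp add: j12_t2 j23_t2 t3_arith tau_t3 t3_powers)

section \<open>Insertion of a middle factor\<close>

definition dlam3 :: "('v letter, 'k::field_char_0) free3 \<Rightarrow> ('v letter, 'k) free3" where
  "dlam3 p = der3 p + lam3 * p"

lemma klin_dlam3 [klin_intros]: "klin f \<Longrightarrow> klin (\<lambda>p. dlam3 (f p))"
  unfolding dlam3_def by (intro klin_intros)

lemma klin_dlam3': "klin dlam3"
  by (rule klin_dlam3[OF klin_id])

lemma klin_i2 [klin_intros]: "klin f \<Longrightarrow> klin (\<lambda>p. i2 (f p))" and klin_i1 [klin_intros]: "klin g \<Longrightarrow> klin (\<lambda>p. i1 (g p))"
  unfolding i2_def i1_def by (intro klin_intros, assumption)+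

lemma dlam3_pow_lam3: "(dlam3 ^^ n) (lam3 * p) = lam3 * (dlam3 ^^ n) p"
  and der3_dlam3_pow: "der3 ((dlam3 ^^ n) p) = (dlam3 ^^ n) (der3 p)"
  by (induction n) (simp_all add: dlam3_def der3_lam3 distrib_left klin_add[OF klin_der3[OF klin_id]])

text \<open>\<open>p\<^bsub>\<lambda>+\<partial>\<^esub> \<otimes>\<^sub>1 y\<close> with \<open>\<partial>\<close> acting on \<open>y\<close>.\<close>

definition mid1 :: "('v letter, 'k::field_char_0) free1 \<Rightarrow> ('v letter, 'k) free2 \<Rightarrow> ('v letter, 'k) free3" where
  "mid1 y = ext2 (\<lambda>f g n. i1 f * i3 g * (dlam3 ^^ n) (i2 y))"

lemma klin_mid1 [klin_intros]: "klin f \<Longrightarrow> klin (\<lambda>p. mid1 y (f p))"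
  unfolding mid1_def by (intro klin_intros)

lemma klin_mid1' [klin_intros]: "klin f \<Longrightarrow> klin (\<lambda>p. mid1 (f p) q)"
  unfolding mid1_def by (intro klin_intros klin_dlam3')

lemma mid1_t2: "mid1 y (t2 f g n) = i1 f * i3 g * (dlam3 ^^ n) (i2 y)"
  unfolding mid1_def by (rule ext2_t2) (intro klin_intros)+

lemma i3_i1_i2_commute: "i3 g * i1 f = i1 f * i3 g" "i3 g * i2 f = i2 f * i3 g" "i2 g * i1 f = i1 f * i2 g"
  by (simp_all add: conv_t3 t3_mult)

lemma mid1_e1_mult: "mid1 y (e1 c * p) = i1 c * mid1 y p"
  by (rule free2_eqI[where F = "\<lambda>p. mid1 y (e1 c * p)"], (intro klin_intros)+)
    (simp add: t2_arith mid1_t2 mult.assoc i1_def e1_mult j12_mult)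

text \<open>All derivatives coming from \<open>dlam3\<close> fall on \<open>y\<close> in the middle
  factor, so their result commutes with the third factor.\<close>

lemma mid1_mult_e2: "mid1 y (p * e2 c) = mid1 y p * i3 c"
proof (rule free2_eqI[where F = "\<lambda>p. mid1 y (p * e2 c)"], (intro klin_intros)+, rename_tac f g n)
  fix f g n
  have "(dlam3 ^^ n) (i2 y) * i3 c = i3 c * (dlam3 ^^ n) (i2 y)"
  proof (induction n arbitrary: y)
    case (Suc n)
    have "(dlam3 ^^ Suc n) (i2 y) = (dlam3 ^^ n) (i2 (free_jet_der y)) + lam3 * (dlam3 ^^ n) (i2 y)"
      by (simp add: funpow_Suc_right dlam3_def[of "i2 y"] der3_gens klin_add[OF klin_funpow[OF klin_dlam3']]
          dlam3_pow_lam3 del: funpow.simps)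
    then show ?case
      by (simp add: Suc distrib_left distrib_right mult.assoc lam3_left[of "i3 c"] del: funpow.simps)
  qed (simp add: i3_i1_i2_commute)
  then show "mid1 y (t2 f g n * e2 c) = mid1 y (t2 f g n) * i3 c"
    by (simp add: t2_arith mid1_t2 mult.assoc i3_mult)
qed

lemma mid1_lam: "mid1 y (lam * p) = lam3 * mid1 y p + mid1 (free_jet_der y) p"
proof (rule free2_eqI[where F = "\<lambda>p. mid1 y (lam * p)"], (intro klin_intros)+, rename_tac f g n)
  fix f g n
  have "(dlam3 ^^ Suc n) (i2 y) = (dlam3 ^^ n) (i2 (free_jet_der y)) + lam3 * (dlam3 ^^ n) (i2 y)"
    by (simp add: funpow_Suc_right dlam3_def[of "i2 y"] der3_gens klin_add[OF klin_funpow[OF klin_dlam3']]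
        dlam3_pow_lam3 del: funpow.simps)
  then show "mid1 y (lam * t2 f g n) = lam3 * mid1 y (t2 f g n) + mid1 (free_jet_der y) (t2 f g n)"
    by (simp add: t2_arith mid1_t2 mult.assoc distrib_left lam3_left[of "i1 f"] lam3_left[of "i3 g"] del: funpow.simps)
qed

lemma der3_mid1: "der3 (mid1 y p) = mid1 y (der2 p) + mid1 (free_jet_der y) p"
  by (rule free2_eqI[where F = "\<lambda>p. der3 (mid1 y p)"], (intro klin_intros)+)
    (simp add: mid1_t2 der2_t2 der3_mult der3_gens der3_dlam3_pow distrib_left distrib_right mult.assoc
      klin_add[OF klin_mid1[OF klin_id]])

text \<open>The substitution \<open>\<lambda> \<mapsto> \<lambda> + \<mu>\<close>.\<close>

definition sumvars :: "('l, 'k::comm_ring_1) free3 \<Rightarrow> ('l, 'k) free3" where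
  "sumvars = ext3 (\<lambda>f g h m n. (lam3 + mu) ^ m * t3 f g h 0 n)"

lemma klin_sumvars [klin_intros]: "klin f \<Longrightarrow> klin (\<lambda>p. sumvars (f p))"
  unfolding sumvars_def by (intro klin_intros)

lemma sumvars_t3: "sumvars (t3 f g h m n) = (lam3 + mu) ^ m * t3 f g h 0 n"
  unfolding sumvars_def by (rule ext3_t3) (intro klin_intros)+

lemma sumvars_lam3: "sumvars (lam3 * p) = (lam3 + mu) * sumvars p"
  by (rule free3_eqI[where F = "\<lambda>p. sumvars (lam3 * p)"], (intro klin_intros)+)
    (simp add: t3_arith sumvars_t3 mult.assoc)

lemma sumvars_i1_mult: "sumvars (i1 c * p) = i1 c * sumvars p"
proof (rule free3_eqI[where F = "\<lambda>p. sumvars (i1 c * p)"], (intro klin_intros)+, rename_tac f g h m n)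
  fix f g h m n
  have "(lam3 + mu) ^ m * i1 c = i1 c * (lam3 + mu) ^ m"
    by (rule power_commuting_commutes) (simp add: distrib_left distrib_right lam3_central mu_central)
  then have "i1 c * ((lam3 + mu) ^ m * q) = (lam3 + mu) ^ m * (i1 c * q)" for q
    by (simp flip: mult.assoc)
  then show "sumvars (i1 c * t3 f g h m n) = i1 c * sumvars (t3 f g h m n)"
    by (simp add: t3_arith(1) sumvars_t3)
qed

lemma sumvars_mult_i3: "sumvars (p * i3 c) = sumvars p * i3 c"
  by (rule free3_eqI[where F = "\<lambda>p. sumvars (p * i3 c)"], (intro klin_intros)+)
    (simp add: t3_arith sumvars_t3 mult.assoc)

lemma der3_sum_pow: "der3 ((lam3 + mu) ^ m * p) = (lam3 + mu) ^ m * der3 p"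
  by (induction m) (simp_all add: mult.assoc distrib_right der3_lam3 der3_mu klin_add[OF klin_der3[OF klin_id]])

lemma der3_sumvars: "der3 (sumvars p) = sumvars (der3 p)"
proof (rule free3_eqI[where F = "\<lambda>p. der3 (sumvars p)"], (intro klin_intros)+, rename_tac f g h m n)
  fix f g h m n
  show "der3 (sumvars (t3 f g h m n)) = sumvars (der3 (t3 f g h m n))"
    by (simp add: der3_sum_pow sumvars_t3 der3_t3 klin_add[OF klin_sumvars[OF klin_id]] distrib_left)
qed

definition mid :: "('v letter, 'k::field_char_0) free1 \<Rightarrow> ('v letter, 'k) free2 \<Rightarrow> ('v letter, 'k) free3" where
  "mid y p = sumvars (mid1 y p)"

lemma klin_mid [klin_intros]: "klin f \<Longrightarrow> klin (\<lambda>p. mid y (f p))"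
  and klin_mid' [klin_intros]: "klin g \<Longrightarrow> klin (\<lambda>p. mid (g p) q)"
  unfolding mid_def by (intro klin_intros, assumption)+

lemma mid_e1_mult: "mid y (e1 c * p) = i1 c * mid y p"
  and mid_mult_e2: "mid y (p * e2 c) = mid y p * i3 c"
  by (simp_all add: mid_def mid1_e1_mult mid1_mult_e2 sumvars_i1_mult sumvars_mult_i3)

text \<open>The derivatives of the outer factors come from \<open>der2\<close> and that of
  \<open>y\<close> from \<open>mid1_lam\<close>; together they form the total derivative. After the
  substitution the operator is \<lambda> + \<mu> + \<partial>, which is minus
  \<open>xi\<close>.\<close>

lemma mid_dlam: "mid y (dlam p) = - xi (mid y p)"
  by (simp add: dlam_def mid_def klin_add[OF klin_mid1[OF klin_id]] mid1_lam xi_def der3_sumvars der3_mid1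
      klin_add[OF klin_sumvars[OF klin_id]] sumvars_lam3 distrib_right)

lemma mid_t2: "mid y (t2 f g 0) = t3 f y g 0 0"
  by (simp add: mid_def mid1_t2 conv_t3 t3_mult sumvars_t3)

lemma mid_ndlam_pow: "mid y ((ndlam ^^ n) p) = (xi ^^ n) (mid y p)"
  by (induction n) (simp_all add: klin_minus[OF klin_mid[OF klin_id]] mid_dlam)

text \<open>Both sides turn the n-th power of \<lambda> into the n-th power of \<open>xi\<close>.
  This is the link between the middle insertion and the rotation, and the reason why the third
  Jacobi term is a rotated first one.\<close>

lemma mid_star: "mid y (star q) = tau (tau (j12 q * i3 y))"
proof (rule free2_eqI[where F = "\<lambda>q. mid y (star q)"], (intro klin_intros)+, rename_tac f g n)
  fix f g n
  show "mid y (star (t2 f g n)) = tau (tau (j12 (t2 f g n) * i3 y))"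
    by (simp add: star_t2 mid_ndlam_pow mid_t2 j12_t2 t3_arith tau_tau_t3)
qed

section \<open>The bracket on the free algebra\<close>

lemma bas_append: "bas u * bas v = bas (u @ v)"
  by (simp add: mult_single plus_list_def)

lemma subspace_equaliser: "klin f \<Longrightarrow> klin g \<Longrightarrow> ksubspace {p. f p = g p}"
  by (auto simp: ksubspace_def klin_simps)

lemma free1_generated_letters:
  fixes S :: "('l, 'k::comm_ring_1) free1 set"
  assumes "ksubspace S" "1 \<in> S" "\<And>f g. f \<in> S \<Longrightarrow> g \<in> S \<Longrightarrow> f * g \<in> S" "\<And>x. bas [x] \<in> S"
  shows "f \<in> S"
proof (rule klin_memI[where f = "\<lambda>f. f", OF klin_id assms(1)])
  show "bas w \<in> S" for w
  proof (induction w)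
    case Nil
    then show ?case using assms(2) by (simp add: bas_Nil)
  next
    case (Cons x w)
    then show ?case using assms(3,4) by (simp add: bas_Cons[of x w])
  qed
qed

text \<open>Reduces a property stable under sums, products and derivation to the letters of degree
  0, where the axioms of the double Poisson algebra are available.\<close>

lemma free1_generated:
  fixes S :: "('v letter, 'k::field_char_0) free1 set"
  assumes "ksubspace S" "1 \<in> S" "\<And>f g. f \<in> S \<Longrightarrow> g \<in> S \<Longrightarrow> f * g \<in> S"
    and "\<And>f. f \<in> S \<Longrightarrow> free_jet_der f \<in> S" "\<And>a. bas [(a, 0)] \<in> S"
  shows "f \<in> S"
proof (rule free1_generated_letters[OF assms(1-3)])
  have "bas [(a, n)] \<in> S" for a n
    by (induction n) (use assms(4,5) in \<open>auto simp flip: free_jet_der_letter\<close>)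
  then show "bas [x] \<in> S" for x by (cases x) simp
qed

section \<open>Extension of a bracket from letters to the free algebra\<close>

locale letter_bracket =
  fixes B :: "'v letter \<Rightarrow> 'v letter \<Rightarrow> ('v letter, 'k::field_char_0) free2"
  assumes B_Suc_left: "B (a, Suc m) y = - (lam * B (a, m) y)"
    and B_Suc_right: "B x (b, Suc n) = dlam (B x (b, n))"
begin

primrec brl :: "'v letter \<Rightarrow> 'v letter list \<Rightarrow> ('v letter, 'k) free2" where
  "brl x [] = 0"
| "brl x (y # v) = B x y * e2 (bas v) + e1 (bas [y]) * brl x v"

definition bletter :: "'v letter \<Rightarrow> ('v letter, 'k) free1 \<Rightarrow> ('v letter, 'k) free2" where
  "bletter x = ext (brl x)"

text \<open>The first argument is unfolded last. For a single letter the right Leibniz rule already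
  holds, and it survives this recursion because inner and outer actions commute.\<close>

primrec brw :: "'v letter list \<Rightarrow> ('v letter, 'k) free1 \<Rightarrow> ('v letter, 'k) free2" where
  "brw [] g = 0"
| "brw (x # u) g = inr (bas u) (bletter x g) + inl (bas [x]) (brw u g)"

definition br :: "('v letter, 'k) free1 \<Rightarrow> ('v letter, 'k) free1 \<Rightarrow> ('v letter, 'k) free2" where
  "br f g = ext (\<lambda>u. brw u g) f"

lemma klin_bletter [klin_intros]: "klin f \<Longrightarrow> klin (\<lambda>p. bletter x (f p))"
  unfolding bletter_def by (intro klin_intros)

lemma klin_brw [klin_intros]: "klin f \<Longrightarrow> klin (\<lambda>p. brw u (f p))"
proof (induction u)
  case Nil
  then show ?case by (simp add: klin_0)
next
  case (Cons x u)
  show ?case unfolding brw.simps by (intro klin_intros Cons)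
qed

lemma klin_br [klin_intros]: "klin f \<Longrightarrow> klin (\<lambda>p. br (f p) q)"
  and klin_br' [klin_intros]: "klin g \<Longrightarrow> klin (\<lambda>p. br q (g p))"
  unfolding br_def by (intro klin_intros, assumption)+

lemmas br_simps = klin_simps[OF klin_br[OF klin_id]] klin_simps[OF klin_br'[OF klin_id]]

lemma brl_append: "brl x (v @ w) = brl x v * e2 (bas w) + e1 (bas v) * brl x w"
proof (induction v)
  case (Cons y v)
  then show ?case
    by (simp add: bas_Cons[of y v] e1_mult e2_mult distrib_left distrib_right mult.assoc flip: bas_append)
qed (simp add: bas_Nil)

lemma bletter_mult: "bletter x (f * g) = bletter x f * e2 g + e1 f * bletter x g"
  by (rule klin2_eqI[where f = "\<lambda>f g. bletter x (f * g)"], (intro klin_intros)+)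
    (simp add: bletter_def bas_append brl_append)

lemma bletter_bas: "bletter x (bas [y]) = B x y"
  by (simp add: bletter_def bas_Nil)

lemma bletter_one: "bletter x 1 = 0"
  using bletter_mult[of x 1 1] by simp

lemma bletter_der: "bletter x (free_jet_der g) = dlam (bletter x g)"
proof -
  let ?S = "{g. bletter x (free_jet_der g) = dlam (bletter x g)}"
  have "g \<in> ?S"
  proof (rule free1_generated_letters)
    show "ksubspace ?S"
      by (rule subspace_equaliser) (intro klin_intros)+
    show "1 \<in> ?S"
      by (simp add: bletter_one free_jet_der_one klin_zero[OF klin_dlam'] klin_zero[OF klin_bletter[OF klin_id]])
  next
    fix f g assume "f \<in> ?S" "g \<in> ?S"
    then show "f * g \<in> ?S"
      by (simp add: free_jet_der_mult bletter_mult klin_add[OF klin_bletter[OF klin_id]] klin_add[OF klin_dlam']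
          dlam_e1_mult dlam_mult_e2)
  next
    show "bas [y] \<in> ?S" for y
      by (cases y) (simp add: free_jet_der_letter bletter_bas B_Suc_right)
  qed
  then show ?thesis by simp
qed

lemma bletter_Suc: "bletter (a, Suc m) g = - (lam * bletter (a, m) g)"
proof -
  let ?S = "{g. bletter (a, Suc m) g = - (lam * bletter (a, m) g)}"
  have "g \<in> ?S"
  proof (rule free1_generated_letters)
    show "ksubspace ?S"
      by (rule subspace_equaliser) (intro klin_intros)+
    show "1 \<in> ?S"
      by (simp add: bletter_one)
  next
    fix f g assume "f \<in> ?S" "g \<in> ?S"
    then show "f * g \<in> ?S"
      by (simp add: bletter_mult lam_left[of "e1 f"] distrib_left mult.assoc)
  next
    show "bas [y] \<in> ?S" for y
      by (simp add: bletter_bas B_Suc_left)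
  qed
  then show ?thesis by simp
qed

lemma inr_add: "inr b (p + q) = inr b p + inr b q" and inl_add: "inl b (p + q) = inl b p + inl b q"
  and inr_add': "inr (b + c) p = inr b p + inr c p" and inl_add': "inl (b + c) p = inl b p + inl c p"
  by (rule klin_add[OF klin_inr[OF klin_id]] klin_add[OF klin_inl[OF klin_id]]
      klin_add[OF klin_inr'[OF klin_id]] klin_add[OF klin_inl'[OF klin_id]])+

lemma inr_neg: "inr b (- p) = - inr b p" and inl_neg: "inl b (- p) = - inl b p"
  by (rule klin_minus[OF klin_inr[OF klin_id]] klin_minus[OF klin_inl[OF klin_id]])+

lemma inr_zero: "inr b 0 = 0" and inl_zero: "inl b 0 = 0"
  by (rule klin_zero[OF klin_inr[OF klin_id]] klin_zero[OF klin_inl[OF klin_id]])+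

lemma brw_mult: "brw u (f * g) = brw u f * e2 g + e1 f * brw u g"
  by (induction u)
    (simp_all add: bletter_mult inr_add inl_add inr_mult_e2 inr_e1_mult inl_mult_e2 inl_e1_mult
      distrib_left distrib_right)

lemma brw_der: "brw u (free_jet_der g) = dlam (brw u g)"
  by (induction u)
    (simp_all add: bletter_der inr_dlam inl_dlam klin_add[OF klin_dlam'] klin_zero[OF klin_dlam'])

lemma brw_append: "brw (u @ v) g = inr (bas v) (brw u g) + inl (bas u) (brw v g)"
proof (induction u)
  case (Cons x u)
  then show ?case
    by (simp add: bas_Cons[of x u] inr_add inl_add inr_inr inl_inl inl_inr flip: bas_append)
qed (simp add: bas_Nil inr_zero)

lemma br_mult_right: "br f (g * h) = br f g * e2 h + e1 g * br f h"
  by (rule klin_eqI[where f = "\<lambda>f. br f (g * h)"], (intro klin_intros)+) (simp add: br_def brw_mult)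

lemma br_der_right: "br f (free_jet_der g) = dlam (br f g)"
  by (rule klin_eqI[where f = "\<lambda>f. br f (free_jet_der g)"], (intro klin_intros)+) (simp add: br_def brw_der)

lemma br_mult_left: "br (f * g) h = inr g (br f h) + inl f (br g h)"
  by (rule klin2_eqI[where f = "\<lambda>f g. br (f * g) h"], (intro klin_intros)+)
    (simp add: br_def bas_append brw_append)

lemma br_letters: "br (bas [x]) (bas [y]) = B x y"
  by (simp add: br_def bas_Nil bletter_bas inl_zero)

lemma br_letter: "br (bas [x]) g = bletter x g"
  by (simp add: br_def bas_Nil inl_zero)

lemma br_one_left: "br 1 g = 0" and br_one_right: "br f 1 = 0"
  using br_mult_left[of 1 1 g] br_mult_right[of f 1 1] by simp_all

text \<open>For a product, the extra terms of \<open>inr_lam\<close> and \<open>inl_lam\<close>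
  cancel those terms of the bracket in which the derivative falls on the factor acting from
  inside.\<close>

lemma br_der_left: "br (free_jet_der f) g = - (lam * br f g)"
proof -
  let ?S = "{f. br (free_jet_der f) g = - (lam * br f g)}"
  have "f \<in> ?S"
  proof (rule free1_generated_letters)
    show "ksubspace ?S"
      by (rule subspace_equaliser) (intro klin_intros)+
    show "1 \<in> ?S"
      by (simp add: free_jet_der_one br_one_left br_simps)
  next
    fix f h assume "f \<in> ?S" "h \<in> ?S"
    then show "f * h \<in> ?S"
      by (simp add: free_jet_der_mult br_mult_left br_simps inr_neg inl_neg inr_lam inl_lam distrib_left)
  next
    show "bas [x] \<in> ?S" for x
      by (cases x) (simp add: free_jet_der_letter br_letter bletter_Suc)
  qed
  then show ?thesis by simp
qed

text \<open>The free versions of \<open>{{a\<^sub>\<lambda> p}}\<^sub>L\<close> and \<open>{{b\<^sub>\<mu> p}}\<^sub>R\<close>, where \<open>p\<close> is a polynomial in \<open>\<mu>\<close>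
  respectively \<open>\<lambda>\<close>, and of \<open>{{p\<^bsub>\<lambda>+\<mu>\<^esub> c}}\<^sub>L\<close>.\<close>

definition brL :: "('v letter, 'k) free1 \<Rightarrow> ('v letter, 'k) free2 \<Rightarrow> ('v letter, 'k) free3" where
  "brL a = ext2 (\<lambda>x y n. j12 (br a x) * i3 y * mu ^ n)"

definition brR :: "('v letter, 'k) free1 \<Rightarrow> ('v letter, 'k) free2 \<Rightarrow> ('v letter, 'k) free3" where
  "brR b = ext2 (\<lambda>x y n. i1 x * j23 (br b y) * lam3 ^ n)"

definition brM :: "('v letter, 'k) free2 \<Rightarrow> ('v letter, 'k) free1 \<Rightarrow> ('v letter, 'k) free3" where
  "brM p c = ext2 (\<lambda>x y n. lam3 ^ n * mid y (br x c)) p"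

lemma klin_brL [klin_intros]: "klin f \<Longrightarrow> klin (\<lambda>p. brL a (f p))"
  and klin_brL' [klin_intros]: "klin h \<Longrightarrow> klin (\<lambda>p. brL (h p) q)"
  and klin_brR [klin_intros]: "klin g \<Longrightarrow> klin (\<lambda>p. brR b (g p))"
  and klin_brR' [klin_intros]: "klin h \<Longrightarrow> klin (\<lambda>p. brR (h p) q)"
  and klin_brM [klin_intros]: "klin f \<Longrightarrow> klin (\<lambda>p. brM (f p) c)"
  and klin_brM' [klin_intros]: "klin h \<Longrightarrow> klin (\<lambda>p. brM q (h p))"
  unfolding brL_def brR_def brM_def by (intro klin_intros, assumption?)+

lemma brL_t2: "brL a (t2 x y n) = j12 (br a x) * i3 y * mu ^ n"
  and brR_t2: "brR b (t2 x y n) = i1 x * j23 (br b y) * lam3 ^ n"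
  and brM_t2: "brM (t2 x y n) c = lam3 ^ n * mid y (br x c)"
  unfolding brL_def brR_def brM_def by (rule ext2_t2; intro klin_intros)+

text \<open>The last summand is the cross term: \<open>a\<close> is paired with \<open>c\<close>
  while \<open>p\<close> is left alone. It has a counterpart in \<open>brR_mult_e2\<close>, and in
  \<open>jac_mult\<close> the two cancel.\<close>

lemma brL_e1_mult: "brL a (e1 c * p) = i1 c * brL a p + j12 (br a c) * j23 p"
  by (rule free2_eqI[where F = "\<lambda>p. brL a (e1 c * p)"], (intro klin_intros)+)
    (simp add: t2_arith(1) brL_t2 br_mult_right klin_add[OF klin_j12[OF klin_id]] j12_mult j12_e1 j12_e2
      j23_t2_prod distrib_right mult.assoc)

lemma brL_mult_e2: "brL a (p * e2 d) = brL a p * i3 d"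
  by (rule free2_eqI[where F = "\<lambda>p. brL a (p * e2 d)"], (intro klin_intros)+)
    (simp add: t2_arith brL_t2 i3_mult mult.assoc mu_power_central[of "i3 d"])

lemma brR_e1_mult: "brR b (e1 c * p) = i1 c * brR b p"
  by (rule free2_eqI[where F = "\<lambda>p. brR b (e1 c * p)"], (intro klin_intros)+)
    (simp add: t2_arith brR_t2 i1_def j12_mult e1_mult mult.assoc)

lemma brR_mult_e2: "brR b (p * e2 d) = brR b p * i3 d + j12 p * j23 (br b d)"
proof (rule free2_eqI[where F = "\<lambda>p. brR b (p * e2 d)"], (intro klin_intros)+, rename_tac x y n)
  fix x y :: "('v letter, 'k) free1" and n
  have "j12 (t2 x y n) = lam3 ^ n * (i1 x * i2 y)"
    by (simp add: j12_t2 conv_t3(1,2) t3_mult t3_powers)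
  moreover have "brR b (t2 x y n) = lam3 ^ n * (i1 x * j23 (br b y))" for y
    by (simp add: brR_t2 lam3_power_central)
  ultimately show "brR b (t2 x y n * e2 d) = brR b (t2 x y n) * i3 d + j12 (t2 x y n) * j23 (br b d)"
    by (simp add: t2_arith br_mult_right klin_add[OF klin_j23[OF klin_id]] j23_mult j23_e1 j23_e2
        distrib_left mult.assoc)
qed

lemma brM_mult: "brM p (c * d) = brM p c * i3 d + i1 c * brM p d"
  by (rule free2_eqI[where F = "\<lambda>p. brM p (c * d)"], (intro klin_intros)+)
    (simp add: brM_t2 br_mult_right klin_add[OF klin_mid[OF klin_id]] mid_e1_mult mid_mult_e2
      distrib_left mult.assoc lam3_pow_left[of "i1 c"])

lemma brM_der: "brM p (free_jet_der c) = - xi (brM p c)"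
  by (rule free2_eqI[where F = "\<lambda>p. brM p (free_jet_der c)"], (intro klin_intros)+)
    (simp add: brM_t2 br_der_right mid_dlam xi_lam3_pow)

lemma brL_lam: "brL a (lam * p) = mu * brL a p"
  by (rule free2_eqI[where F = "\<lambda>p. brL a (lam * p)"], (intro klin_intros)+)
    (simp add: t2_arith brL_t2 mult.assoc mu_left[of "j12 _"] mu_left[of "i3 _"])

lemma brR_lam: "brR a (lam * p) = lam3 * brR a p"
  by (rule free2_eqI[where F = "\<lambda>p. brR a (lam * p)"], (intro klin_intros)+)
    (simp add: t2_arith brR_t2 mult.assoc lam3_left[of "i1 _"] lam3_left[of "j23 _"])

lemma brL_der2: "brL a (der2 p) = der3 (brL a p) + lam3 * brL a p"
proof (rule free2_eqI[where F = "\<lambda>p. brL a (der2 p)"], (intro klin_intros)+, rename_tac x y n)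
  fix x y n
  show "brL a (der2 (t2 x y n)) = der3 (brL a (t2 x y n)) + lam3 * brL a (t2 x y n)"
    by (simp add: der3_powers der2_t2 klin_add[OF klin_brL[OF klin_id]] brL_t2 br_der_right dlam_def der3_mult der3_gens
        klin_add[OF klin_j12[OF klin_id]] der3_j12 j12_mult j12_lam distrib_right mult.assoc)
qed

lemma brR_der2: "brR b (der2 p) = der3 (brR b p) + mu * brR b p"
proof (rule free2_eqI[where F = "\<lambda>p. brR b (der2 p)"], (intro klin_intros)+, rename_tac x y n)
  fix x y n
  show "brR b (der2 (t2 x y n)) = der3 (brR b (t2 x y n)) + mu * brR b (t2 x y n)"
    by (simp add: der3_powers der2_t2 klin_add[OF klin_brR[OF klin_id]] brR_t2 br_der_right dlam_def der3_mult der3_gens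
        klin_add[OF klin_j23[OF klin_id]] der3_j23 j23_mult j23_lam distrib_right distrib_left mult.assoc
        mu_left[of "i1 x"])
qed

text \<open>Moving \<partial> out of the outer bracket adds the variable of that bracket to the
  \<partial> plus variable already present, which gives \<lambda> + \<mu> + \<partial> on both
  sides.\<close>

lemma brL_dlam: "brL a (dlam p) = - xi (brL a p)" and brR_dlam: "brR a (dlam p) = - xi (brR a p)"
  by (simp_all add: dlam_def klin_add[OF klin_brL[OF klin_id]] klin_add[OF klin_brR[OF klin_id]]
      brL_der2 brR_der2 brL_lam brR_lam xi_def)

text \<open>Combined with skew-symmetry, this exhibits the second Jacobi term as a rotation of a
  first one.\<close>

lemma brR_star: "brR b (star p) = tau (brL b p)"
proof (rule free2_eqI[where F = "\<lambda>p. brR b (star p)"], (intro klin_intros)+, rename_tac x y n)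
  fix x y n
  \<comment> \<open>By \<open>brR_dlam\<close> the map \<open>brR b\<close> carries
    -\<lambda>-\<partial> to \<open>xi\<close>, the same operator that \<open>tau\<close>
    substitutes for \<mu>.\<close>
  have 1: "brR b ((ndlam ^^ n) q) = (xi ^^ n) (brR b q)" for q
    by (induction n) (simp_all add: klin_minus[OF klin_brR[OF klin_id]] brR_dlam)
  show "brR b (star (t2 x y n)) = tau (brL b (t2 x y n))"
    by (simp add: star_t2 1 brR_t2 brL_t2 mu_power_central tau_pow tau_j12_i3)
qed

lemma brM_t2_star: "lam3 ^ n * mid y (star (br c x)) = tau (tau (brL c (t2 x y n)))"
  by (simp add: brL_t2 mu_power_central tau_pow mid_star)

section \<open>The Jacobiator and its rules in the last argument\<close>

definition jac1 where "jac1 a b c = brL a (br b c)"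
definition jac2 where "jac2 a b c = brR b (br a c)"
definition jac3 where "jac3 a b c = brM (br a b) c"
definition jac where "jac a b c = jac1 a b c - jac2 a b c - jac3 a b c"

lemma klin_jac: "klin (\<lambda>c. jac a b c)"
  unfolding jac_def jac1_def jac2_def jac3_def by (intro klin_intros)

lemma jac_mult: "jac a b (c * d) = jac a b c * i3 d + i1 c * jac a b d"
  by (simp add: jac_def jac1_def jac2_def jac3_def br_mult_right klin_add[OF klin_brL[OF klin_id]]
      klin_add[OF klin_brR[OF klin_id]] brL_e1_mult brL_mult_e2 brR_e1_mult brR_mult_e2 brM_mult algebra_simps)

lemma jac_der: "jac a b (free_jet_der c) = - xi (jac a b c)"
  by (simp add: jac_def jac1_def jac2_def jac3_def br_der_right brL_dlam brR_dlam brM_der klin_diff[OF klin_xi'])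

end

section \<open>Congruences modulo a differential ideal\<close>

locale diff_ideal =
  fixes N :: "('v letter, 'k::field_char_0) free1 set"
  assumes subspace_N: "ksubspace N"
    and N_mult_left: "f \<in> N \<Longrightarrow> g * f \<in> N" and N_mult_right: "f \<in> N \<Longrightarrow> f * g \<in> N"
    and N_der: "f \<in> N \<Longrightarrow> free_jet_der f \<in> N"
begin

text \<open>The usual description of the kernel of a tensor product of two quotient maps, taken in
  every power of \<lambda>.\<close>

definition N2 :: "('v letter, 'k) free2 set" where
  "N2 = pm.span {t2 f g n | f g n. f \<in> N \<or> g \<in> N}"

definition N3 :: "('v letter, 'k) free3 set" where
  "N3 = pm.span {t3 f g h m n | f g h m n. f \<in> N \<or> g \<in> N \<or> h \<in> N}"

lemma subspace_N2: "ksubspace N2" and subspace_N3: "ksubspace N3"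
  unfolding N2_def N3_def by (rule subspace_span)+

lemma t2_N2: "f \<in> N \<or> g \<in> N \<Longrightarrow> t2 f g n \<in> N2"
  unfolding N2_def by (rule pm.span_base) auto

lemma t3_N3: "f \<in> N \<or> g \<in> N \<or> h \<in> N \<Longrightarrow> t3 f g h m n \<in> N3"
  unfolding N3_def by (rule pm.span_base) blast

lemma N2_map:
  assumes "p \<in> N2" "klin F" "ksubspace S" "\<And>f g n. f \<in> N \<or> g \<in> N \<Longrightarrow> F (t2 f g n) \<in> S"
  shows "F p \<in> S"
  using assms(1) unfolding N2_def by (rule span_mem_vimage[OF _ assms(2,3)]) (auto intro: assms(4))

lemma N3_map:
  assumes "p \<in> N3" "klin F" "ksubspace S" "\<And>f g h m n. f \<in> N \<or> g \<in> N \<or> h \<in> N \<Longrightarrow> F (t3 f g h m n) \<in> S"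
  shows "F p \<in> S"
  using assms(1) unfolding N3_def by (rule span_mem_vimage[OF _ assms(2,3)]) (auto intro: assms(4))

lemma N2_mult_left: "p \<in> N2 \<Longrightarrow> q * p \<in> N2" and N2_mult_right: "p \<in> N2 \<Longrightarrow> p * q \<in> N2"
proof -
  assume p: "p \<in> N2"
  show "q * p \<in> N2"
  proof (rule N2_map[OF p _ subspace_N2], (intro klin_intros)+)
    fix f g n assume *: "f \<in> N \<or> g \<in> N"
    show "q * t2 f g n \<in> N2"
      by (rule free2_memI[OF _ subspace_N2, of "\<lambda>q. q * t2 f g n"], (intro klin_intros)+)
        (use * in \<open>auto simp: t2_mult intro!: t2_N2 N_mult_left\<close>)
  qed
  show "p * q \<in> N2"
  proof (rule N2_map[OF p _ subspace_N2], (intro klin_intros)+)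
    fix f g n assume *: "f \<in> N \<or> g \<in> N"
    show "t2 f g n * q \<in> N2"
      by (rule free2_memI[OF _ subspace_N2, of "\<lambda>q. t2 f g n * q"], (intro klin_intros)+)
        (use * in \<open>auto simp: t2_mult intro!: t2_N2 N_mult_right\<close>)
  qed
qed

lemma N3_mult_left: "p \<in> N3 \<Longrightarrow> q * p \<in> N3" and N3_mult_right: "p \<in> N3 \<Longrightarrow> p * q \<in> N3"
proof -
  assume p: "p \<in> N3"
  show "q * p \<in> N3"
  proof (rule N3_map[OF p _ subspace_N3], (intro klin_intros)+)
    fix f g h m n assume *: "f \<in> N \<or> g \<in> N \<or> h \<in> N"
    show "q * t3 f g h m n \<in> N3"
      by (rule free3_memI[OF _ subspace_N3, of "\<lambda>q. q * t3 f g h m n"], (intro klin_intros)+)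
        (use * in \<open>auto simp: t3_mult intro!: t3_N3 N_mult_left\<close>)
  qed
  show "p * q \<in> N3"
  proof (rule N3_map[OF p _ subspace_N3], (intro klin_intros)+)
    fix f g h m n assume *: "f \<in> N \<or> g \<in> N \<or> h \<in> N"
    show "t3 f g h m n * q \<in> N3"
      by (rule free3_memI[OF _ subspace_N3, of "\<lambda>q. t3 f g h m n * q"], (intro klin_intros)+)
        (use * in \<open>auto simp: t3_mult intro!: t3_N3 N_mult_right\<close>)
  qed
qed

lemma der2_N2: "p \<in> N2 \<Longrightarrow> der2 p \<in> N2"
  by (erule N2_map[OF _ klin_der2[OF klin_id] subspace_N2])
    (auto simp: der2_t2 intro!: subspace_add[OF subspace_N2] t2_N2 N_der)

lemma dlam_N2: "p \<in> N2 \<Longrightarrow> dlam p \<in> N2"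
  unfolding dlam_def by (intro subspace_add[OF subspace_N2] der2_N2 N2_mult_left)

lemma star_N2: "p \<in> N2 \<Longrightarrow> star p \<in> N2"
proof (erule N2_map[OF _ klin_star[OF klin_id] subspace_N2])
  fix f g n assume "f \<in> N \<or> g \<in> N"
  then have "t2 g f 0 \<in> N2" by (auto intro!: t2_N2)
  then show "star (t2 f g n) \<in> N2"
    unfolding star_t2 by (induction n) (auto intro: dlam_N2 subspace_minus[OF subspace_N2])
qed

lemma inr_N2: "p \<in> N2 \<Longrightarrow> inr b p \<in> N2" and inl_N2: "p \<in> N2 \<Longrightarrow> inl b p \<in> N2"
  unfolding inr_def inl_def by (intro star_N2 N2_mult_right, assumption)
    (intro star_N2 N2_mult_left, assumption)

lemma inr_N2': "b \<in> N \<Longrightarrow> inr b q \<in> N2" and inl_N2': "b \<in> N \<Longrightarrow> inl b q \<in> N2"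
  unfolding inr_def inl_def e1_conv_t2 e2_conv_t2
  by (rule star_N2, rule N2_mult_left, simp add: t2_N2)
    (rule star_N2, rule N2_mult_right, simp add: t2_N2)

lemma j12_N2: "p \<in> N2 \<Longrightarrow> j12 p \<in> N3" and j23_N2: "p \<in> N2 \<Longrightarrow> j23 p \<in> N3"
  by (erule N2_map[OF _ klin_j12[OF klin_id] subspace_N3], auto simp: j12_t2 intro!: t3_N3)
    (erule N2_map[OF _ klin_j23[OF klin_id] subspace_N3], auto simp: j23_t2 intro!: t3_N3)

lemma der3_N3: "p \<in> N3 \<Longrightarrow> der3 p \<in> N3"
  by (erule N3_map[OF _ klin_der3[OF klin_id] subspace_N3])
    (auto simp: der3_t3 intro!: subspace_add[OF subspace_N3] t3_N3 N_der)

lemma xi_N3: "p \<in> N3 \<Longrightarrow> xi p \<in> N3"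
  unfolding xi_def
  by (intro subspace_diff[OF subspace_N3] subspace_minus[OF subspace_N3] der3_N3 N3_mult_left)

lemma tau_N3: "p \<in> N3 \<Longrightarrow> tau p \<in> N3"
proof (erule N3_map[OF _ klin_tau' subspace_N3])
  fix f g h m n assume "f \<in> N \<or> g \<in> N \<or> h \<in> N"
  then have "t3 h f g 0 0 \<in> N3" by (auto intro!: t3_N3)
  then have "(xi ^^ n) (t3 h f g 0 0) \<in> N3"
    by (induction n) (auto intro: xi_N3)
  then show "tau (t3 f g h m n) \<in> N3"
    unfolding tau_t3 by (rule N3_mult_left)
qed

text \<open>Written as \<open>star (star p)\<close>, the argument is seen by \<open>mid_star\<close>
  to pass only through operations already known to respect the ideal; no expansion in \<lambda> +
  \<mu> is needed.\<close>

lemma mid_N3: "p \<in> N2 \<Longrightarrow> mid y p \<in> N3" for p :: "('v letter, 'k) free2"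
  using mid_star[of y "star p"] by (simp add: tau_N3 N3_mult_right j12_N2 star_N2)

end

lemma subspace_cong: "ksubspace S \<Longrightarrow> p - q \<in> S \<Longrightarrow> p \<in> S \<longleftrightarrow> q \<in> S"
  using subspace_add[of S "p - q" q] subspace_diff[of S p "p - q"] by auto

lemma i1_one: "i1 1 = 1"
  by (simp add: i1_def)

text \<open>Everything that the double Poisson algebra contributes is collected here, and it
  concerns only letters of degree 0 and the generators \<open>R\<close> of \<open>N\<close> as a
  differential ideal. What follows in this locale is formal.\<close>

locale poisson_letters = letter_bracket B + diff_ideal N
  for B :: "'v letter \<Rightarrow> 'v letter \<Rightarrow> ('v letter, 'k::field_char_0) free2"
    and N :: "('v letter, 'k) free1 set" +
  fixes R :: "('v letter, 'k) free1 set"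
  assumes letter_skew: "B (a, 0) (b, 0) + star (B (b, 0) (a, 0)) \<in> N2"
    and letter_jac: "jac (bas [(a, 0)]) (bas [(b, 0)]) (bas [(c, 0)]) \<in> N3"
    and R_N: "R \<subseteq> N"
    and N_least: "\<lbrakk>ksubspace S; \<And>f g. f \<in> S \<Longrightarrow> f * g \<in> S; \<And>f g. f \<in> S \<Longrightarrow> g * f \<in> S;
      \<And>f. f \<in> S \<Longrightarrow> free_jet_der f \<in> S; R \<subseteq> S\<rbrakk> \<Longrightarrow> N \<subseteq> S"
    and R_br: "r \<in> R \<Longrightarrow> br r (bas [(c, 0)]) \<in> N2"
begin

lemma star_add: "star (p + q) = star p + star q" and star_minus: "star (- p) = - star p"
  and star_zero: "star 0 = 0"
  by (rule klin_simps[OF klin_star[OF klin_id]])+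

lemma skew_swap: "br f g + star (br g f) \<in> N2 \<Longrightarrow> br g f + star (br f g) \<in> N2"
  using star_N2[of "br f g + star (br g f)"] by (simp add: star_add add.commute)

text \<open>The adjoint carries the right rules for \<open>br g f\<close> to the left rules for
  \<open>br f g\<close>. So the defect of skew-symmetry as a whole obeys the left Leibniz rule and
  left sesquilinearity in \<open>f\<close>, and these preserve \<open>N2\<close>.\<close>

lemma skew_left_induct:
  assumes "\<And>a. br (bas [(a, 0)]) g + star (br g (bas [(a, 0)])) \<in> N2"
  shows "br f g + star (br g f) \<in> N2"
proof -
  let ?S = "{f. br f g + star (br g f) \<in> N2}"
  have "f \<in> ?S"
  proof (rule free1_generated)
    show "ksubspace ?S"
      by (rule subspace_vimage[OF _ subspace_N2]) (intro klin_intros)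
    show "1 \<in> ?S"
      by (simp add: br_one_left br_one_right star_zero subspace_zero[OF subspace_N2])
  next
    fix f f' assume "f \<in> ?S" "f' \<in> ?S"
    then have "inr f' (br f g + star (br g f)) + inl f (br f' g + star (br g f')) \<in> N2"
      by (auto intro: subspace_add[OF subspace_N2] inr_N2 inl_N2)
    then show "f * f' \<in> ?S"
      by (simp add: br_mult_left br_mult_right star_add star_e1_mult star_mult_e2 inr_add inl_add algebra_simps)
  next
    fix f assume "f \<in> ?S"
    then have "- (lam * (br f g + star (br g f))) \<in> N2"
      by (auto intro: subspace_minus[OF subspace_N2] N2_mult_left)
    then show "free_jet_der f \<in> ?S"
      by (simp add: br_der_left br_der_right star_dlam distrib_left)
  qed (use assms in simp)
  then show ?thesis by simp
qed

theorem br_skew: "br f g + star (br g f) \<in> N2"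
proof -
  \<comment> \<open>The induction treats the first argument only; \<open>skew_swap\<close> allows it
    to be run once for each argument.\<close>
  have 1: "br f (bas [(b, 0)]) + star (br (bas [(b, 0)]) f) \<in> N2" for f b
    by (rule skew_left_induct) (simp add: br_letters letter_skew)
  show ?thesis
    by (rule skew_left_induct, rule skew_swap, rule 1)
qed

lemma br_N2_left: assumes "f \<in> N" shows "br f g \<in> N2"
proof -
  \<comment> \<open>Membership in \<open>N\<close> is part of the set because the bracket of
    \<open>f * g\<close> contains \<open>inl f (br g h)\<close>, which lies in \<open>N2\<close>
    only thanks to \<open>f\<close> itself.\<close>
  let ?S = "{f \<in> N. \<forall>g. br f g \<in> N2}"
  have "N \<subseteq> ?S"
  proof (rule N_least)
    have "?S = N \<inter> (\<Inter>g. {f. br f g \<in> N2})" by auto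
    also have "ksubspace \<dots>"
      using subspace_N subspace_vimage[OF klin_br[OF klin_id] subspace_N2] by (auto simp: ksubspace_def)
    finally show "ksubspace ?S" .
  next
    fix f g assume "f \<in> ?S"
    then show "f * g \<in> ?S" "g * f \<in> ?S"
      by (auto simp: br_mult_left N_mult_left N_mult_right
          intro: subspace_add[OF subspace_N2] inr_N2 inl_N2 inr_N2' inl_N2')
  next
    fix f assume "f \<in> ?S"
    then show "free_jet_der f \<in> ?S"
      by (auto simp: N_der br_der_left intro: subspace_minus[OF subspace_N2] N2_mult_left)
  next
    \<comment> \<open>\<open>R_br\<close> speaks of letters of degree 0; the exact rules in the
      second argument extend it to all of the free algebra.\<close>
    have "br r g \<in> N2" if "r \<in> R" for r g
    proof -
      let ?T = "{g. br r g \<in> N2}"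
      have "g \<in> ?T"
      proof (rule free1_generated)
        show "ksubspace ?T"
          by (rule subspace_vimage[OF _ subspace_N2]) (intro klin_intros)
      qed (use that in \<open>auto simp: br_one_right br_mult_right br_der_right R_br
            intro: subspace_zero[OF subspace_N2] subspace_add[OF subspace_N2] N2_mult_left N2_mult_right dlam_N2\<close>)
      then show ?thesis by simp
    qed
    then show "R \<subseteq> ?S" using R_N by auto
  qed
  then show ?thesis using assms by auto
qed

lemma br_N2_right: assumes "g \<in> N" shows "br f g \<in> N2"
  using subspace_diff[OF subspace_N2 br_skew[of f g] star_N2[OF br_N2_left[OF assms, of f]]] by simp

section \<open>Cyclic invariance of the Jacobiator and the Jacobi identity\<close>

lemma brR_N3: "p \<in> N2 \<Longrightarrow> brR a p \<in> N3"
proof (erule N2_map[OF _ klin_brR[OF klin_id] subspace_N3])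
  fix x y n assume "x \<in> N \<or> y \<in> N"
  then have "i1 x * j23 (br a y) \<in> N3"
    by (elim disjE) (auto simp: conv_t3(1) t3_N3 intro: N3_mult_right N3_mult_left[OF j23_N2[OF br_N2_right]])
  then show "brR a (t2 x y n) \<in> N3"
    unfolding brR_t2 by (rule N3_mult_right)
qed

text \<open>Skew-symmetry replaces \<open>br a c\<close> in the second term by minus the adjoint of
  \<open>br c a\<close>, and likewise each bracket with \<open>c\<close> in the third. By
  \<open>brR_star\<close> and \<open>brM_t2_star\<close> the adjoints become rotations, and the
  minus signs of \<open>jac\<close> disappear: what remains is the sum over a cyclic orbit.\<close>

lemma jac_cyclic: "jac a b c - (jac1 a b c + tau (jac1 b c a) + tau (tau (jac1 c a b))) \<in> N3"
proof -
  have "brR b (br a c + star (br c a)) \<in> N3"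
    by (intro brR_N3 br_skew)
  moreover have "brM p c + tau (tau (brL c p)) \<in> N3" for p
  proof (rule free2_memI[where F = "\<lambda>p. brM p c + tau (tau (brL c p))", OF _ subspace_N3], (intro klin_intros)+)
    fix x y n
    have "lam3 ^ n * mid y (br x c + star (br c x)) \<in> N3"
      by (intro N3_mult_left mid_N3 br_skew)
    then show "brM (t2 x y n) c + tau (tau (brL c (t2 x y n))) \<in> N3"
      by (simp add: brM_t2 klin_add[OF klin_mid[OF klin_id]] distrib_left flip: brM_t2_star)
  qed
  from this[of "br a b"] calculation have "- (brR b (br a c + star (br c a)) + (brM (br a b) c + tau (tau (brL c (br a b))))) \<in> N3"
    by (metis subspace_minus[OF subspace_N3] subspace_add[OF subspace_N3])
  then show ?thesis
    by (simp add: jac_def jac1_def jac2_def jac3_def klin_add[OF klin_brR[OF klin_id]] brR_star algebra_simps)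
qed

lemma jac_rotate: assumes "jac a b c \<in> N3" shows "jac b c a \<in> N3"
proof -
  let ?J = "\<lambda>a b c. jac1 a b c + tau (jac1 b c a) + tau (tau (jac1 c a b))"
  have "?J a b c \<in> N3"
    using assms subspace_cong[OF subspace_N3 jac_cyclic[of a b c]] by simp
  \<comment> \<open>Since \<open>tau\<close> has order three, two further rotations permute the
    summands of \<open>?J a b c\<close> into those of \<open>?J b c a\<close>.\<close>
  then have "tau (tau (?J a b c)) \<in> N3"
    by (intro tau_N3)
  then have "?J b c a \<in> N3"
    by (simp add: klin_add[OF klin_tau'] ac_simps)
  then show ?thesis
    using subspace_cong[OF subspace_N3 jac_cyclic[of b c a]] by simp
qed

lemma jac_last_induct:
  assumes "\<And>c. jac a b (bas [(c, 0)]) \<in> N3"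
  shows "jac a b c \<in> N3"
proof -
  let ?S = "{c. jac a b c \<in> N3}"
  have 1: "jac a b 1 = 0"
    using jac_mult[of a b 1 1] by (simp add: i1_one)
  have "c \<in> ?S"
  proof (rule free1_generated)
    show "ksubspace ?S"
      by (rule subspace_vimage[OF klin_jac subspace_N3])
  qed (use assms 1 in \<open>auto simp: jac_mult jac_der intro: subspace_zero[OF subspace_N3] subspace_add[OF subspace_N3]
        N3_mult_left N3_mult_right subspace_minus[OF subspace_N3] xi_N3\<close>)
  then show ?thesis by simp
qed

theorem br_jacobi: "jac a b c \<in> N3"
proof -
  \<comment> \<open>Each rotation brings the first argument into the last place, where the induction
    applies; after two rotations every argument has been freed from being a letter.\<close>
  have 1: "jac (bas [(a, 0)]) (bas [(b, 0)]) c \<in> N3" for a b c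
    by (rule jac_last_induct[OF letter_jac])
  have 2: "jac (bas [(b, 0)]) c a \<in> N3" for a b c
    by (rule jac_last_induct) (rule jac_rotate[OF 1])
  show ?thesis
    by (rule jac_last_induct) (rule jac_rotate[OF 2])
qed

end

section \<open>Modules over a field and quotients of free modules\<close>

abbreviation kmod :: "('k::field_char_0, 'w) module \<Rightarrow> bool" where
  "kmod M \<equiv> Module.module (ring_of_type_algebra :: 'k ring) M"

lemma ring_of_type_algebra_simps [simp]:
  "carrier (ring_of_type_algebra :: 'k::field_char_0 ring) = UNIV"
  "x \<oplus>\<^bsub>(ring_of_type_algebra :: 'k ring)\<^esub> y = x + y" "x \<otimes>\<^bsub>(ring_of_type_algebra :: 'k ring)\<^esub> y = x * y"
  "\<zero>\<^bsub>(ring_of_type_algebra :: 'k ring)\<^esub> = 0" "\<one>\<^bsub>(ring_of_type_algebra :: 'k ring)\<^esub> = 1"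
  by (simp_all add: ring_of_type_algebra_def)

section \<open>Linear maps from free modules to modules given by records\<close>

definition khom :: "('k::field_char_0, 'w) module \<Rightarrow> (('x \<Rightarrow>\<^sub>0 'k) \<Rightarrow> 'w) \<Rightarrow> bool" where
  "khom M G \<longleftrightarrow> (\<forall>p. G p \<in> carrier M) \<and> (\<forall>p q. G (p + q) = G p \<oplus>\<^bsub>M\<^esub> G q)
     \<and> (\<forall>c p. G (pm_smult c p) = c \<odot>\<^bsub>M\<^esub> G p)"

lemma khom_closed: "khom M G \<Longrightarrow> G p \<in> carrier M"
  and khom_add: "khom M G \<Longrightarrow> G (p + q) = G p \<oplus>\<^bsub>M\<^esub> G q"
  and khom_smult: "khom M G \<Longrightarrow> G (pm_smult c p) = c \<odot>\<^bsub>M\<^esub> G p"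
  by (auto simp: khom_def)

lemma khom_compose: "khom M G \<Longrightarrow> klin h \<Longrightarrow> khom M (\<lambda>p. G (h p))"
  by (simp add: khom_def klin_simps)

text \<open>All quotients of free modules below are presented by surjections from whole types of the form
  \<^typ>\<open>'x \<Rightarrow>\<^sub>0 'k\<close>, from which the module axioms are inherited.\<close>

lemma kmod_of_surj:
  fixes M :: "('k::field_char_0, 'w) module" and G :: "('x \<Rightarrow>\<^sub>0 'k) \<Rightarrow> 'w"
  assumes G: "khom M G" and surj: "carrier M = range G" and zero: "\<zero>\<^bsub>M\<^esub> = G 0"
  shows "kmod M"
proof (rule moduleI)
  show "cring (ring_of_type_algebra :: 'k ring)" by blast
  show "abelian_group M"
  proof (rule abelian_groupI)
    fix x assume "x \<in> carrier M"
    then obtain p where "x = G p" using surj by auto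
    then have "G (- p) \<oplus>\<^bsub>M\<^esub> x = \<zero>\<^bsub>M\<^esub>"
      using khom_add[OF G, of "- p" p] zero by simp
    then show "\<exists>y\<in>carrier M. y \<oplus>\<^bsub>M\<^esub> x = \<zero>\<^bsub>M\<^esub>"
      using surj by auto
  qed (auto simp: surj zero ac_simps simp flip: khom_add[OF G])
qed (auto simp: surj pm_smult_add_left pm_smult_add_right pm_smult_smult simp flip: khom_add[OF G] khom_smult[OF G])

context
  fixes M :: "('k::field_char_0, 'w) module" and G :: "('x \<Rightarrow>\<^sub>0 'k) \<Rightarrow> 'w"
  assumes M: "kmod M" and G: "khom M G"
begin

interpretation Module.module "ring_of_type_algebra :: 'k ring" M by (rule M)

lemma khom_zero: "G 0 = \<zero>\<^bsub>M\<^esub>"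
  using khom_smult[OF G, of 0 0] smult_l_null[OF khom_closed[OF G]] by simp

lemma khom_minus: "G (- p) = \<ominus>\<^bsub>M\<^esub> G p"
  using khom_add[OF G, of "- p" p] khom_zero khom_closed[OF G] by (simp add: M.minus_equality)

lemma khom_diff: "G (p - q) = G p \<ominus>\<^bsub>M\<^esub> G q"
  using khom_add[OF G, of p "- q"] by (simp add: khom_minus a_minus_def)

lemma khom_sum: "G (\<Sum>i\<in>I. f i) = (\<Oplus>\<^bsub>M\<^esub>i\<in>I. G (f i))"
  by (induction I rule: infinite_finite_induct)
    (auto simp: khom_zero khom_add[OF G] khom_closed[OF G])

lemma khom_eq_iff: "G p = G q \<longleftrightarrow> G (p - q) = \<zero>\<^bsub>M\<^esub>"
proof
  assume "G p = G q"
  then show "G (p - q) = \<zero>\<^bsub>M\<^esub>"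
    using khom_add[OF G, of p "- q"] khom_add[OF G, of q "- q"] by (simp add: khom_zero)
next
  assume "G (p - q) = \<zero>\<^bsub>M\<^esub>"
  then show "G p = G q"
    using khom_add[OF G, of "p - q" q] khom_closed[OF G] by simp
qed

lemma khom_kernel_subspace: "ksubspace {p. G p = \<zero>\<^bsub>M\<^esub>}"
  by (auto simp: ksubspace_def khom_zero khom_add[OF G] khom_smult[OF G])

lemma khom_eqI:
  assumes H: "khom M H" and eq: "\<And>x. G (bas x) = H (bas x)"
  shows "G p = H p"
proof (induction p rule: poly_mapping_single_add_induct)
  case (single x c)
  show ?case
    using khom_smult[OF G, of c "bas x"] khom_smult[OF H, of c "bas x"] eq by simp
next
  case zero
  show ?case
    using khom_smult[OF G, of 0 0] khom_smult[OF H, of 0 0] smult_l_null khom_closed[OF G] khom_closed[OF H] by simp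
qed (simp add: khom_add[OF G] khom_add[OF H])

end

lemma up_iff: "p \<in> up M \<longleftrightarrow> (\<forall>n. p n \<in> carrier M) \<and> (\<exists>n. \<forall>i>n. p i = \<zero>\<^bsub>M\<^esub>)"
  by (auto simp: up_def bound_def)

lemma poly_module_simps:
  "carrier (poly_module M) = up M" "\<zero>\<^bsub>poly_module M\<^esub> = (\<lambda>n. \<zero>\<^bsub>M\<^esub>)"
  "p \<oplus>\<^bsub>poly_module M\<^esub> q = (\<lambda>n. p n \<oplus>\<^bsub>M\<^esub> q n)" "c \<odot>\<^bsub>poly_module M\<^esub> p = (\<lambda>n. c \<odot>\<^bsub>M\<^esub> p n)"
  by (simp_all add: poly_module_def)

lemma kmod_poly_module: assumes "kmod M" shows "kmod (poly_module M :: ('k::field_char_0, nat \<Rightarrow> 'm) module)"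
proof -
  interpret Module.module "ring_of_type_algebra :: 'k ring" M by fact
  show ?thesis
  proof (rule moduleI)
    show "cring (ring_of_type_algebra :: 'k ring)" by blast
    show "abelian_group (poly_module M)"
    proof (rule abelian_groupI, unfold poly_module_simps)
      fix p q assume "p \<in> up M" "q \<in> up M"
      then obtain m n where "\<forall>i>m. p i = \<zero>\<^bsub>M\<^esub>" "\<forall>i>n. q i = \<zero>\<^bsub>M\<^esub>" "\<forall>i. p i \<in> carrier M" "\<forall>i. q i \<in> carrier M"
        by (auto simp: up_iff)
      then show "(\<lambda>n. p n \<oplus>\<^bsub>M\<^esub> q n) \<in> up M"
        by (auto simp: up_iff intro!: exI[of _ "max m n"])
    next
      fix p assume "p \<in> up M"
      then have "(\<lambda>n. \<ominus>\<^bsub>M\<^esub> p n) \<in> up M" "(\<lambda>n. \<ominus>\<^bsub>M\<^esub> p n \<oplus>\<^bsub>M\<^esub> p n) = (\<lambda>n. \<zero>\<^bsub>M\<^esub>)"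
        by (auto simp: up_iff M.l_neg)
      then show "\<exists>q\<in>up M. (\<lambda>n. q n \<oplus>\<^bsub>M\<^esub> p n) = (\<lambda>n. \<zero>\<^bsub>M\<^esub>)"
        by (intro bexI[of _ "\<lambda>n. \<ominus>\<^bsub>M\<^esub> p n"])
    qed (auto simp: up_iff M.a_ac)
    have null: "a \<odot>\<^bsub>M\<^esub> \<zero>\<^bsub>M\<^esub> = \<zero>\<^bsub>M\<^esub>" for a
      by (rule smult_r_null) simp
    have l: "(a + b) \<odot>\<^bsub>M\<^esub> x = a \<odot>\<^bsub>M\<^esub> x \<oplus>\<^bsub>M\<^esub> b \<odot>\<^bsub>M\<^esub> x"
      and m: "(a * b) \<odot>\<^bsub>M\<^esub> x = a \<odot>\<^bsub>M\<^esub> (b \<odot>\<^bsub>M\<^esub> x)" and o: "1 \<odot>\<^bsub>M\<^esub> x = x" if "x \<in> carrier M" for a b x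
      using smult_l_distr[of a b x] smult_assoc1[of a b x] smult_one[of x] that by simp_all
    fix a b p q
    show "p \<in> carrier (poly_module M) \<Longrightarrow> a \<odot>\<^bsub>poly_module M\<^esub> p \<in> carrier (poly_module M)"
      using null by (force simp: poly_module_simps up_iff)
    show "p \<in> carrier (poly_module M) \<Longrightarrow> (a \<oplus>\<^bsub>ring_of_type_algebra\<^esub> b) \<odot>\<^bsub>poly_module M\<^esub> p =
        a \<odot>\<^bsub>poly_module M\<^esub> p \<oplus>\<^bsub>poly_module M\<^esub> b \<odot>\<^bsub>poly_module M\<^esub> p"
      "p \<in> carrier (poly_module M) \<Longrightarrow> (a \<otimes>\<^bsub>ring_of_type_algebra\<^esub> b) \<odot>\<^bsub>poly_module M\<^esub> p =
        a \<odot>\<^bsub>poly_module M\<^esub> (b \<odot>\<^bsub>poly_module M\<^esub> p)"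
      "p \<in> carrier (poly_module M) \<Longrightarrow> \<one>\<^bsub>ring_of_type_algebra\<^esub> \<odot>\<^bsub>poly_module M\<^esub> p = p"
      by (simp_all add: poly_module_simps up_iff l m o)
    show "p \<in> carrier (poly_module M) \<Longrightarrow> q \<in> carrier (poly_module M) \<Longrightarrow>
        a \<odot>\<^bsub>poly_module M\<^esub> (p \<oplus>\<^bsub>poly_module M\<^esub> q) =
        a \<odot>\<^bsub>poly_module M\<^esub> p \<oplus>\<^bsub>poly_module M\<^esub> a \<odot>\<^bsub>poly_module M\<^esub> q"
      by (simp add: poly_module_simps up_iff smult_r_distr)
  qed
qed

section \<open>Quotients of the free module on a set of words\<close>

definition pm_restrict :: "'x set \<Rightarrow> ('x \<Rightarrow>\<^sub>0 'k::comm_ring_1) \<Rightarrow> ('x \<Rightarrow>\<^sub>0 'k)" where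
  "pm_restrict S = ext (\<lambda>x. if x \<in> S then bas x else 0)"

lemma klin_pm_restrict [klin_intros]: "klin f \<Longrightarrow> klin (\<lambda>p. pm_restrict S (f p))"
  unfolding pm_restrict_def by (intro klin_intros)

lemma lookup_pm_restrict: "Poly_Mapping.lookup (pm_restrict S p) x = (if x \<in> S then Poly_Mapping.lookup p x else 0)"
proof (induction p rule: poly_mapping_single_add_induct)
  case (single y c)
  then show ?case by (simp add: pm_restrict_def lookup_single when_def)
qed (simp_all add: klin_zero[OF klin_pm_restrict[OF klin_id]] klin_add[OF klin_pm_restrict[OF klin_id]] lookup_add)

lemma keys_pm_restrict: "Poly_Mapping.keys (pm_restrict S p) = Poly_Mapping.keys p \<inter> S"
  by (auto simp: in_keys_iff lookup_pm_restrict split: if_splits)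

lemma pm_restrict_id: "Poly_Mapping.keys p \<subseteq> S \<Longrightarrow> pm_restrict S p = p"
  by (rule poly_mapping_eqI) (auto simp: lookup_pm_restrict in_keys_iff)

lemma subspace_keys: "ksubspace {p :: 'x \<Rightarrow>\<^sub>0 'k::comm_ring_1. Poly_Mapping.keys p \<subseteq> S}"
proof -
  have "{p :: 'x \<Rightarrow>\<^sub>0 'k. Poly_Mapping.keys p \<subseteq> S} = {p. pm_restrict S p = p}"
    using keys_pm_restrict[of S] by (auto simp: pm_restrict_id dest!: arg_cong[of _ _ Poly_Mapping.keys])
  then show ?thesis
    by (simp only:) (rule subspace_equaliser; intro klin_intros)
qed

lemma pm_restrict_bas [simp]: "pm_restrict S (bas x) = (if x \<in> S then bas x else 0)"
  by (simp add: pm_restrict_def)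

text \<open>Restricting to \<open>S\<close> beforehand makes the class map total and linear on the
  whole type; words outside \<open>S\<close> go to the zero class.\<close>

definition qcls :: "'x list set \<Rightarrow> ('x list \<Rightarrow>\<^sub>0 'k::field_char_0) set \<Rightarrow> ('x list \<Rightarrow>\<^sub>0 'k) \<Rightarrow> ('x list \<Rightarrow>\<^sub>0 'k) set" where
  "qcls S N p = N +>\<^bsub>word_module S\<^esub> pm_restrict S p"

lemma word_module_simps [simp]:
  "carrier (word_module S) = {p. Poly_Mapping.keys p \<subseteq> S}" "p \<otimes>\<^bsub>word_module S\<^esub> q = p * q"
  "\<one>\<^bsub>word_module S\<^esub> = 1" "\<zero>\<^bsub>word_module S\<^esub> = 0" "p \<oplus>\<^bsub>word_module S\<^esub> q = p + q"
  "c \<odot>\<^bsub>word_module S\<^esub> p = pm_smult c p"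
  by (simp_all add: word_module_def)

lemma word_coset: "N +>\<^bsub>word_module S\<^esub> p = (\<lambda>n. n + p) ` N"
  by (auto simp: a_r_coset_def r_coset_def)

context
  fixes S :: "'x list set" and N :: "('x list \<Rightarrow>\<^sub>0 'k::field_char_0) set"
  assumes N: "ksubspace N" and N_keys: "N \<subseteq> {p. Poly_Mapping.keys p \<subseteq> S}"
begin

lemma translate_eq_iff: "(\<lambda>n. n + p) ` N = (\<lambda>n. n + q) ` N \<longleftrightarrow> p - q \<in> N"
proof
  assume "(\<lambda>n. n + p) ` N = (\<lambda>n. n + q) ` N"
  then have "0 + p \<in> (\<lambda>n. n + q) ` N"
    using subspace_zero[OF N] by blast
  then show "p - q \<in> N" by auto
next
  assume *: "p - q \<in> N"
  have "n + p \<in> (\<lambda>n. n + q) ` N" "n + q \<in> (\<lambda>n. n + p) ` N" if "n \<in> N" for n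
  proof -
    have "n + p = (n + (p - q)) + q" "n + q = (n - (p - q)) + p" by simp_all
    then show "n + p \<in> (\<lambda>n. n + q) ` N" "n + q \<in> (\<lambda>n. n + p) ` N"
      using subspace_add[OF N that *] subspace_diff[OF N that *] by blast+
  qed
  then show "(\<lambda>n. n + p) ` N = (\<lambda>n. n + q) ` N" by blast
qed

lemma qcls_eq_iff: "qcls S N p = qcls S N q \<longleftrightarrow> pm_restrict S (p - q) \<in> N"
  by (simp add: qcls_def word_coset translate_eq_iff klin_diff[OF klin_pm_restrict[OF klin_id]])

lemma qcls_eq: "Poly_Mapping.keys p \<subseteq> S \<Longrightarrow> qcls S N p = (\<lambda>n. n + p) ` N"
  by (simp add: qcls_def word_coset pm_restrict_id)

lemma quot_carrier: "carrier (quot_module (word_module S) N) = range (qcls S N)"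
proof -
  have "carrier (quot_module (word_module S) N) = (\<lambda>p. N +>\<^bsub>word_module S\<^esub> p) ` {p. Poly_Mapping.keys p \<subseteq> S}"
    by (auto simp: quot_module_def ring.extend_def FactRing_def A_RCOSETS_def RCOSETS_def a_r_coset_def)
  also have "{p. Poly_Mapping.keys p \<subseteq> S} = range (pm_restrict S :: _ \<Rightarrow> ('x list \<Rightarrow>\<^sub>0 'k))"
  proof (intro equalityI subsetI)
    fix p :: "'x list \<Rightarrow>\<^sub>0 'k" assume "p \<in> {p. Poly_Mapping.keys p \<subseteq> S}"
    then have "p = pm_restrict S p" by (simp add: pm_restrict_id)
    then show "p \<in> range (pm_restrict S)" by blast
  qed (auto simp: keys_pm_restrict)
  finally show ?thesis
    by (simp add: image_image qcls_def[abs_def])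
qed

lemma quot_zero: "\<zero>\<^bsub>quot_module (word_module S) N\<^esub> = qcls S N 0"
  by (simp add: quot_module_def ring.extend_def FactRing_def qcls_eq)

lemma khom_qcls: "khom (quot_module (word_module S) N) (qcls S N)"
proof -
  let ?M = "quot_module (word_module S) N"
  have "qcls S N (p + q) = qcls S N p \<oplus>\<^bsub>?M\<^esub> qcls S N q" for p q
  proof -
    let ?p = "pm_restrict S p" and ?q = "pm_restrict S q"
    have "qcls S N p \<oplus>\<^bsub>?M\<^esub> qcls S N q = (\<Union>x\<in>N. \<Union>y\<in>N. {(x + ?p) + (y + ?q)})"
      by (auto simp: quot_module_def ring.extend_def FactRing_def qcls_def word_coset set_add_def set_mult_def)
    also have "\<dots> = (\<lambda>n. n + (?p + ?q)) ` N"
    proof (intro equalityI subsetI)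
      fix z assume "z \<in> (\<Union>x\<in>N. \<Union>y\<in>N. {(x + ?p) + (y + ?q)})"
      then obtain x y where "x \<in> N" "y \<in> N" "z = (x + y) + (?p + ?q)"
        by (auto simp: algebra_simps)
      then show "z \<in> (\<lambda>n. n + (?p + ?q)) ` N"
        using subspace_add[OF N] by blast
    next
      fix z assume "z \<in> (\<lambda>n. n + (?p + ?q)) ` N"
      then obtain n where "n \<in> N" "z = (n + ?p) + (0 + ?q)"
        by (auto simp: algebra_simps)
      then show "z \<in> (\<Union>x\<in>N. \<Union>y\<in>N. {(x + ?p) + (y + ?q)})"
        using subspace_zero[OF N] by blast
    qed
    finally show ?thesis
      by (simp add: qcls_def word_coset klin_add[OF klin_pm_restrict[OF klin_id]])
  qed
  moreover have "qcls S N (pm_smult c p) = c \<odot>\<^bsub>?M\<^esub> qcls S N p" for c p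
  proof -
    have "c \<odot>\<^bsub>?M\<^esub> qcls S N p = (\<Union>n\<in>N. (\<lambda>m. m + pm_smult c (n + pm_restrict S p)) ` N)"
      by (auto simp: quot_module_def ring.extend_def module.fields_def qcls_def word_coset)
    \<comment> \<open>The scalar multiple of a class is a union over its representatives; these
      differ by elements of \<open>N\<close>, so all members of the union are one and the same
      coset.\<close>
    also have "\<dots> = (\<Union>n\<in>N. (\<lambda>m. m + pm_smult c (pm_restrict S p)) ` N)"
      by (intro SUP_cong refl, subst translate_eq_iff)
        (simp add: pm_smult_add_right subspace_smult[OF N])
    also have "\<dots> = (\<lambda>m. m + pm_smult c (pm_restrict S p)) ` N"
      using subspace_zero[OF N] by blast
    finally show ?thesis
      by (simp add: qcls_def word_coset klin_smult[OF klin_pm_restrict[OF klin_id]])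
  qed
  ultimately show ?thesis
    unfolding khom_def quot_carrier by blast
qed

lemma kmod_quot: "kmod (quot_module (word_module S) N)"
  by (rule kmod_of_surj[OF khom_qcls quot_carrier quot_zero])

end

section \<open>Tensor powers\<close>

definition tcls :: "nat \<Rightarrow> ('k::field_char_0, 'v) module \<Rightarrow> ('v list \<Rightarrow>\<^sub>0 'k) \<Rightarrow> ('k, 'v) tensor" where
  "tcls n V = qcls (tensor_words n V) (tensor_null n V)"

locale kmodule = Module.module "ring_of_type_algebra :: 'k ring" V
  for V :: "('k::field_char_0, 'v) module" (structure)
begin

lemma subspace_tensor_null: "ksubspace (tensor_null n V)"
  unfolding tensor_null_def by (rule subspace_span)

lemma tensor_words_update: "xs \<in> tensor_words n V \<Longrightarrow> x \<in> carrier V \<Longrightarrow> xs[i := x] \<in> tensor_words n V"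
  using set_update_subset_insert[of xs i x] by (auto simp: tensor_words_def in_lists_conv_set)

lemma tensor_null_keys: "tensor_null n V \<subseteq> {p. Poly_Mapping.keys p \<subseteq> tensor_words n V}"
proof
  fix p assume p: "p \<in> tensor_null n V"
  have id: "klin (\<lambda>p. p)" by (rule klin_id)
  note sub = subspace_keys[of "tensor_words n V"]
  have "r \<in> {p. Poly_Mapping.keys p \<subseteq> tensor_words n V}" if "r \<in> tensor_rels n V" for r
  proof -
    have single: "Poly_Mapping.single xs c \<in> {p. Poly_Mapping.keys p \<subseteq> tensor_words n V}"
      if "xs \<in> tensor_words n V" for xs and c :: 'k
      using that by simp
    show ?thesis
      using \<open>r \<in> tensor_rels n V\<close> unfolding tensor_rels_def
      by (elim UnE CollectE exE conjE; hypsubst; intro subspace_diff[OF sub] single tensor_words_update)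
        (auto intro: smult_closed)
  qed
  then show "p \<in> {p. Poly_Mapping.keys p \<subseteq> tensor_words n V}"
    using span_mem_vimage[OF _ id sub] p unfolding tensor_null_def by blast
qed

lemmas tcls_facts = subspace_tensor_null tensor_null_keys

lemma khom_tcls: "khom (tensor_power n V) (tcls n V)"
  unfolding tcls_def tensor_power_def by (rule khom_qcls[OF tcls_facts])

lemma kmod_tensor_power: "kmod (tensor_power n V)"
  unfolding tensor_power_def by (rule kmod_quot[OF tcls_facts])

lemma tensor_power_carrier: "carrier (tensor_power n V) = range (tcls n V)"
  unfolding tcls_def tensor_power_def by (rule quot_carrier[OF tcls_facts])

lemma tensor_power_zero: "\<zero>\<^bsub>tensor_power n V\<^esub> = tcls n V 0"
  unfolding tcls_def tensor_power_def by (rule quot_zero[OF tcls_facts])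

lemma tcls_restrict: "tcls n V (pm_restrict (tensor_words n V) p) = tcls n V p"
  unfolding tcls_def qcls_def by (simp add: pm_restrict_id keys_pm_restrict)

lemma tcls_eq_zero_iff:
  "Poly_Mapping.keys p \<subseteq> tensor_words n V \<Longrightarrow> tcls n V p = \<zero>\<^bsub>tensor_power n V\<^esub> \<longleftrightarrow> p \<in> tensor_null n V"
  unfolding tensor_power_zero unfolding tcls_def qcls_eq_iff[OF tcls_facts] by (simp add: pm_restrict_id)

lemma pure_eq_tcls: "xs \<in> tensor_words n V \<Longrightarrow> pure V xs = tcls n V (bas xs)"
  by (auto simp: pure_def tcls_def qcls_def tensor_words_def)

lemma tcls_add: "xs \<in> tensor_words n V \<Longrightarrow> i < n \<Longrightarrow> x \<in> carrier V \<Longrightarrow> y \<in> carrier V \<Longrightarrow>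
    tcls n V (bas (xs[i := x \<oplus> y])) = tcls n V (bas (xs[i := x])) \<oplus>\<^bsub>tensor_power n V\<^esub> tcls n V (bas (xs[i := y]))"
proof -
  assume *: "xs \<in> tensor_words n V" "i < n" "x \<in> carrier V" "y \<in> carrier V"
  let ?r = "bas (xs[i := x \<oplus> y]) - bas (xs[i := x]) - bas (xs[i := y]) :: 'v list \<Rightarrow>\<^sub>0 'k"
  have "?r \<in> tensor_null n V"
    unfolding tensor_null_def by (rule pm.span_base) (use * in \<open>auto simp: tensor_rels_def\<close>)
  then have "tcls n V ?r = \<zero>\<^bsub>tensor_power n V\<^esub>"
    using tensor_null_keys by (subst tcls_eq_zero_iff) auto
  then show ?thesis
    using khom_eq_iff[OF kmod_tensor_power khom_tcls, of n "bas (xs[i := x \<oplus> y])" "bas (xs[i := x]) + bas (xs[i := y])"]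
      khom_add[OF khom_tcls, of n "bas (xs[i := x])" "bas (xs[i := y])"] by (simp add: algebra_simps)
qed

lemma tcls_smult: "xs \<in> tensor_words n V \<Longrightarrow> i < n \<Longrightarrow> x \<in> carrier V \<Longrightarrow>
    tcls n V (bas (xs[i := c \<odot> x])) = c \<odot>\<^bsub>tensor_power n V\<^esub> tcls n V (bas (xs[i := x]))"
proof -
  assume *: "xs \<in> tensor_words n V" "i < n" "x \<in> carrier V"
  let ?r = "bas (xs[i := c \<odot> x]) - Poly_Mapping.single (xs[i := x]) c :: 'v list \<Rightarrow>\<^sub>0 'k"
  have "?r \<in> tensor_null n V"
    unfolding tensor_null_def by (rule pm.span_base) (use * in \<open>auto simp: tensor_rels_def\<close>)
  then have "tcls n V ?r = \<zero>\<^bsub>tensor_power n V\<^esub>"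
    using tensor_null_keys by (subst tcls_eq_zero_iff) auto
  then show ?thesis
    using khom_eq_iff[OF kmod_tensor_power khom_tcls, of n "bas (xs[i := c \<odot> x])" "Poly_Mapping.single (xs[i := x]) c"]
      khom_smult[OF khom_tcls, of n c "bas (xs[i := x])"] by simp
qed

lemma tensor_words_2: "xs \<in> tensor_words 2 V \<longleftrightarrow> (\<exists>x\<in>carrier V. \<exists>y\<in>carrier V. xs = [x, y])"
  by (auto simp: tensor_words_def length_Suc_conv numeral_2_eq_2)

lemma tensor_words_3: "xs \<in> tensor_words 3 V \<longleftrightarrow> (\<exists>x\<in>carrier V. \<exists>y\<in>carrier V. \<exists>z\<in>carrier V. xs = [x, y, z])"
  by (auto simp: tensor_words_def length_Suc_conv numeral_3_eq_3)

text \<open>The universal property in terms of a linear map \<open>G\<close> on words: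
  multilinearity in each slot makes every generator of the null space, hence its span, go to
  zero.\<close>

lemma tensor_null_memI:
  assumes p: "p \<in> tensor_null n V" and G: "khom M G" and M: "kmod M"
    and add: "\<And>xs i x y. xs \<in> tensor_words n V \<Longrightarrow> i < n \<Longrightarrow> x \<in> carrier V \<Longrightarrow> y \<in> carrier V \<Longrightarrow>
      G (bas (xs[i := x \<oplus> y])) = G (bas (xs[i := x])) \<oplus>\<^bsub>M\<^esub> G (bas (xs[i := y]))"
    and smult: "\<And>xs i x c. xs \<in> tensor_words n V \<Longrightarrow> i < n \<Longrightarrow> x \<in> carrier V \<Longrightarrow>
      G (bas (xs[i := c \<odot> x])) = c \<odot>\<^bsub>M\<^esub> G (bas (xs[i := x]))"
  shows "G p = \<zero>\<^bsub>M\<^esub>"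
proof -
  have "p \<in> {p. G p = \<zero>\<^bsub>M\<^esub>}"
    using p unfolding tensor_null_def
  proof (rule span_mem_vimage[OF _ klin_id khom_kernel_subspace[OF M G]])
    fix r assume "r \<in> tensor_rels n V"
    then consider (a) xs i x y where "xs \<in> tensor_words n V" "i < n" "x \<in> carrier V" "y \<in> carrier V"
        "r = bas (xs[i := x \<oplus> y]) - (bas (xs[i := x]) + bas (xs[i := y]))"
      | (s) xs i x c where "xs \<in> tensor_words n V" "i < n" "x \<in> carrier V"
        "r = bas (xs[i := c \<odot> x]) - pm_smult c (bas (xs[i := x]))"
      unfolding tensor_rels_def by (auto simp: diff_diff_eq)
    then show "r \<in> {p. G p = \<zero>\<^bsub>M\<^esub>}"
    proof cases
      case a
      then show ?thesis by (simp add: add khom_add[OF G] flip: khom_eq_iff[OF M G])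
    next
      case s
      then show ?thesis
        using khom_smult[OF G, of c "bas (xs[i := x])"] by (simp add: smult flip: khom_eq_iff[OF M G])
    qed
  qed
  then show ?thesis by simp
qed

text \<open>A bilinear map \<open>F\<close> is usually given by representatives: \<open>q x y\<close> represents the value
  \<open>F x y\<close> under the surjection \<open>G\<close>.\<close>

lemma tensor_lift2_tcls:
  assumes M: "kmod M" and G: "khom M G" and F: "bilinear_on V M F"
    and q: "\<And>x y. x \<in> carrier V \<Longrightarrow> y \<in> carrier V \<Longrightarrow> G (q x y) = F x y"
    and p: "Poly_Mapping.keys p \<subseteq> tensor_words 2 V"
  shows "tensor_lift2 M F (tcls 2 V p) = G (ext (\<lambda>xs. q (xs ! 0) (xs ! 1)) p)"
proof -
  let ?e = "ext (\<lambda>xs. q (xs ! 0) (xs ! 1))"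
  have Ge: "khom M (\<lambda>p. G (?e p))"
    by (rule khom_compose[OF G klin_ext])
  have eval: "(\<Oplus>\<^bsub>M\<^esub>xs\<in>Poly_Mapping.keys r. Poly_Mapping.lookup r xs \<odot>\<^bsub>M\<^esub> F (xs ! 0) (xs ! 1)) = G (?e r)"
    if "Poly_Mapping.keys r \<subseteq> tensor_words 2 V" for r
  proof -
    interpret M: Module.module "ring_of_type_algebra :: 'k ring" M by (rule M)
    show ?thesis
      unfolding ext_def khom_sum[OF M G]
    proof (rule M.M.finsum_cong'[OF refl])
      fix xs assume "xs \<in> Poly_Mapping.keys r"
      then have "xs \<in> tensor_words 2 V" using that by auto
      then show "Poly_Mapping.lookup r xs \<odot>\<^bsub>M\<^esub> F (xs ! 0) (xs ! 1) =
          G (pm_smult (Poly_Mapping.lookup r xs) (q (xs ! 0) (xs ! 1)))"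
        by (auto simp: tensor_words_2 q khom_smult[OF G])
    qed (simp add: khom_closed[OF G])
  qed
  have null: "G (?e r) = \<zero>\<^bsub>M\<^esub>" if "r \<in> tensor_null 2 V" for r
  proof (rule tensor_null_memI[OF that Ge M])
    fix xs x y and i :: nat assume "xs \<in> tensor_words 2 V" "i < 2" "x \<in> carrier V" "y \<in> carrier V"
    then show "G (?e (bas (xs[i := x \<oplus> y]))) = G (?e (bas (xs[i := x]))) \<oplus>\<^bsub>M\<^esub> G (?e (bas (xs[i := y])))"
      using F by (auto simp: tensor_words_2 less_2_cases_iff q bilinear_on_def)
  next
    fix xs x c and i :: nat assume "xs \<in> tensor_words 2 V" "i < 2" "x \<in> carrier V"
    then show "G (?e (bas (xs[i := c \<odot> x]))) = c \<odot>\<^bsub>M\<^esub> G (?e (bas (xs[i := x])))"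
      using F by (auto simp: tensor_words_2 less_2_cases_iff q bilinear_on_def)
  qed
  have "tcls 2 V p = (\<lambda>n. n + p) ` tensor_null 2 V"
    unfolding tcls_def by (rule qcls_eq[OF tcls_facts p])
  moreover have "(\<Oplus>\<^bsub>M\<^esub>xs\<in>Poly_Mapping.keys (n + p). Poly_Mapping.lookup (n + p) xs \<odot>\<^bsub>M\<^esub> F (xs ! 0) (xs ! 1)) = G (?e p)"
    if "n \<in> tensor_null 2 V" for n
  proof -
    have "Poly_Mapping.keys (n + p) \<subseteq> tensor_words 2 V"
      using that tensor_null_keys p Poly_Mapping.keys_add[of n p] by blast
    then have "(\<Oplus>\<^bsub>M\<^esub>xs\<in>Poly_Mapping.keys (n + p). Poly_Mapping.lookup (n + p) xs \<odot>\<^bsub>M\<^esub> F (xs ! 0) (xs ! 1)) = G (?e (n + p))"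
      by (rule eval)
    also have "\<dots> = G (?e p)"
      using null[OF that] by (subst khom_eq_iff[OF M Ge]) simp
    finally show ?thesis .
  qed
  \<comment> \<open>Nonemptiness turns the constant image over the class into a singleton, from
    which \<open>the_elem\<close> can select.\<close>
  moreover have "tensor_null 2 V \<noteq> {}"
    using subspace_zero[OF subspace_tensor_null] by blast
  ultimately show ?thesis
    unfolding tensor_lift2_def tensor_lift_def by (simp add: image_image image_constant_conv cong: image_cong_simp)
qed

end

lemma range_pm_restrict: "range (pm_restrict S :: _ \<Rightarrow> ('x \<Rightarrow>\<^sub>0 'k::comm_ring_1)) = {p. Poly_Mapping.keys p \<subseteq> S}"
proof (intro equalityI subsetI)
  fix p :: "'x \<Rightarrow>\<^sub>0 'k" assume "p \<in> {p. Poly_Mapping.keys p \<subseteq> S}"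
  then have "p = pm_restrict S p" by (simp add: pm_restrict_id)
  then show "p \<in> range (pm_restrict S)" by blast
qed (auto simp: keys_pm_restrict)

lemma khom_word_module: "khom (word_module S) (pm_restrict S)"
  by (auto simp: khom_def keys_pm_restrict klin_add[OF klin_pm_restrict[OF klin_id]] klin_smult[OF klin_pm_restrict[OF klin_id]])

lemma kmod_word_module: "kmod (word_module S)"
  by (rule kmod_of_surj[OF khom_word_module])
    (simp_all add: range_pm_restrict klin_zero[OF klin_pm_restrict[OF klin_id]])

lemma word_module_minus: "Poly_Mapping.keys p \<subseteq> S \<Longrightarrow> \<ominus>\<^bsub>word_module S\<^esub> p = - p"
  using khom_minus[OF kmod_word_module khom_word_module, of S p]
  by (simp add: klin_minus[OF klin_pm_restrict[OF klin_id]] pm_restrict_id)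

section \<open>The jet algebra\<close>

lemma free_jet_der_of_nat: "free_jet_der (of_nat n) = 0"
  by (induction n) (simp_all add: klin_add[OF klin_free_jet_der[OF klin_id]] klin_zero[OF klin_free_jet_der[OF klin_id]]
      free_jet_der_one)

lemma free_jet_der_pow_mult:
  "(free_jet_der ^^ k) (f * g) = (\<Sum>j\<le>k. of_nat (k choose j) * (free_jet_der ^^ j) f * (free_jet_der ^^ (k - j)) g)"
proof (induction k)
  case (Suc k)
  let ?x = "\<lambda>j. (free_jet_der ^^ j) f" and ?y = "\<lambda>j. (free_jet_der ^^ j) g"
  \<comment> \<open>The term with \<open>j = 0\<close> is split off so that Pascal's rule applies to
    the remaining coefficients.\<close>
  have "(\<Sum>j\<le>Suc k. of_nat (Suc k choose j) * ?x j * ?y (Suc k - j)) =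
      ?x 0 * ?y (Suc k) + (\<Sum>j\<le>k. of_nat (k choose Suc j) * ?x (Suc j) * ?y (k - j))
      + (\<Sum>j\<le>k. of_nat (k choose j) * ?x (Suc j) * ?y (k - j))"
    unfolding sum.atMost_Suc_shift by (simp add: distrib_right sum.distrib algebra_simps del: funpow.simps)
  also have "?x 0 * ?y (Suc k) + (\<Sum>j\<le>k. of_nat (k choose Suc j) * ?x (Suc j) * ?y (k - j)) =
      (\<Sum>j\<le>Suc k. of_nat (k choose j) * ?x j * ?y (Suc k - j))"
    unfolding sum.atMost_Suc_shift by (simp del: funpow.simps add: funpow_0)
  also have "\<dots> = (\<Sum>j\<le>k. of_nat (k choose j) * ?x j * ?y (Suc (k - j)))"
    by (simp add: binomial_eq_0 Suc_diff_le del: funpow.simps)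
  finally show ?case
    by (simp add: Suc klin_sum[OF klin_free_jet_der[OF klin_id]] free_jet_der_mult free_jet_der_of_nat mult.assoc distrib_left
        sum.distrib add.commute)
qed simp

lemma free_jet_der_pow_letter: "(free_jet_der ^^ k) (bas [(a, 0)]) = bas [(a, k)]"
  by (induction k) (simp_all add: free_jet_der_letter)

lemma klin_free_jet_der': "klin free_jet_der"
  by (rule klin_free_jet_der[OF klin_id])

section \<open>The ideal of the jet algebra and its stability under the derivation\<close>

context assoc_algebra
begin

abbreviation jet_words :: "('v letter) list set" where
  "jet_words \<equiv> lists (carrier A \<times> UNIV)"

text \<open>A concatenation consists of letters over the carrier exactly when both parts do, so
  discarding all other words respects products.\<close>

lemma jet_restrict_mult: "pm_restrict jet_words (p * q) = pm_restrict jet_words p * (pm_restrict jet_words q :: ('v letter, 'k) free1)"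
  by (rule klin2_eqI[where f = "\<lambda>p q. pm_restrict jet_words (p * q)"], (intro klin_intros)+)
    (auto simp: bas_append)

lemma jet_restrict_one: "pm_restrict jet_words 1 = (1 :: ('v letter, 'k) free1)"
  using pm_restrict_bas[of jet_words "[]"] by (simp add: bas_Nil)

lemma jet_restrict_der: "pm_restrict jet_words (free_jet_der p) = free_jet_der (pm_restrict jet_words p :: ('v letter, 'k) free1)"
proof -
  let ?S = "{p :: ('v letter, 'k) free1. pm_restrict jet_words (free_jet_der p) = free_jet_der (pm_restrict jet_words p)}"
  have "p \<in> ?S"
  proof (rule free1_generated_letters)
    show "ksubspace ?S"
      by (rule subspace_equaliser) (intro klin_intros)+
    show "1 \<in> ?S"
      by (simp add: jet_restrict_one free_jet_der_one klin_zero[OF klin_pm_restrict[OF klin_id]])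
    show "f * g \<in> ?S" if "f \<in> ?S" "g \<in> ?S" for f g
      using that by (simp add: free_jet_der_mult jet_restrict_mult klin_add[OF klin_pm_restrict[OF klin_id]])
    show "bas [x] \<in> ?S" for x
      by (cases x) (simp add: free_jet_der_letter klin_zero[OF klin_free_jet_der'])
  qed
  then show ?thesis by simp
qed

lemma jet_keys_mult:
  fixes p q :: "('v letter, 'k) free1"
  assumes "Poly_Mapping.keys p \<subseteq> jet_words" "Poly_Mapping.keys q \<subseteq> jet_words"
  shows "Poly_Mapping.keys (p * q) \<subseteq> jet_words"
proof -
  have "p * q = pm_restrict jet_words (p * q)"
    using assms by (simp add: jet_restrict_mult pm_restrict_id)
  then show ?thesis
    using keys_pm_restrict[of jet_words "p * q"] by (metis inf_le2)
qed

lemma ring_jet_free: "ring (jet_free A)"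
proof (rule ringI)
  show "abelian_group (jet_free A)"
    using kmod_word_module unfolding jet_free_def Module.module_def by blast
  show "Group.monoid (jet_free A)"
    unfolding jet_free_def by (rule monoidI) (simp_all add: jet_keys_mult zero_list_def mult.assoc)
qed (simp_all add: jet_free_def algebra_simps)

lemma jet_rels_carrier: "jet_rels A \<subseteq> carrier (jet_free A)"
proof -
  have sym: "Poly_Mapping.keys (jet_sym a k :: ('v letter, 'k) free1) \<subseteq> jet_words" if "a \<in> carrier A" for a k
    using that by (simp add: jet_sym_def)
  note sub = subspace_keys[of jet_words, where ?'k = 'k]
  note S = subspace_add[OF sub] subspace_diff[OF sub] subspace_smult[OF sub] subspace_sum[OF sub]
  have prod: "of_nat n * jet_sym a j * jet_sym b l \<in> {p :: ('v letter, 'k) free1. Poly_Mapping.keys p \<subseteq> jet_words}"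
    if "a \<in> carrier A" "b \<in> carrier A" for n a j b l
    using S(3)[of "jet_sym a j * jet_sym b l" "of_nat n"] jet_keys_mult[OF sym sym] that
    by (simp add: of_nat_mult_conv_smult pm_smult_mult_left)
  show ?thesis
    unfolding jet_rels_def jet_free_def word_module_simps
    by (intro Un_least subsetI; elim CollectE singletonE exE conjE; hypsubst; intro S prod)
      (simp_all add: sym zero_list_def)
qed

lemma ideal_jet_ideal: "ideal (jet_ideal A) (jet_free A)"
  unfolding jet_ideal_def by (rule ring.genideal_ideal[OF ring_jet_free jet_rels_carrier])

lemma jet_ideal_keys: "jet_ideal A \<subseteq> {p. Poly_Mapping.keys p \<subseteq> jet_words}"
  using ideal.Icarr[OF ideal_jet_ideal] by (auto simp: jet_free_def)

lemma jet_ideal_mult: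
  assumes "p \<in> jet_ideal A" "Poly_Mapping.keys q \<subseteq> jet_words"
  shows "q * p \<in> jet_ideal A" "p * q \<in> jet_ideal A"
  using ideal.I_l_closed[OF ideal_jet_ideal assms(1), of q] ideal.I_r_closed[OF ideal_jet_ideal assms(1), of q] assms(2)
  by (simp_all add: jet_free_def)

lemma subspace_jet_ideal: "ksubspace (jet_ideal A)"
proof -
  note sub = ideal.axioms(1)[OF ideal_jet_ideal]
  have "pm_smult c p \<in> jet_ideal A" if "p \<in> jet_ideal A" for c p
    unfolding pm_smult_conv_mult using that by (intro jet_ideal_mult) (auto simp: zero_list_def)
  then show ?thesis
    using additive_subgroup.zero_closed[OF sub] additive_subgroup.a_closed[OF sub]
    by (auto simp: ksubspace_def jet_free_def)
qed

text \<open>Stability under multiplication by every element of the type gives, after intersection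
  with the carrier of \<open>jet_free A\<close>, an ideal of that ring, to which minimality
  applies.\<close>

lemma jet_ideal_least:
  assumes S: "ksubspace S" and mult: "\<And>f g. f \<in> S \<Longrightarrow> f * g \<in> S" "\<And>f g. f \<in> S \<Longrightarrow> g * f \<in> S" and R: "jet_rels A \<subseteq> S"
  shows "jet_ideal A \<subseteq> S"
proof -
  let ?I = "S \<inter> carrier (jet_free A)"
  note sub = subspace_keys[of jet_words, where ?'k = 'k]
  have "ideal ?I (jet_free A)"
  proof (rule idealI[OF ring_jet_free])
    show "subgroup ?I (add_monoid (jet_free A))"
    proof (rule subgroup.intro)
      fix x assume x: "x \<in> ?I"
      then have "\<ominus>\<^bsub>jet_free A\<^esub> x = - x"
        unfolding jet_free_def by (intro word_module_minus) simp
      then show "inv\<^bsub>add_monoid (jet_free A)\<^esub> x \<in> ?I"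
        using x subspace_minus[OF S, of x] subspace_minus[OF sub, of x] by (simp add: a_inv_def jet_free_def)
    qed (use subspace_add[OF sub] in \<open>auto simp: jet_free_def intro: subspace_add[OF S] subspace_zero[OF S]\<close>)
  qed (auto simp: jet_free_def jet_keys_mult intro: mult)
  then have "jet_ideal A \<subseteq> ?I"
    unfolding jet_ideal_def using R jet_rels_carrier by (intro ring.genideal_minimal[OF ring_jet_free]) auto
  then show ?thesis by blast
qed

lemma jet_rels_jet_ideal: "jet_rels A \<subseteq> jet_ideal A"
  unfolding jet_ideal_def by (rule ring.genideal_self[OF ring_jet_free jet_rels_carrier])

text \<open>The relations in degree 0 generate the ideal of \<open>J\<close> as a differential ideal: by the Leibniz
  formula the others are their derivatives.\<close>

definition jet_rels0 :: "('v letter, 'k) free1 set" where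
  "jet_rels0 =
     {bas [(a \<oplus> b, 0)] - (bas [(a, 0)] + bas [(b, 0)]) | a b. a \<in> carrier A \<and> b \<in> carrier A} \<union>
     {bas [(c \<odot> a, 0)] - pm_smult c (bas [(a, 0)]) | a c. a \<in> carrier A} \<union>
     {bas [(a \<otimes> b, 0)] - bas [(a, 0)] * bas [(b, 0)] | a b. a \<in> carrier A \<and> b \<in> carrier A} \<union>
     {bas [(\<one>, 0)] - 1}"

lemma jet_mult_rel: "jet_sym (a \<otimes> b) k - (\<Sum>j\<le>k. of_nat (k choose j) * jet_sym a j * jet_sym b (k - j)) =
    (free_jet_der ^^ k) (bas [(a \<otimes> b, 0)] - bas [(a, 0)] * bas [(b, 0)] :: ('v letter, 'k) free1)"
  by (simp add: jet_sym_def klin_diff[OF klin_funpow[OF klin_free_jet_der']] free_jet_der_pow_mult free_jet_der_pow_letter)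

lemma jet_rels_of_rels0:
  assumes "jet_rels0 \<subseteq> S" and der: "\<And>f. f \<in> S \<Longrightarrow> free_jet_der f \<in> S"
  shows "jet_rels A \<subseteq> S"
proof -
  have pow: "(free_jet_der ^^ k) f \<in> S" if "f \<in> jet_rels0" for f k
    by (induction k) (use that assms in auto)
  have "jet_sym (a \<oplus> b) k - (jet_sym a k + jet_sym b k) \<in> S"
    and "jet_sym (a \<otimes> b) k - (\<Sum>j\<le>k. of_nat (k choose j) * jet_sym a j * jet_sym b (k - j)) \<in> S"
    if "a \<in> carrier A" "b \<in> carrier A" for a b k
    using pow[of "bas [(a \<oplus> b, 0)] - (bas [(a, 0)] + bas [(b, 0)])" k] pow[of "bas [(a \<otimes> b, 0)] - bas [(a, 0)] * bas [(b, 0)]" k] that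
    unfolding jet_mult_rel
    by (auto simp: jet_rels0_def jet_sym_def klin_add[OF klin_funpow[OF klin_free_jet_der']]
        klin_diff[OF klin_funpow[OF klin_free_jet_der']] free_jet_der_pow_letter)
  moreover have "jet_sym (c \<odot> a) k - pm_smult c (jet_sym a k) \<in> S" if "a \<in> carrier A" for a c k
    using pow[of "bas [(c \<odot> a, 0)] - pm_smult c (bas [(a, 0)])" k] that
    by (auto simp: jet_rels0_def jet_sym_def klin_diff[OF klin_funpow[OF klin_free_jet_der']]
        klin_smult[OF klin_funpow[OF klin_free_jet_der']] free_jet_der_pow_letter simp del: pm_smult_single)
  moreover have "jet_sym \<one> 0 - 1 \<in> S"
    using assms(1) by (auto simp: jet_rels0_def jet_sym_def)
  ultimately show ?thesis
    unfolding jet_rels_def by blast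
qed

lemma jet_rels0_jet_rels: "jet_rels0 \<subseteq> jet_rels A"
proof -
  have "bas [(a \<oplus> b, 0)] - (bas [(a, 0)] + bas [(b, 0)]) \<in> jet_rels A" if "a \<in> carrier A" "b \<in> carrier A" for a b
    unfolding jet_rels_def jet_sym_def using that by blast
  moreover have "bas [(c \<odot> a, 0)] - pm_smult c (bas [(a, 0)]) \<in> jet_rels A" if "a \<in> carrier A" for a c
    unfolding jet_rels_def jet_sym_def using that by blast
  moreover have "bas [(a \<otimes> b, 0)] - bas [(a, 0)] * bas [(b, 0)] \<in> jet_rels A" if "a \<in> carrier A" "b \<in> carrier A" for a b
  proof -
    have "bas [(a \<otimes> b, 0)] - bas [(a, 0)] * bas [(b, 0)] =
        jet_sym (a \<otimes> b) 0 - (\<Sum>j\<le>0. of_nat (0 choose j) * jet_sym a j * jet_sym b (0 - j) :: ('v letter, 'k) free1)"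
      by (simp add: jet_sym_def)
    then show ?thesis
      unfolding jet_rels_def using that by blast
  qed
  moreover have "bas [(\<one>, 0)] - 1 \<in> jet_rels A"
    unfolding jet_rels_def jet_sym_def by blast
  ultimately show ?thesis
    unfolding jet_rels0_def by blast
qed

text \<open>Letters outside \<^term>\<open>carrier A\<close> are sent to \<open>0\<close>, which makes \<open>J\<close> a quotient of the free algebra on
  the whole type of letters.\<close>

definition jet_kernel :: "('v letter, 'k) free1 set" where
  "jet_kernel = {p. pm_restrict jet_words p \<in> jet_ideal A}"

definition jet_gens :: "('v letter, 'k) free1 set" where
  "jet_gens = jet_rels0 \<union> {bas [(x, 0)] | x. x \<notin> carrier A}"

lemma subspace_jet_kernel: "ksubspace jet_kernel"
  unfolding jet_kernel_def by (rule subspace_vimage[OF _ subspace_jet_ideal]) (intro klin_intros)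

lemma jet_kernel_mult: "f \<in> jet_kernel \<Longrightarrow> g * f \<in> jet_kernel" "f \<in> jet_kernel \<Longrightarrow> f * g \<in> jet_kernel"
  using jet_ideal_mult[of "pm_restrict jet_words f" "pm_restrict jet_words g"]
  by (simp_all add: jet_kernel_def jet_restrict_mult keys_pm_restrict)

lemma jet_ideal_kernel: "p \<in> jet_ideal A \<Longrightarrow> p \<in> jet_kernel"
  using jet_ideal_keys by (auto simp: jet_kernel_def pm_restrict_id)

lemma jet_gens_kernel: "jet_gens \<subseteq> jet_kernel"
  unfolding jet_gens_def using jet_rels0_jet_rels jet_rels_jet_ideal jet_ideal_kernel
  by (auto simp: jet_kernel_def subspace_zero[OF subspace_jet_ideal])

text \<open>The relation for the unit is imposed in degree 0 only. Its derivative, the letter x for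
  \<partial>(1), comes from the Leibniz relation for 1 times 1 in degree 1: modulo the degree 0
  relation it reads x = 2 x.\<close>

lemma free_jet_der_bas_one: "bas [(\<one>, Suc 0)] \<in> jet_ideal A"
proof -
  note S = subspace_add[OF subspace_jet_ideal] subspace_diff[OF subspace_jet_ideal]
  let ?x = "bas [(\<one>, Suc 0)] :: ('v letter, 'k) free1" and ?r = "bas [(\<one>, 0)] - 1 :: ('v letter, 'k) free1"
  have x: "Poly_Mapping.keys ?x \<subseteq> jet_words" by simp
  have r: "?r \<in> jet_ideal A"
    using jet_rels_jet_ideal jet_rels0_jet_rels by (auto simp: jet_rels0_def)
  have "jet_sym (\<one> \<otimes> \<one>) 1 - (\<Sum>j\<le>1. of_nat (1 choose j) * jet_sym \<one> j * jet_sym \<one> (1 - j)) \<in> jet_rels A"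
    unfolding jet_rels_def by blast
  then have "?x - (bas [(\<one>, 0)] * ?x + ?x * bas [(\<one>, 0)]) \<in> jet_ideal A"
    using jet_rels_jet_ideal by (auto simp: jet_sym_def)
  moreover have "?r * ?x + ?x * ?r \<in> jet_ideal A"
    by (rule S(1)[OF jet_ideal_mult(2)[OF r x] jet_ideal_mult(1)[OF r x]])
  ultimately have "- (?x - (bas [(\<one>, 0)] * ?x + ?x * bas [(\<one>, 0)]) + (?r * ?x + ?x * ?r)) \<in> jet_ideal A"
    by (rule subspace_minus[OF subspace_jet_ideal S(1)])
  then show ?thesis
    by (simp add: algebra_simps)
qed

lemma jet_ideal_der: "p \<in> jet_ideal A \<Longrightarrow> free_jet_der p \<in> jet_ideal A"
proof -
  \<comment> \<open>The derivative of \<open>f * g\<close> contains \<open>f\<close> itself, hence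
    the first condition; \<open>jet_kernel\<close> replaces the ideal because
    \<open>jet_ideal_least\<close> asks for stability under multipliers that may contain letters
    outside the carrier.\<close>
  let ?S = "{p \<in> jet_kernel. free_jet_der p \<in> jet_kernel}"
  have "jet_ideal A \<subseteq> ?S"
  proof (rule jet_ideal_least)
    show "ksubspace ?S"
      using subspace_jet_kernel subspace_vimage[OF klin_free_jet_der' subspace_jet_kernel] by (auto simp: ksubspace_def)
  next
    fix f g assume "f \<in> ?S"
    then show "f * g \<in> ?S" "g * f \<in> ?S"
      by (auto simp: free_jet_der_mult intro: subspace_add[OF subspace_jet_kernel] jet_kernel_mult)
  next
    have der: "free_jet_der (jet_sym a k) = (jet_sym a (Suc k) :: ('v letter, 'k) free1)" for a k
      by (simp add: jet_sym_def free_jet_der_letter)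
    note lin = klin_simps[OF klin_free_jet_der'] 
    have "jet_rels A \<subseteq> {p. free_jet_der p \<in> jet_ideal A}"
    proof
      fix r assume "r \<in> jet_rels A"
      then consider (a) a b k where "r = jet_sym (a \<oplus> b) k - (jet_sym a k + jet_sym b k)" "a \<in> carrier A" "b \<in> carrier A"
        | (s) c a k where "r = jet_sym (c \<odot> a) k - pm_smult c (jet_sym a k)" "a \<in> carrier A"
        | (m) a b k where "r = jet_sym (a \<otimes> b) k - (\<Sum>j\<le>k. of_nat (k choose j) * jet_sym a j * jet_sym b (k - j))"
            "a \<in> carrier A" "b \<in> carrier A"
        | (o) "r = jet_sym \<one> 0 - 1"
        unfolding jet_rels_def by blast
      then show "r \<in> {p. free_jet_der p \<in> jet_ideal A}"
      proof cases
        case a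
        then have "free_jet_der r \<in> jet_rels A"
          unfolding jet_rels_def by (simp add: lin der) blast
        then show ?thesis using jet_rels_jet_ideal by blast
      next
        case s
        then have "free_jet_der r \<in> jet_rels A"
          unfolding jet_rels_def by (simp add: lin der) blast
        then show ?thesis using jet_rels_jet_ideal by blast
      next
        case m
        \<comment> \<open>By \<open>jet_mult_rel\<close> the product relation in degree
          \<open>k\<close> is a k-th derivative, so one more derivation yields the relation in
          degree \<open>Suc k\<close>.\<close>
        have "free_jet_der r = jet_sym (a \<otimes> b) (Suc k) -
            (\<Sum>j\<le>Suc k. of_nat (Suc k choose j) * jet_sym a j * jet_sym b (Suc k - j))"
          unfolding m(1) jet_mult_rel by simp
        then have "free_jet_der r \<in> jet_rels A"
          unfolding jet_rels_def using m(2,3) by blast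
        then show ?thesis using jet_rels_jet_ideal by blast
      next
        case o
        then show ?thesis
          using free_jet_der_bas_one by (simp add: lin der free_jet_der_one) (simp add: jet_sym_def)
      qed
    qed
    then show "jet_rels A \<subseteq> ?S"
      using jet_rels_jet_ideal jet_ideal_kernel by blast
  qed
  moreover assume p: "p \<in> jet_ideal A"
  ultimately have "pm_restrict jet_words (free_jet_der p) \<in> jet_ideal A"
    by (auto simp: jet_kernel_def)
  then show "free_jet_der p \<in> jet_ideal A"
    using p jet_ideal_keys by (auto simp: jet_restrict_der pm_restrict_id)
qed

lemma jet_kernel_der: "f \<in> jet_kernel \<Longrightarrow> free_jet_der f \<in> jet_kernel"
  by (simp add: jet_kernel_def jet_restrict_der jet_ideal_der)

lemma diff_ideal_jet_kernel: "diff_ideal jet_kernel"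
  by standard (auto intro: subspace_jet_kernel jet_kernel_mult jet_kernel_der)

text \<open>An element splits into its restriction, which lies in the jet ideal, and a combination
  of words with some letter outside the carrier. Such a letter is a derivative of a generator, and
  the relations in all degrees come from those in degree 0.\<close>

lemma jet_kernel_least:
  assumes S: "ksubspace S" and mult: "\<And>f g. f \<in> S \<Longrightarrow> f * g \<in> S" "\<And>f g. f \<in> S \<Longrightarrow> g * f \<in> S"
    and der: "\<And>f. f \<in> S \<Longrightarrow> free_jet_der f \<in> S" and gens: "jet_gens \<subseteq> S"
  shows "jet_kernel \<subseteq> S"
proof
  fix p assume "p \<in> jet_kernel"
  moreover have "jet_ideal A \<subseteq> S"
    using gens by (intro jet_ideal_least[OF S mult] jet_rels_of_rels0 der) (auto simp: jet_gens_def)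
  ultimately have "pm_restrict jet_words p \<in> S"
    by (auto simp: jet_kernel_def)
  moreover have "p - pm_restrict jet_words p \<in> S"
  proof (rule klin_memI[where f = "\<lambda>p. p - pm_restrict jet_words p", OF _ S], (intro klin_intros)+)
    fix w :: "'v letter list"
    show "bas w - pm_restrict jet_words (bas w) \<in> S"
    proof (cases "w \<in> jet_words")
      case False
      then obtain x k where "(x, k) \<in> set w" and x: "x \<notin> carrier A" by auto
      then obtain u v where w: "w = u @ [(x, k)] @ v"
        by (metis append_Cons append_Nil split_list)
      have "bas [(x, k)] \<in> S"
        by (induction k) (use gens x der in \<open>auto simp: jet_gens_def simp flip: free_jet_der_letter\<close>)
      then have "bas u * (bas [(x, k)] * bas v) \<in> S"
        by (intro mult)
      then show ?thesis
        using False subspace_zero[OF S] by (simp add: w bas_append)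
    qed (simp add: subspace_zero[OF S])
  qed
  ultimately show "p \<in> S"
    using subspace_add[OF S] by fastforce
qed

section \<open>The projection from the free algebra onto the jet algebra\<close>

definition jp :: "('v letter, 'k) free1 \<Rightarrow> ('k, 'v) jet" where
  "jp = qcls jet_words (jet_ideal A)"

lemmas jet_quot = subspace_jet_ideal jet_ideal_keys

lemma khom_jp: "khom (jet_algebra A) jp"
  unfolding jp_def jet_algebra_def jet_free_def by (rule khom_qcls[OF jet_quot])

lemma kmod_jet: "kmod (jet_algebra A)"
  unfolding jet_algebra_def jet_free_def by (rule kmod_quot[OF jet_quot])

lemma jet_carrier: "carrier (jet_algebra A) = range jp"
  unfolding jp_def jet_algebra_def jet_free_def by (rule quot_carrier[OF jet_quot])

lemma jp_eq_iff: "jp p = jp q \<longleftrightarrow> p - q \<in> jet_kernel"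
  unfolding jp_def qcls_eq_iff[OF jet_quot] by (simp add: jet_kernel_def)

lemma jp_alt: "jp p = (\<lambda>n. n + pm_restrict jet_words p) ` jet_ideal A"
  by (simp add: jp_def qcls_def word_coset)

lemma jp_mult: "jp (p * q) = jp p \<otimes>\<^bsub>jet_algebra A\<^esub> jp q"
proof -
  let ?p = "pm_restrict jet_words p" and ?q = "pm_restrict jet_words q"
  note S = subspace_add[OF subspace_jet_ideal]
  have "jp p \<otimes>\<^bsub>jet_algebra A\<^esub> jp q = (\<Union>m\<in>jet_ideal A. \<Union>n\<in>jet_ideal A. (\<lambda>l. l + (m + ?p) * (n + ?q)) ` jet_ideal A)"
    by (simp add: jet_algebra_def quot_module_def ring.extend_def FactRing_def rcoset_mult_def jp_alt jet_free_def
        word_coset)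
  also have "\<dots> = (\<Union>m\<in>jet_ideal A. \<Union>n\<in>jet_ideal A. jp (p * q))"
  proof (intro SUP_cong refl)
    fix m n assume m: "m \<in> jet_ideal A" and n: "n \<in> jet_ideal A"
    have keys: "Poly_Mapping.keys (n + ?q) \<subseteq> jet_words" "Poly_Mapping.keys ?p \<subseteq> jet_words"
      using n jet_ideal_keys Poly_Mapping.keys_add[of n ?q] unfolding keys_pm_restrict by blast+
    have "(m + ?p) * (n + ?q) - ?p * ?q = m * (n + ?q) + ?p * n"
      by (simp add: algebra_simps)
    also have "\<dots> \<in> jet_ideal A"
      by (intro S jet_ideal_mult m n keys)
    finally show "(\<lambda>l. l + (m + ?p) * (n + ?q)) ` jet_ideal A = jp (p * q)"
      unfolding jp_alt jet_restrict_mult translate_eq_iff[OF jet_quot] .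
  qed
  also have "\<dots> = jp (p * q)"
    using subspace_zero[OF subspace_jet_ideal] by auto
  finally show ?thesis by simp
qed

lemma jp_one: "\<one>\<^bsub>jet_algebra A\<^esub> = jp 1"
  by (simp add: jet_algebra_def quot_module_def ring.extend_def FactRing_def jp_alt jet_free_def word_coset
      jet_restrict_one)

lemma jp_embed: "a \<in> carrier A \<Longrightarrow> jet_embed A a = jp (bas [(a, 0)])"
  by (simp add: jet_embed_def jp_alt jet_free_def word_coset jet_sym_def)

lemma jp_der: "jet_der A (jp p) = jp (free_jet_der p)"
proof -
  have "jet_der A (jp p) = (\<Union>m\<in>jet_ideal A. (\<lambda>l. l + free_jet_der (m + pm_restrict jet_words p)) ` jet_ideal A)"
    by (simp add: jet_der_def jp_alt jet_free_def word_coset)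
  also have "\<dots> = (\<Union>m\<in>jet_ideal A. jp (free_jet_der p))"
    unfolding jp_alt
    by (intro SUP_cong refl, subst translate_eq_iff[OF jet_quot])
      (simp add: klin_add[OF klin_free_jet_der'] jet_restrict_der jet_ideal_der)
  also have "\<dots> = jp (free_jet_der p)"
    using subspace_zero[OF subspace_jet_ideal] by auto
  finally show ?thesis .
qed

lemma assoc_algebra_jet: "assoc_algebra (jet_algebra A)"
proof -
  have "ring (jet_algebra A)"
  proof (rule ringI)
    show "abelian_group (jet_algebra A)"
      using kmod_jet unfolding Module.module_def by blast
    show "Group.monoid (jet_algebra A)"
      by (rule monoidI) (auto simp: jet_carrier jp_one mult.assoc simp flip: jp_mult)
  qed (auto simp: jet_carrier distrib_left distrib_right simp flip: jp_mult khom_add[OF khom_jp])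
  then show ?thesis
    unfolding assoc_algebra_def assoc_algebra_axioms_def using kmod_jet
    by (auto simp: jet_carrier pm_smult_mult_left pm_smult_mult_right simp flip: jp_mult khom_smult[OF khom_jp])
qed

lemma derivation_jet: "derivation (jet_algebra A) (jet_der A)"
  unfolding derivation_def derivation_axioms_def using assoc_algebra_jet
  by (auto simp: jet_carrier jp_der free_jet_der_mult klin_add[OF klin_free_jet_der'] klin_smult[OF klin_free_jet_der']
      simp flip: jp_mult khom_add[OF khom_jp] khom_smult[OF khom_jp])

end

section \<open>Operations on the tensor square, computed on representatives\<close>

lemma keys_ext_subset:
  assumes "\<And>x. x \<in> Poly_Mapping.keys p \<Longrightarrow> Poly_Mapping.keys (f x) \<subseteq> S"
  shows "Poly_Mapping.keys (ext f p) \<subseteq> S"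
proof -
  have "ext f p \<in> {p. Poly_Mapping.keys p \<subseteq> S}"
    unfolding ext_def
    by (intro subspace_sum[OF subspace_keys] subspace_smult[OF subspace_keys]) (simp add: assms)
  then show ?thesis by simp
qed

lemma bilinear_on_cong:
  assumes "bilinear_on V W F" "kmod V" "\<And>x y. x \<in> carrier V \<Longrightarrow> y \<in> carrier V \<Longrightarrow> F' x y = F x y"
  shows "bilinear_on V W F'"
proof -
  have "x \<oplus>\<^bsub>V\<^esub> y \<in> carrier V" "c \<odot>\<^bsub>V\<^esub> x \<in> carrier V" if "x \<in> carrier V" "y \<in> carrier V" for x y c
    using assms(2) that abelian_groupE(1)[of V x y] module.smult_closed[OF assms(2), of c x]
    by (auto simp: Module.module_def)
  then show ?thesis
    using assms(1,3) unfolding bilinear_on_def by simp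
qed

context kmodule
begin

lemma kmod_V: "kmod V" ..

lemma tcls_not_word: "xs \<notin> tensor_words n V \<Longrightarrow> tcls n V (bas xs) = \<zero>\<^bsub>tensor_power n V\<^esub>"
  using tcls_restrict[of n "bas xs"] by (simp add: tensor_power_zero)

lemma tensor_words_update_iff:
  "x \<in> carrier V \<Longrightarrow> y \<in> carrier V \<Longrightarrow> xs[i := x] \<in> tensor_words n V \<longleftrightarrow> xs[i := y] \<in> tensor_words n V"
  using tensor_words_update[of "xs[i := x]" n y i] tensor_words_update[of "xs[i := y]" n x i] by auto

text \<open>For words outside \<open>tensor_words\<close> all three classes vanish. Without that
  side condition, \<open>tcls_ext_add\<close> can be applied to all words at once.\<close>

lemma tcls_add': "x \<in> carrier V \<Longrightarrow> y \<in> carrier V \<Longrightarrow> i < n \<Longrightarrow>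
    tcls n V (bas (xs[i := x \<oplus> y])) = tcls n V (bas (xs[i := x])) \<oplus>\<^bsub>tensor_power n V\<^esub> tcls n V (bas (xs[i := y]))"
proof -
  assume *: "x \<in> carrier V" "y \<in> carrier V" "i < n"
  then have c: "x \<oplus> y \<in> carrier V" by simp
  show ?thesis
  proof (cases "xs[i := x] \<in> tensor_words n V")
    case True
    then show ?thesis using tcls_add[of "xs[i := x]" n i x y] * by simp
  next
    case False
    then have "tcls n V (bas (xs[i := z])) = tcls n V 0" if "z \<in> carrier V" for z
      using tensor_words_update_iff[of x z] * that by (simp add: tcls_not_word tensor_power_zero)
    then show ?thesis
      using * c khom_add[OF khom_tcls, of n 0 0] by simp
  qed
qed

lemma tcls_smult': "x \<in> carrier V \<Longrightarrow> i < n \<Longrightarrow>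
    tcls n V (bas (xs[i := c \<odot> x])) = c \<odot>\<^bsub>tensor_power n V\<^esub> tcls n V (bas (xs[i := x]))"
proof -
  assume *: "x \<in> carrier V" "i < n"
  then have c: "c \<odot> x \<in> carrier V" by simp
  show ?thesis
  proof (cases "xs[i := x] \<in> tensor_words n V")
    case True
    then show ?thesis using tcls_smult[of "xs[i := x]" n i x c] * by simp
  next
    case False
    then have "tcls n V (bas (xs[i := z])) = tcls n V 0" if "z \<in> carrier V" for z
      using tensor_words_update_iff[of x z] * that by (simp add: tcls_not_word tensor_power_zero)
    then show ?thesis
      using * c khom_smult[OF khom_tcls, of n c 0] by simp
  qed
qed

lemma tcls_lin:
  assumes "x \<in> carrier V"
  shows "tcls 2 V (bas [c \<odot> x, y]) = c \<odot>\<^bsub>tensor_power 2 V\<^esub> tcls 2 V (bas [x, y])"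
    "tcls 2 V (bas [y, c \<odot> x]) = c \<odot>\<^bsub>tensor_power 2 V\<^esub> tcls 2 V (bas [y, x])"
    "tcls 3 V (bas [c \<odot> x, y, z]) = c \<odot>\<^bsub>tensor_power 3 V\<^esub> tcls 3 V (bas [x, y, z])"
    "tcls 3 V (bas [y, c \<odot> x, z]) = c \<odot>\<^bsub>tensor_power 3 V\<^esub> tcls 3 V (bas [y, x, z])"
    "tcls 3 V (bas [y, z, c \<odot> x]) = c \<odot>\<^bsub>tensor_power 3 V\<^esub> tcls 3 V (bas [y, z, x])"
    "x' \<in> carrier V \<Longrightarrow> tcls 2 V (bas [x \<oplus> x', y]) = tcls 2 V (bas [x, y]) \<oplus>\<^bsub>tensor_power 2 V\<^esub> tcls 2 V (bas [x', y])"
    "x' \<in> carrier V \<Longrightarrow> tcls 2 V (bas [y, x \<oplus> x']) = tcls 2 V (bas [y, x]) \<oplus>\<^bsub>tensor_power 2 V\<^esub> tcls 2 V (bas [y, x'])"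
    "x' \<in> carrier V \<Longrightarrow> tcls 3 V (bas [x \<oplus> x', y, z]) = tcls 3 V (bas [x, y, z]) \<oplus>\<^bsub>tensor_power 3 V\<^esub> tcls 3 V (bas [x', y, z])"
    "x' \<in> carrier V \<Longrightarrow> tcls 3 V (bas [y, x \<oplus> x', z]) = tcls 3 V (bas [y, x, z]) \<oplus>\<^bsub>tensor_power 3 V\<^esub> tcls 3 V (bas [y, x', z])"
    "x' \<in> carrier V \<Longrightarrow> tcls 3 V (bas [y, z, x \<oplus> x']) = tcls 3 V (bas [y, z, x]) \<oplus>\<^bsub>tensor_power 3 V\<^esub> tcls 3 V (bas [y, z, x'])"
  using tcls_smult'[OF assms, of 0 2 "[x, y]" c] tcls_smult'[OF assms, of 1 2 "[y, x]" c]
    tcls_smult'[OF assms, of 0 3 "[x, y, z]" c] tcls_smult'[OF assms, of 1 3 "[y, x, z]" c]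
    tcls_smult'[OF assms, of 2 3 "[y, z, x]" c]
    tcls_add'[OF assms, of x' 0 2 "[x, y]"] tcls_add'[OF assms, of x' 1 2 "[y, x]"]
    tcls_add'[OF assms, of x' 0 3 "[x, y, z]"] tcls_add'[OF assms, of x' 1 3 "[y, x, z]"]
    tcls_add'[OF assms, of x' 2 3 "[y, z, x]"]
  by (simp_all add: numeral_2_eq_2 numeral_3_eq_3)

lemma tensor_lift2_pure:
  assumes "bilinear_on V (tensor_power n V) (\<lambda>x y. tcls n V (bas (Q x y)))"
    and Q: "\<And>x y. x \<in> carrier V \<Longrightarrow> y \<in> carrier V \<Longrightarrow> Q x y \<in> tensor_words n V"
    and p: "Poly_Mapping.keys p \<subseteq> tensor_words 2 V"
  shows "tensor_lift2 (tensor_power n V) (\<lambda>x y. pure V (Q x y)) (tcls 2 V p) =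
    tcls n V (ext (\<lambda>xs. bas (Q (xs ! 0) (xs ! 1))) p)"
proof (rule tensor_lift2_tcls[OF kmod_tensor_power khom_tcls _ _ p])
  show "bilinear_on V (tensor_power n V) (\<lambda>x y. pure V (Q x y))"
    by (rule bilinear_on_cong[OF assms(1) kmod_V]) (simp add: pure_eq_tcls[OF Q])
qed (simp add: pure_eq_tcls[OF Q])

lemma tensor_lift2_tcls_tcls:
  assumes F: "\<And>x y. x \<in> carrier V \<Longrightarrow> y \<in> carrier V \<Longrightarrow> F x y = tcls n V (q x y)"
    and bil: "bilinear_on V (tensor_power n V) (\<lambda>x y. tcls n V (q x y))"
    and p: "Poly_Mapping.keys p \<subseteq> tensor_words 2 V"
  shows "tensor_lift2 (tensor_power n V) F (tcls 2 V p) = tcls n V (ext (\<lambda>xs. q (xs ! 0) (xs ! 1)) p)"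
  by (rule tensor_lift2_tcls[OF kmod_tensor_power khom_tcls _ _ p])
    (auto intro: bilinear_on_cong[OF bil kmod_V] simp: F)

lemma flip_tcls:
  assumes "Poly_Mapping.keys p \<subseteq> tensor_words 2 V"
  shows "flip V (tcls 2 V p) = tcls 2 V (ext (\<lambda>xs. bas [xs ! 1, xs ! 0]) p)"
  unfolding flip_def
  by (rule tensor_lift2_pure[OF _ _ assms])
    (auto simp: bilinear_on_def tcls_lin khom_closed[OF khom_tcls] tensor_words_2)

lemma tensor_snoc_tcls:
  assumes "Poly_Mapping.keys p \<subseteq> tensor_words 2 V" "c \<in> carrier V"
  shows "tensor_snoc V (tcls 2 V p) c = tcls 3 V (ext (\<lambda>xs. bas [xs ! 0, xs ! 1, c]) p)"
  unfolding tensor_snoc_def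
  by (rule tensor_lift2_pure[OF _ _ assms(1)])
    (auto simp: bilinear_on_def tcls_lin khom_closed[OF khom_tcls] tensor_words_3 assms(2))

lemma tensor_cons_tcls:
  assumes "Poly_Mapping.keys p \<subseteq> tensor_words 2 V" "c \<in> carrier V"
  shows "tensor_cons V c (tcls 2 V p) = tcls 3 V (ext (\<lambda>xs. bas [c, xs ! 0, xs ! 1]) p)"
  unfolding tensor_cons_def
  by (rule tensor_lift2_pure[OF _ _ assms(1)])
    (auto simp: bilinear_on_def tcls_lin khom_closed[OF khom_tcls] tensor_words_3 assms(2))

lemma tensor_mid_tcls:
  assumes "Poly_Mapping.keys p \<subseteq> tensor_words 2 V" "c \<in> carrier V"
  shows "tensor_mid V (tcls 2 V p) c = tcls 3 V (ext (\<lambda>xs. bas [xs ! 0, c, xs ! 1]) p)"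
  unfolding tensor_mid_def
  by (rule tensor_lift2_pure[OF _ _ assms(1)])
    (auto simp: bilinear_on_def tcls_lin khom_closed[OF khom_tcls] tensor_words_3 assms(2))

lemma tcls_ext_add:
  assumes "\<And>xs. tcls n V (f xs) = tcls n V (g xs) \<oplus>\<^bsub>tensor_power n V\<^esub> tcls n V (h xs)"
  shows "tcls n V (ext f p) = tcls n V (ext g p) \<oplus>\<^bsub>tensor_power n V\<^esub> tcls n V (ext h p)"
proof -
  have "tcls n V (ext f p) = tcls n V (ext g p + ext h p)"
    by (rule khom_eqI[OF kmod_tensor_power khom_compose[OF khom_tcls klin_ext]
          khom_compose[OF khom_tcls klin_plus[OF klin_ext klin_ext]]]) (simp add: assms khom_add[OF khom_tcls])
  then show ?thesis by (simp add: khom_add[OF khom_tcls])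
qed

lemma tcls_ext_smult:
  assumes "\<And>xs. tcls n V (f xs) = c \<odot>\<^bsub>tensor_power n V\<^esub> tcls n V (g xs)"
  shows "tcls n V (ext f p) = c \<odot>\<^bsub>tensor_power n V\<^esub> tcls n V (ext g p)"
proof -
  have "tcls n V (ext f p) = tcls n V (pm_smult c (ext g p))"
    by (rule khom_eqI[OF kmod_tensor_power khom_compose[OF khom_tcls klin_ext]
          khom_compose[OF khom_tcls klin_pm_smult[OF klin_ext]]]) (simp add: assms khom_smult[OF khom_tcls])
  then show ?thesis by (simp add: khom_smult[OF khom_tcls])
qed

end

sublocale assoc_algebra \<subseteq> kmodule A ..

context assoc_algebra
begin

lemma inner_right_tcls:
  assumes "Poly_Mapping.keys p \<subseteq> tensor_words 2 A" "c \<in> carrier A"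
  shows "inner_right A (tcls 2 A p) c = tcls 2 A (ext (\<lambda>xs. bas [xs ! 0 \<otimes> c, xs ! 1]) p)"
  unfolding inner_right_def
  by (rule tensor_lift2_pure[OF _ _ assms(1)])
    (auto simp: bilinear_on_def tcls_lin khom_closed[OF khom_tcls] tensor_words_2 assms(2) l_distr smult_mult_left)

lemma inner_left_tcls:
  assumes "Poly_Mapping.keys p \<subseteq> tensor_words 2 A" "c \<in> carrier A"
  shows "inner_left A c (tcls 2 A p) = tcls 2 A (ext (\<lambda>xs. bas [xs ! 0, c \<otimes> xs ! 1]) p)"
  unfolding inner_left_def
  by (rule tensor_lift2_pure[OF _ _ assms(1)])
    (auto simp: bilinear_on_def tcls_lin khom_closed[OF khom_tcls] tensor_words_2 assms(2) r_distr smult_mult_right)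

end

section \<open>Representatives of the double bracket\<close>

context double_poisson_algebra
begin

text \<open>A representative of the bracket in the free module on words of length 2.\<close>

definition rp :: "'v \<Rightarrow> 'v \<Rightarrow> ('v list \<Rightarrow>\<^sub>0 'k)" where
  "rp a b = (SOME p. Poly_Mapping.keys p \<subseteq> tensor_words 2 A \<and> tcls 2 A p = br a b)"

lemma rp:
  assumes "a \<in> carrier A" "b \<in> carrier A"
  shows "Poly_Mapping.keys (rp a b) \<subseteq> tensor_words 2 A" "tcls 2 A (rp a b) = br a b"
proof -
  have "br a b \<in> range (tcls 2 A)"
    using bilinear assms unfolding tensor_power_carrier[symmetric] by (simp add: bilinear_on_def)
  then obtain p where "br a b = tcls 2 A p" by auto
  then have "Poly_Mapping.keys (pm_restrict (tensor_words 2 A) p) \<subseteq> tensor_words 2 A \<and> tcls 2 A (pm_restrict (tensor_words 2 A) p) = br a b"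
    by (simp add: tcls_restrict keys_pm_restrict)
  then have "Poly_Mapping.keys (rp a b) \<subseteq> tensor_words 2 A \<and> tcls 2 A (rp a b) = br a b"
    unfolding rp_def by (rule someI)
  then show "Poly_Mapping.keys (rp a b) \<subseteq> tensor_words 2 A" "tcls 2 A (rp a b) = br a b" by auto
qed

text \<open>The choice \<open>rp\<close> is not additive, but \<open>op\<close> depends on the class
  alone, and for classes additivity is the hypothesis on \<open>br\<close>.\<close>

lemma rp_ext_add:
  assumes op: "\<And>p. Poly_Mapping.keys p \<subseteq> tensor_words 2 A \<Longrightarrow> op (tcls 2 A p) = tcls n A (ext s p)"
    and "a \<in> carrier A" "b \<in> carrier A" "a' \<in> carrier A" "b' \<in> carrier A" "a'' \<in> carrier A" "b'' \<in> carrier A"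
    and "br a b = br a' b' \<oplus>\<^bsub>tensor_power 2 A\<^esub> br a'' b''"
  shows "tcls n A (ext s (rp a b)) = tcls n A (ext s (rp a' b')) \<oplus>\<^bsub>tensor_power n A\<^esub> tcls n A (ext s (rp a'' b''))"
proof -
  have "tcls 2 A (rp a b) = tcls 2 A (rp a' b' + rp a'' b'')"
    using assms(2-) by (simp add: rp khom_add[OF khom_tcls])
  moreover have "rp a' b' + rp a'' b'' \<in> {p. Poly_Mapping.keys p \<subseteq> tensor_words 2 A}"
    by (intro subspace_add[OF subspace_keys]) (simp_all add: rp assms(2-7))
  ultimately have "tcls n A (ext s (rp a b)) = tcls n A (ext s (rp a' b' + rp a'' b''))"
    using op[of "rp a b"] op[of "rp a' b' + rp a'' b''"] rp[OF assms(2,3)] by simp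
  then show ?thesis
    by (simp add: klin_add[OF klin_ext] khom_add[OF khom_tcls])
qed

lemma rp_ext_smult:
  assumes op: "\<And>p. Poly_Mapping.keys p \<subseteq> tensor_words 2 A \<Longrightarrow> op (tcls 2 A p) = tcls n A (ext s p)"
    and "a \<in> carrier A" "b \<in> carrier A" "a' \<in> carrier A" "b' \<in> carrier A"
    and "br a b = c \<odot>\<^bsub>tensor_power 2 A\<^esub> br a' b'"
  shows "tcls n A (ext s (rp a b)) = c \<odot>\<^bsub>tensor_power n A\<^esub> tcls n A (ext s (rp a' b'))"
proof -
  have "tcls 2 A (rp a b) = tcls 2 A (pm_smult c (rp a' b'))"
    using assms(2-) by (simp add: rp khom_smult[OF khom_tcls])
  moreover have "pm_smult c (rp a' b') \<in> {p. Poly_Mapping.keys p \<subseteq> tensor_words 2 A}"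
    by (intro subspace_smult[OF subspace_keys]) (simp_all add: rp assms(2-5))
  ultimately have "tcls n A (ext s (rp a b)) = tcls n A (ext s (pm_smult c (rp a' b')))"
    using op[of "rp a b"] op[of "pm_smult c (rp a' b')"] rp[OF assms(2,3)] by simp
  then show ?thesis
    by (simp add: klin_smult[OF klin_ext] khom_smult[OF khom_tcls])
qed

lemma br_lin:
  assumes "a \<in> carrier A" "b \<in> carrier A"
  shows "br a b \<in> carrier (tensor_power 2 A)"
    "br a (c \<odot> b) = c \<odot>\<^bsub>tensor_power 2 A\<^esub> br a b" "br (c \<odot> a) b = c \<odot>\<^bsub>tensor_power 2 A\<^esub> br a b"
    "b' \<in> carrier A \<Longrightarrow> br a (b \<oplus> b') = br a b \<oplus>\<^bsub>tensor_power 2 A\<^esub> br a b'"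
    "a' \<in> carrier A \<Longrightarrow> br (a \<oplus> a') b = br a b \<oplus>\<^bsub>tensor_power 2 A\<^esub> br a' b"
  using bilinear assms unfolding bilinear_on_def by auto

lemma bracket_L_tcls:
  assumes p: "Poly_Mapping.keys p \<subseteq> tensor_words 2 A" and a: "a \<in> carrier A"
  shows "bracket_L A br a (tcls 2 A p) =
    tcls 3 A (ext (\<lambda>xs. ext (\<lambda>zs. bas [zs ! 0, zs ! 1, xs ! 1]) (rp a (xs ! 0))) p)"
  unfolding bracket_L_def
proof (rule tensor_lift2_tcls_tcls[OF _ _ p])
  show "tensor_snoc A (br a x) y = tcls 3 A (ext (\<lambda>zs. bas [zs ! 0, zs ! 1, y]) (rp a x))"
    if "x \<in> carrier A" "y \<in> carrier A" for x y
    using tensor_snoc_tcls[of "rp a x" y] rp[OF a that(1)] that by simp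
  show "bilinear_on A (tensor_power 3 A) (\<lambda>x y. tcls 3 A (ext (\<lambda>zs. bas [zs ! 0, zs ! 1, y]) (rp a x)))"
    unfolding bilinear_on_def
    by (intro conjI allI ballI khom_closed[OF khom_tcls] tcls_ext_add tcls_ext_smult
        rp_ext_add[where op = "\<lambda>d. tensor_snoc A d y" and s = "\<lambda>zs. bas [zs ! 0, zs ! 1, y]" and n = 3 for y, OF tensor_snoc_tcls]
        rp_ext_smult[where op = "\<lambda>d. tensor_snoc A d y" and s = "\<lambda>zs. bas [zs ! 0, zs ! 1, y]" and n = 3 for y, OF tensor_snoc_tcls]) (auto simp: tcls_lin br_lin a)
qed

lemma bracket_R_tcls:
  assumes p: "Poly_Mapping.keys p \<subseteq> tensor_words 2 A" and a: "a \<in> carrier A"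
  shows "bracket_R A br a (tcls 2 A p) =
    tcls 3 A (ext (\<lambda>xs. ext (\<lambda>zs. bas [xs ! 0, zs ! 0, zs ! 1]) (rp a (xs ! 1))) p)"
  unfolding bracket_R_def
proof (rule tensor_lift2_tcls_tcls[OF _ _ p])
  show "tensor_cons A x (br a y) = tcls 3 A (ext (\<lambda>zs. bas [x, zs ! 0, zs ! 1]) (rp a y))"
    if "x \<in> carrier A" "y \<in> carrier A" for x y
    using tensor_cons_tcls[of "rp a y" x] rp[OF a that(2)] that by simp
  show "bilinear_on A (tensor_power 3 A) (\<lambda>x y. tcls 3 A (ext (\<lambda>zs. bas [x, zs ! 0, zs ! 1]) (rp a y)))"
    unfolding bilinear_on_def
    by (intro conjI allI ballI khom_closed[OF khom_tcls] tcls_ext_add tcls_ext_smult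
        rp_ext_add[where op = "\<lambda>d. tensor_cons A y d" and s = "\<lambda>zs. bas [y, zs ! 0, zs ! 1]" and n = 3 for y, OF tensor_cons_tcls]
        rp_ext_smult[where op = "\<lambda>d. tensor_cons A y d" and s = "\<lambda>zs. bas [y, zs ! 0, zs ! 1]" and n = 3 for y, OF tensor_cons_tcls]) (auto simp: tcls_lin br_lin a)
qed

lemma bracket_fst_L_tcls:
  assumes p: "Poly_Mapping.keys p \<subseteq> tensor_words 2 A" and c: "c \<in> carrier A"
  shows "bracket_fst_L A br (tcls 2 A p) c =
    tcls 3 A (ext (\<lambda>xs. ext (\<lambda>zs. bas [zs ! 0, xs ! 1, zs ! 1]) (rp (xs ! 0) c)) p)"
  unfolding bracket_fst_L_def
proof (rule tensor_lift2_tcls_tcls[OF _ _ p])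
  show "tensor_mid A (br x c) y = tcls 3 A (ext (\<lambda>zs. bas [zs ! 0, y, zs ! 1]) (rp x c))"
    if "x \<in> carrier A" "y \<in> carrier A" for x y
    using tensor_mid_tcls[of "rp x c" y] rp[OF that(1) c] that by simp
  show "bilinear_on A (tensor_power 3 A) (\<lambda>x y. tcls 3 A (ext (\<lambda>zs. bas [zs ! 0, y, zs ! 1]) (rp x c)))"
    unfolding bilinear_on_def
    by (intro conjI allI ballI khom_closed[OF khom_tcls] tcls_ext_add tcls_ext_smult
        rp_ext_add[where op = "\<lambda>d. tensor_mid A d y" and s = "\<lambda>zs. bas [zs ! 0, y, zs ! 1]" and n = 3 for y, OF tensor_mid_tcls]
        rp_ext_smult[where op = "\<lambda>d. tensor_mid A d y" and s = "\<lambda>zs. bas [zs ! 0, y, zs ! 1]" and n = 3 for y, OF tensor_mid_tcls]) (auto simp: tcls_lin br_lin c)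
qed

end

section \<open>The bracket on letters\<close>

lemma klin_ext_apply: "klin h \<Longrightarrow> h (ext f p) = ext (\<lambda>x. h (f x)) p"
  by (simp add: ext_def klin_sum klin_smult)

lemmas t2_lin = klin_simps[OF klin_t2_1[OF klin_id]] klin_simps[OF klin_t2_2[OF klin_id]]
lemmas t3_lin = klin_simps[OF klin_t3(1)[OF klin_id]] klin_simps[OF klin_t3(2)[OF klin_id]] klin_simps[OF klin_t3(3)[OF klin_id]]

lemma t2_single: "t2 f (Poly_Mapping.single w c) n = pm_smult c (t2 f (bas w) n)"
  "t2 (Poly_Mapping.single w c) f n = pm_smult c (t2 (bas w) f n)"
  using klin_smult[OF klin_t2_1[OF klin_id], of c "bas w"] klin_smult[OF klin_t2_2[OF klin_id], of _ c "bas w"] by simp_all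

lemma t3_single: "t3 (Poly_Mapping.single w c) f g m n = pm_smult c (t3 (bas w) f g m n)"
  "t3 f (Poly_Mapping.single w c) g m n = pm_smult c (t3 f (bas w) g m n)"
  "t3 f g (Poly_Mapping.single w c) m n = pm_smult c (t3 f g (bas w) m n)"
  using klin_smult[OF klin_t3(1)[OF klin_id], of c "bas w"] klin_smult[OF klin_t3(2)[OF klin_id], of _ c "bas w"]
    klin_smult[OF klin_t3(3)[OF klin_id], of _ _ c "bas w"] by simp_all

lemma (in kmodule) word_nth:
  assumes "Poly_Mapping.keys p \<subseteq> tensor_words 2 V" "xs \<in> Poly_Mapping.keys p"
  shows "xs ! 0 \<in> carrier V" "xs ! 1 \<in> carrier V" "xs ! Suc 0 \<in> carrier V"
  using assms by (auto simp: tensor_words_2 subset_eq)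

sublocale assoc_algebra \<subseteq> N: diff_ideal jet_kernel
  by (rule diff_ideal_jet_kernel)

context assoc_algebra
begin

section \<open>Tensor words over A as elements of the free tensor powers\<close>

definition psi2 :: "('v list \<Rightarrow>\<^sub>0 'k) \<Rightarrow> ('v letter, 'k) free2" where
  "psi2 = ext (\<lambda>xs. t2 (bas [(xs ! 0, 0)]) (bas [(xs ! 1, 0)]) 0)"

definition psi3 :: "('v list \<Rightarrow>\<^sub>0 'k) \<Rightarrow> ('v letter, 'k) free3" where
  "psi3 = ext (\<lambda>xs. t3 (bas [(xs ! 0, 0)]) (bas [(xs ! 1, 0)]) (bas [(xs ! 2, 0)]) 0 0)"

lemma klin_psi2: "klin psi2" and klin_psi3: "klin psi3"
  unfolding psi2_def psi3_def by (rule klin_ext)+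

lemma jet_gens_I:
  "a \<in> carrier A \<Longrightarrow> b \<in> carrier A \<Longrightarrow> bas [(a \<oplus> b, 0)] - bas [(a, 0)] - bas [(b, 0)] \<in> jet_gens"
  "a \<in> carrier A \<Longrightarrow> bas [(c \<odot> a, 0)] - Poly_Mapping.single [(a, 0)] c \<in> jet_gens"
  "a \<in> carrier A \<Longrightarrow> b \<in> carrier A \<Longrightarrow> bas [(a \<otimes> b, 0)] - bas [(a, 0)] * bas [(b, 0)] \<in> jet_gens"
  "bas [(\<one>, 0)] - 1 \<in> jet_gens"
  "x \<notin> carrier A \<Longrightarrow> bas [(x, 0)] \<in> jet_gens"
proof -
  show "bas [(a \<oplus> b, 0)] - bas [(a, 0)] - bas [(b, 0)] \<in> jet_gens" if "a \<in> carrier A" "b \<in> carrier A"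
    unfolding jet_gens_def jet_rels0_def diff_diff_eq using that by blast
  show "bas [(c \<odot> a, 0)] - Poly_Mapping.single [(a, 0)] c \<in> jet_gens" if "a \<in> carrier A"
  proof -
    have "bas [(c \<odot> a, 0)] - pm_smult c (bas [(a, 0)]) \<in> jet_gens"
      unfolding jet_gens_def jet_rels0_def using that by blast
    then show ?thesis by simp
  qed
  show "bas [(a \<otimes> b, 0)] - bas [(a, 0)] * bas [(b, 0)] \<in> jet_gens" if "a \<in> carrier A" "b \<in> carrier A"
    unfolding jet_gens_def jet_rels0_def using that by blast
  show "bas [(\<one>, 0)] - 1 \<in> jet_gens"
    unfolding jet_gens_def jet_rels0_def by blast
  show "bas [(x, 0)] \<in> jet_gens" if "x \<notin> carrier A"
    unfolding jet_gens_def using that by blast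
qed

lemmas jet_kernel_I = jet_gens_I[THEN jet_gens_kernel[THEN subsetD]]

text \<open>Multilinearity relations between words turn into the linear relations between letters of
  degree 0, tensored with one further letter.\<close>

lemma psi2_null: "p \<in> tensor_null 2 A \<Longrightarrow> psi2 p \<in> N.N2"
  unfolding tensor_null_def
proof (erule span_mem_vimage[OF _ klin_psi2 N.subspace_N2])
  fix r assume "r \<in> tensor_rels 2 A"
  then consider (a) xs i x y where "xs \<in> tensor_words 2 A" "i < 2" "x \<in> carrier A" "y \<in> carrier A"
      "r = bas (xs[i := x \<oplus> y]) - bas (xs[i := x]) - bas (xs[i := y])"
    | (s) xs i x c where "xs \<in> tensor_words 2 A" "i < 2" "x \<in> carrier A"
      "r = bas (xs[i := c \<odot> x]) - Poly_Mapping.single (xs[i := x]) c"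
    unfolding tensor_rels_def by blast
  then show "psi2 r \<in> N.N2"
  proof cases
    case a
    then show ?thesis
      using N.t2_N2[OF disjI1[OF jet_kernel_I(1)[OF a(3,4)]]] N.t2_N2[OF disjI2[OF jet_kernel_I(1)[OF a(3,4)]]]
      by (auto simp: less_2_cases_iff tensor_words_2 klin_diff[OF klin_psi2] t2_lin) (auto simp: psi2_def)
  next
    case s
    then show ?thesis
      using N.t2_N2[OF disjI1[OF jet_kernel_I(2)[OF s(3), of c]]] N.t2_N2[OF disjI2[OF jet_kernel_I(2)[OF s(3), of c]]] s
      by (auto simp: less_2_cases_iff tensor_words_2 klin_diff[OF klin_psi2] t2_single[where c = c] t2_lin(5,10)) (auto simp: psi2_def)
  qed
qed

lemma psi3_null: "p \<in> tensor_null 3 A \<Longrightarrow> psi3 p \<in> N.N3"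
  unfolding tensor_null_def
proof (erule span_mem_vimage[OF _ klin_psi3 N.subspace_N3])
  fix r assume "r \<in> tensor_rels 3 A"
  then consider (a) xs i x y where "xs \<in> tensor_words 3 A" "i < 3" "x \<in> carrier A" "y \<in> carrier A"
      "r = bas (xs[i := x \<oplus> y]) - bas (xs[i := x]) - bas (xs[i := y])"
    | (s) xs i x c where "xs \<in> tensor_words 3 A" "i < 3" "x \<in> carrier A"
      "r = bas (xs[i := c \<odot> x]) - Poly_Mapping.single (xs[i := x]) c"
    unfolding tensor_rels_def by blast
  moreover have less3: "i < 3 \<longleftrightarrow> i = 0 \<or> i = 1 \<or> i = 2" for i :: nat by auto
  ultimately show "psi3 r \<in> N.N3"
  proof cases
    case a
    then show ?thesis
      using N.t3_N3[OF disjI1[OF jet_kernel_I(1)[OF a(3,4)]]] N.t3_N3[OF disjI2[OF disjI1[OF jet_kernel_I(1)[OF a(3,4)]]]]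
        N.t3_N3[OF disjI2[OF disjI2[OF jet_kernel_I(1)[OF a(3,4)]]]]
      by (auto simp: less3 tensor_words_3 klin_diff[OF klin_psi3] t3_lin) (auto simp: psi3_def)
  next
    case s
    then show ?thesis
      using N.t3_N3[OF disjI1[OF jet_kernel_I(2)[OF s(3), of c]]] N.t3_N3[OF disjI2[OF disjI1[OF jet_kernel_I(2)[OF s(3), of c]]]]
        N.t3_N3[OF disjI2[OF disjI2[OF jet_kernel_I(2)[OF s(3), of c]]]] s
      by (auto simp: less3 tensor_words_3 t3_single[where c = c] klin_diff[OF klin_psi3] klin_diff[OF klin_t3(1)[OF klin_id]]
          klin_diff[OF klin_t3(2)[OF klin_id]] klin_diff[OF klin_t3(3)[OF klin_id]]) (auto simp: psi3_def)
  qed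
qed

lemma psi2_cong:
  assumes "Poly_Mapping.keys p \<subseteq> tensor_words 2 A" "Poly_Mapping.keys q \<subseteq> tensor_words 2 A" "tcls 2 A p = tcls 2 A q"
  shows "psi2 p - psi2 q \<in> N.N2"
proof -
  have "p - q \<in> {p. Poly_Mapping.keys p \<subseteq> tensor_words 2 A}"
    by (intro subspace_diff[OF subspace_keys]) (simp_all add: assms)
  then have "p - q \<in> tensor_null 2 A"
    using assms(3) tcls_eq_zero_iff[of "p - q" 2] khom_eq_iff[OF kmod_tensor_power khom_tcls, of 2 p q] by simp
  then show ?thesis
    using psi2_null[of "p - q"] by (simp add: klin_diff[OF klin_psi2])
qed

lemma psi3_zero:
  assumes "Poly_Mapping.keys p \<subseteq> tensor_words 3 A" "tcls 3 A p = \<zero>\<^bsub>tensor_power 3 A\<^esub>"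
  shows "psi3 p \<in> N.N3"
  using assms psi3_null tcls_eq_zero_iff[of p 3] by simp

end

section \<open>Skew-symmetry, Jacobi and the relations on letters of degree 0\<close>

context double_poisson_algebra
begin

text \<open>Sesquilinearity forces this formula: a derivative of the first letter contributes
  -\<lambda>, one of the second \<partial> + \<lambda>. Letters outside the carrier vanish in
  \<open>J\<close> and may be given the bracket 0.\<close>

definition jB :: "'v letter \<Rightarrow> 'v letter \<Rightarrow> ('v letter, 'k) free2" where
  "jB x y = (if fst x \<in> carrier A \<and> fst y \<in> carrier A
     then ((\<lambda>p. - (lam * p)) ^^ snd x) ((dlam ^^ snd y) (psi2 (rp (fst x) (fst y)))) else 0)"

lemma jB_0: "a \<in> carrier A \<Longrightarrow> b \<in> carrier A \<Longrightarrow> jB (a, 0) (b, 0) = psi2 (rp a b)"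
  by (simp add: jB_def)

lemma letter_bracket_jB: "letter_bracket jB"
proof
  have "((\<lambda>p. - (lam * p)) ^^ m) (dlam p) = dlam (((\<lambda>p. - (lam * p)) ^^ m) p)" for m and p :: "('v letter, 'k) free2"
    by (induction m) (simp_all add: dlam_lam klin_minus[OF klin_dlam'])
  then show "jB x (b, Suc n) = dlam (jB x (b, n))" for x b n
    by (simp add: jB_def klin_zero[OF klin_dlam'])
qed (simp add: jB_def)

interpretation L: letter_bracket jB
  by (rule letter_bracket_jB)

lemma L_br_bad_left: "a \<notin> carrier A \<Longrightarrow> L.br (bas [(a, m)]) g = 0"
proof -
  assume a: "a \<notin> carrier A"
  have "g \<in> {g. L.br (bas [(a, m)]) g = 0}"
    by (rule free1_generated_letters)
      (auto simp: ksubspace_def L.br_simps L.br_one_right L.br_mult_right L.br_letters jB_def a)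
  then show ?thesis by simp
qed

lemma L_br_bad_right: "b \<notin> carrier A \<Longrightarrow> L.br g (bas [(b, m)]) = 0"
proof -
  assume b: "b \<notin> carrier A"
  have "g \<in> {g. L.br g (bas [(b, m)]) = 0}"
    by (rule free1_generated_letters)
      (auto simp: ksubspace_def L.br_simps L.br_one_left L.br_mult_left L.inr_zero L.inl_zero L.br_letters jB_def b)
  then show ?thesis by simp
qed

lemma jB_skew: "jB (a, 0) (b, 0) + star (jB (b, 0) (a, 0)) \<in> N.N2"
proof (cases "a \<in> carrier A \<and> b \<in> carrier A")
  case True
  let ?f = "ext (\<lambda>xs. bas [xs ! 1, xs ! 0]) :: _ \<Rightarrow> 'v list \<Rightarrow>\<^sub>0 'k"
  have keys: "Poly_Mapping.keys (?f (rp b a)) \<subseteq> tensor_words 2 A"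
    using word_nth[OF rp(1)[of b a]] True by (intro keys_ext_subset) (auto simp: tensor_words_2)
  have "tcls 2 A (rp a b) = \<ominus>\<^bsub>tensor_power 2 A\<^esub> flip A (tcls 2 A (rp b a))"
    using True by (simp add: rp(2) skew[of a b])
  also have "\<dots> = tcls 2 A (- ?f (rp b a))"
    using True by (simp add: flip_tcls rp(1) khom_minus[OF kmod_tensor_power khom_tcls])
  finally have "psi2 (rp a b) - psi2 (- ?f (rp b a)) \<in> N.N2"
    using True keys by (intro psi2_cong) (simp_all add: rp(1))
  \<comment> \<open>The image of \<open>psi2\<close> is free of \<lambda>, and there the adjoint is
    the plain flip.\<close>
  moreover have "psi2 (?f q) = star (psi2 q)" for q
    by (simp add: psi2_def ext_ext klin_ext_apply[OF klin_star[OF klin_id]] star_e1_e2)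
  ultimately show ?thesis
    using True by (simp add: jB_0 klin_minus[OF klin_psi2])
next
  case False
  then show ?thesis
    by (auto simp: jB_def klin_zero[OF klin_star[OF klin_id]] subspace_zero[OF N.subspace_N2])
qed

lemma jB_jac: "L.jac (bas [(a, 0)]) (bas [(b, 0)]) (bas [(c, 0)]) \<in> N.N3"
proof (cases "a \<in> carrier A \<and> b \<in> carrier A \<and> c \<in> carrier A")
  case True
  then have a: "a \<in> carrier A" and b: "b \<in> carrier A" and c: "c \<in> carrier A" by auto
  \<comment> \<open>\<open>?P1\<close>, \<open>?P2\<close> and \<open>?P3\<close> represent the
    three terms of the Jacobi identity of \<open>A\<close> by words of length 3; below,
    \<open>psi3\<close> sends them exactly to \<open>jac1\<close>, \<open>jac2\<close> and
    \<open>jac3\<close> on letters.\<close>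
  let ?P1 = "ext (\<lambda>xs. ext (\<lambda>zs. bas [zs ! 0, zs ! 1, xs ! 1]) (rp a (xs ! 0))) (rp b c)"
  let ?P2 = "ext (\<lambda>xs. ext (\<lambda>zs. bas [xs ! 0, zs ! 0, zs ! 1]) (rp b (xs ! 1))) (rp a c)"
  let ?P3 = "ext (\<lambda>xs. ext (\<lambda>zs. bas [zs ! 0, xs ! 1, zs ! 1]) (rp (xs ! 0) c)) (rp a b)"
  have word: "xs ! 0 \<in> carrier A" "xs ! 1 \<in> carrier A" "xs ! Suc 0 \<in> carrier A" if "xs \<in> Poly_Mapping.keys (rp x y)" "x \<in> carrier A" "y \<in> carrier A" for xs x y
    using word_nth[OF rp(1)[OF that(2,3)] that(1)] by auto
  have "tcls 3 A (?P1 - ?P2 - ?P3) = bracket_L A br a (br b c) \<ominus>\<^bsub>tensor_power 3 A\<^esub> bracket_R A br b (br a c)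
        \<ominus>\<^bsub>tensor_power 3 A\<^esub> bracket_fst_L A br (br a b) c"
    using bracket_L_tcls[OF rp(1)[OF b c] a] bracket_R_tcls[OF rp(1)[OF a c] b] bracket_fst_L_tcls[OF rp(1)[OF a b] c]
    by (simp add: rp(2) a b c khom_diff[OF kmod_tensor_power khom_tcls])
  then have "tcls 3 A (?P1 - ?P2 - ?P3) = \<zero>\<^bsub>tensor_power 3 A\<^esub>"
    using jacobi[OF a b c] by simp
  moreover have "?P1 - ?P2 - ?P3 \<in> {p. Poly_Mapping.keys p \<subseteq> tensor_words 3 A}"
  proof (intro subspace_diff[OF subspace_keys] CollectI)
    show "Poly_Mapping.keys ?P1 \<subseteq> tensor_words 3 A" "Poly_Mapping.keys ?P2 \<subseteq> tensor_words 3 A" "Poly_Mapping.keys ?P3 \<subseteq> tensor_words 3 A"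
      by (intro keys_ext_subset; use word a b c in \<open>force simp: tensor_words_3\<close>)+
  qed
  ultimately have "psi3 (?P1 - ?P2 - ?P3) \<in> N.N3"
    by (intro psi3_zero) auto
  moreover have "psi3 ?P1 = L.jac1 (bas [(a, 0)]) (bas [(b, 0)]) (bas [(c, 0)])"
  proof -
    have "L.jac1 (bas [(a, 0)]) (bas [(b, 0)]) (bas [(c, 0)]) =
        ext (\<lambda>xs. j12 (L.br (bas [(a, 0)]) (bas [(xs ! 0, 0)])) * i3 (bas [(xs ! 1, 0)])) (rp b c)"
      unfolding L.jac1_def L.br_letters jB_0[OF b c] psi2_def klin_ext_apply[OF L.klin_brL[OF klin_id]] L.brL_t2 by simp
    also have "\<dots> = psi3 ?P1"
      unfolding psi3_def ext_ext
      by (rule ext_cong) (simp add: word b c a L.br_letters jB_0 psi2_def klin_ext_apply[OF klin_mult_right[OF klin_j12[OF klin_id]]] t3_def)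
    finally show ?thesis ..
  qed
  moreover have "psi3 ?P2 = L.jac2 (bas [(a, 0)]) (bas [(b, 0)]) (bas [(c, 0)])"
  proof -
    have "L.jac2 (bas [(a, 0)]) (bas [(b, 0)]) (bas [(c, 0)]) =
        ext (\<lambda>xs. i1 (bas [(xs ! 0, 0)]) * j23 (L.br (bas [(b, 0)]) (bas [(xs ! 1, 0)]))) (rp a c)"
      unfolding L.jac2_def L.br_letters jB_0[OF a c] psi2_def klin_ext_apply[OF L.klin_brR[OF klin_id]] L.brR_t2 by simp
    also have "\<dots> = psi3 ?P2"
      unfolding psi3_def ext_ext
      by (rule ext_cong) (simp add: word b c a L.br_letters jB_0 psi2_def klin_ext_apply[OF klin_mult_left[OF klin_j23[OF klin_id]]]
          j23_t2 conv_t3(1) t3_mult)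
    finally show ?thesis ..
  qed
  moreover have "psi3 ?P3 = L.jac3 (bas [(a, 0)]) (bas [(b, 0)]) (bas [(c, 0)])"
  proof -
    have "L.jac3 (bas [(a, 0)]) (bas [(b, 0)]) (bas [(c, 0)]) =
        ext (\<lambda>xs. mid (bas [(xs ! 1, 0)]) (L.br (bas [(xs ! 0, 0)]) (bas [(c, 0)]))) (rp a b)"
      unfolding L.jac3_def L.br_letters jB_0[OF a b] psi2_def klin_ext_apply[OF L.klin_brM[OF klin_id]] L.brM_t2 by simp
    also have "\<dots> = psi3 ?P3"
      unfolding psi3_def ext_ext
      by (rule ext_cong) (simp add: word b c a L.br_letters jB_0 psi2_def klin_ext_apply[OF klin_mid[OF klin_id]] mid_t2)
    finally show ?thesis ..
  qed
  ultimately show ?thesis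
    by (simp add: L.jac_def klin_diff[OF klin_psi3])
next
  case False
  \<comment> \<open>Every argument enters each of the three terms through some bracket, so one
    letter outside the carrier annihilates all of them.\<close>
  have "L.jac (bas [(a, 0)]) (bas [(b, 0)]) (bas [(c, 0)]) = 0"
  proof -
    have 1: "L.brL (bas [(a, 0)]) p = 0" if "a \<notin> carrier A" for p
      by (rule free2_eqI[where F = "\<lambda>p. L.brL (bas [(a, 0)]) p"], (intro L.klin_brL klin_intros)+)
        (simp add: L.brL_t2 L_br_bad_left that klin_zero[OF klin_j12[OF klin_id]])
    have 2: "L.brR (bas [(b, 0)]) p = 0" if "b \<notin> carrier A" for p
      by (rule free2_eqI[where F = "\<lambda>p. L.brR (bas [(b, 0)]) p"], (intro L.klin_brR klin_intros)+)
        (simp add: L.brR_t2 L_br_bad_left that klin_zero[OF klin_j23[OF klin_id]])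
    have 3: "L.brM p (bas [(c, 0)]) = 0" if "c \<notin> carrier A" for p
      by (rule free2_eqI[where F = "\<lambda>p. L.brM p (bas [(c, 0)])"], (intro L.klin_brM klin_intros)+)
        (simp add: L.brM_t2 L_br_bad_right that klin_zero[OF klin_mid[OF klin_id]])
    show ?thesis
      using False 1 2 3
      by (auto simp: L.jac_def L.jac1_def L.jac2_def L.jac3_def L_br_bad_left L_br_bad_right
          klin_zero[OF L.klin_brL[OF klin_id]] klin_zero[OF L.klin_brR[OF klin_id]] klin_zero[OF L.klin_brM[OF klin_id]])
  qed
  then show ?thesis by (simp add: subspace_zero[OF N.subspace_N3])
qed

text \<open>A product in \<open>A\<close> gives a single letter, a product in the free algebra a
  word of two letters; the difference is a multiplicative relation of degree 0.\<close>

lemma psi2_inner_right: assumes "Poly_Mapping.keys p \<subseteq> tensor_words 2 A" "c \<in> carrier A"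
  shows "psi2 (ext (\<lambda>xs. bas [xs ! 0 \<otimes> c, xs ! 1]) p) - inr (bas [(c, 0)]) (psi2 p) \<in> N.N2"
proof -
  have "psi2 (ext (\<lambda>xs. bas [xs ! 0 \<otimes> c, xs ! 1]) p) - inr (bas [(c, 0)]) (psi2 p) =
    ext (\<lambda>xs. t2 (bas [(xs ! 0 \<otimes> c, 0)] - bas [(xs ! 0, 0)] * bas [(c, 0)]) (bas [(xs ! 1, 0)]) 0) p"
    unfolding psi2_def ext_ext klin_ext_apply[OF klin_inr[OF klin_id]] inr_t2
    by (simp add: ext_def t2_lin(5) pm.scale_right_diff_distrib sum_subtractf)
  also have "\<dots> \<in> N.N2"
    unfolding ext_def
    by (intro subspace_sum[OF N.subspace_N2] subspace_smult[OF N.subspace_N2] N.t2_N2 disjI1 jet_kernel_I(3))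
      (use assms word_nth[OF assms(1)] in \<open>auto simp: tensor_words_2\<close>)
  finally show ?thesis .
qed

lemma psi2_inner_left: assumes "Poly_Mapping.keys p \<subseteq> tensor_words 2 A" "c \<in> carrier A"
  shows "psi2 (ext (\<lambda>xs. bas [xs ! 0, c \<otimes> xs ! 1]) p) - inl (bas [(c, 0)]) (psi2 p) \<in> N.N2"
proof -
  have "psi2 (ext (\<lambda>xs. bas [xs ! 0, c \<otimes> xs ! 1]) p) - inl (bas [(c, 0)]) (psi2 p) =
    ext (\<lambda>xs. t2 (bas [(xs ! 0, 0)]) (bas [(c \<otimes> xs ! 1, 0)] - bas [(c, 0)] * bas [(xs ! 1, 0)]) 0) p"
    unfolding psi2_def ext_ext klin_ext_apply[OF klin_inl[OF klin_id]] inl_t2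
    by (simp add: ext_def t2_lin(10) pm.scale_right_diff_distrib sum_subtractf)
  also have "\<dots> \<in> N.N2"
    unfolding ext_def
    by (intro subspace_sum[OF N.subspace_N2] subspace_smult[OF N.subspace_N2] N.t2_N2 disjI2 jet_kernel_I(3))
      (use assms word_nth[OF assms(1)] in \<open>auto simp: tensor_words_2\<close>)
  finally show ?thesis .
qed

lemma jB_mult:
  assumes a: "a \<in> carrier A" and b: "b \<in> carrier A" and c: "c \<in> carrier A"
  shows "L.br (bas [(a \<otimes> b, 0)] - bas [(a, 0)] * bas [(b, 0)]) (bas [(c, 0)]) \<in> N.N2"
proof -
  let ?r = "ext (\<lambda>xs. bas [xs ! 0 \<otimes> b, xs ! 1]) (rp a c)" and ?l = "ext (\<lambda>xs. bas [xs ! 0, a \<otimes> xs ! 1]) (rp b c)"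
  have keys: "Poly_Mapping.keys ?r \<subseteq> tensor_words 2 A" "Poly_Mapping.keys ?l \<subseteq> tensor_words 2 A"
    using word_nth[OF rp(1)[OF a c]] word_nth[OF rp(1)[OF b c]] a b by (auto intro!: keys_ext_subset simp: tensor_words_2)
  then have keys': "?r + ?l \<in> {p. Poly_Mapping.keys p \<subseteq> tensor_words 2 A}"
    by (intro subspace_add[OF subspace_keys]) auto
  have "tcls 2 A (rp (a \<otimes> b) c) = tcls 2 A (?r + ?l)"
    using inner_right_tcls[OF rp(1)[OF a c] b] inner_left_tcls[OF rp(1)[OF b c] a]
    by (simp add: rp(2) a b c leibniz_left khom_add[OF khom_tcls])
  then have "psi2 (rp (a \<otimes> b) c) - psi2 (?r + ?l) \<in> N.N2"
    using keys' a b c by (intro psi2_cong) (auto intro: rp(1)[THEN subsetD])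
  moreover have "psi2 ?r - inr (bas [(b, 0)]) (psi2 (rp a c)) \<in> N.N2" "psi2 ?l - inl (bas [(a, 0)]) (psi2 (rp b c)) \<in> N.N2"
    by (intro psi2_inner_right psi2_inner_left rp(1) a b c)+
  ultimately have "(psi2 (rp (a \<otimes> b) c) - psi2 (?r + ?l)) + ((psi2 ?r - inr (bas [(b, 0)]) (psi2 (rp a c)))
      + (psi2 ?l - inl (bas [(a, 0)]) (psi2 (rp b c)))) \<in> N.N2"
    by (intro subspace_add[OF N.subspace_N2])
  then show ?thesis
    by (simp add: L.br_simps L.br_mult_left L.br_letters jB_0 a b c klin_add[OF klin_psi2] algebra_simps)
qed

lemma jB_gens:
  assumes "r \<in> jet_gens"
  shows "L.br r (bas [(c, 0)]) \<in> N.N2"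
proof (cases "c \<in> carrier A")
  case c: True
  from assms consider (a) a b where "a \<in> carrier A" "b \<in> carrier A" "r = bas [(a \<oplus> b, 0)] - (bas [(a, 0)] + bas [(b, 0)])"
    | (s) a d where "a \<in> carrier A" "r = bas [(d \<odot> a, 0)] - pm_smult d (bas [(a, 0)])"
    | (m) a b where "a \<in> carrier A" "b \<in> carrier A" "r = bas [(a \<otimes> b, 0)] - bas [(a, 0)] * bas [(b, 0)]"
    | (o) "r = bas [(\<one>, 0)] - 1"
    | (b) x where "x \<notin> carrier A" "r = bas [(x, 0)]"
    unfolding jet_gens_def jet_rels0_def by blast
  then show ?thesis
  proof cases
    case a
    have "psi2 (rp (a \<oplus> b) c) - psi2 (rp a c + rp b c) \<in> N.N2"
    proof (rule psi2_cong)
      show "tcls 2 A (rp (a \<oplus> b) c) = tcls 2 A (rp a c + rp b c)"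
        using a c by (simp add: rp(2) br_lin khom_add[OF khom_tcls])
      show "Poly_Mapping.keys (rp a c + rp b c) \<subseteq> tensor_words 2 A"
        using Poly_Mapping.keys_add[of "rp a c" "rp b c"] rp(1)[OF a(1) c] rp(1)[OF a(2) c] by blast
    qed (use a c in \<open>simp add: rp(1)\<close>)
    then show ?thesis
      using a c by (simp add: L.br_simps L.br_letters jB_0 klin_add[OF klin_psi2])
  next
    case s
    have "psi2 (rp (d \<odot> a) c) - psi2 (pm_smult d (rp a c)) \<in> N.N2"
    proof (rule psi2_cong)
      show "tcls 2 A (rp (d \<odot> a) c) = tcls 2 A (pm_smult d (rp a c))"
        using s c by (simp add: rp(2) br_lin khom_smult[OF khom_tcls])
      show "Poly_Mapping.keys (pm_smult d (rp a c)) \<subseteq> tensor_words 2 A"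
        using keys_pm_smult[of d "rp a c"] rp(1)[OF s(1) c] by blast
    qed (use s c in \<open>simp add: rp(1)\<close>)
    then show ?thesis
      unfolding s(2) using s c
      by (simp add: L.br_simps L.br_letters jB_0 klin_smult[OF klin_psi2] del: pm_smult_single)
  next
    case m
    then show ?thesis using jB_mult c by simp
  next
    case o
    \<comment> \<open>With the letter of the unit congruent to 1, the left Leibniz rule for 1 times
      1 says that the bracket of 1 with \<open>c\<close> equals twice itself, hence vanishes modulo
      \<open>N2\<close>.\<close>
    have "L.br (bas [(\<one> \<otimes> \<one>, 0)] - bas [(\<one>, 0)] * bas [(\<one>, 0)]) (bas [(c, 0)]) \<in> N.N2"
      by (rule jB_mult) (simp_all add: c)
    moreover have "inr (bas [(\<one>, 0)] - 1) p \<in> N.N2" "inl (bas [(\<one>, 0)] - 1) p \<in> N.N2" for p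
      by (intro N.inr_N2' N.inl_N2' jet_kernel_I)+
    ultimately have "- (L.br (bas [(\<one> \<otimes> \<one>, 0)] - bas [(\<one>, 0)] * bas [(\<one>, 0)]) (bas [(c, 0)])
        + (inr (bas [(\<one>, 0)] - 1) (jB (\<one>, 0) (c, 0)) + inl (bas [(\<one>, 0)] - 1) (jB (\<one>, 0) (c, 0)))) \<in> N.N2"
      by (intro subspace_minus[OF N.subspace_N2] subspace_add[OF N.subspace_N2])
    then show ?thesis
      by (simp add: o L.br_simps L.br_letters L.br_mult_left L.br_one_left klin_diff[OF klin_inr'[OF klin_id]]
          klin_diff[OF klin_inl'[OF klin_id]])
  next
    case b
    then show ?thesis by (simp add: L_br_bad_left subspace_zero[OF N.subspace_N2])
  qed
qed (simp add: L_br_bad_right subspace_zero[OF N.subspace_N2])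

lemma poisson_letters_jB: "poisson_letters jB jet_kernel jet_gens"
  by (intro poisson_letters.intro letter_bracket_jB diff_ideal_jet_kernel poisson_letters_axioms.intro)
    (auto intro: jB_skew jB_jac jB_gens jet_gens_kernel[THEN subsetD] jet_kernel_least[THEN subsetD])

end

sublocale double_poisson_algebra \<subseteq> P: poisson_letters jB jet_kernel jet_gens
  by (rule poisson_letters_jB)

section \<open>Coefficients\<close>

lemma klin_if [klin_intros]: "(b \<Longrightarrow> klin f) \<Longrightarrow> klin (\<lambda>p. if b then f p else 0)"
  by (cases b) (auto intro: klin_intros)

text \<open>A coefficient stays in the ring as an element free of \<lambda>, so that the actions and
  the derivation still apply to it; \<open>coef2 0 p = p\<close> expresses that \<open>p\<close> is
  free of \<lambda>.\<close>

definition coef2 :: "nat \<Rightarrow> ('l, 'k::comm_ring_1) free2 \<Rightarrow> ('l, 'k) free2" where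
  "coef2 k = ext2 (\<lambda>f g m. if m = k then t2 f g 0 else 0)"

definition coef3 :: "nat \<Rightarrow> nat \<Rightarrow> ('l, 'k::comm_ring_1) free3 \<Rightarrow> ('l, 'k) free3" where
  "coef3 i j = ext3 (\<lambda>f g h m n. if m = i \<and> n = j then t3 f g h 0 0 else 0)"

lemma klin_coef2 [klin_intros]: "klin f \<Longrightarrow> klin (\<lambda>p. coef2 k (f p))"
  unfolding coef2_def by (intro klin_intros)

lemma klin_coef3 [klin_intros]: "klin f \<Longrightarrow> klin (\<lambda>p. coef3 i j (f p))"
  unfolding coef3_def by (intro klin_intros)

lemma coef2_t2: "coef2 k (t2 f g m) = (if m = k then t2 f g 0 else 0)"
  unfolding coef2_def by (rule ext2_t2) (intro klin_intros)+

lemma coef2_bas: "coef2 k (bas (u, v, m)) = (if m = k then bas (u, v, 0) else 0)"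
  by (simp add: coef2_t2 flip: t2_bas)

lemma coef3_t3: "coef3 i j (t3 f g h m n) = (if m = i \<and> n = j then t3 f g h 0 0 else 0)"
  unfolding coef3_def by (rule ext3_t3) (intro klin_intros)+

lemmas coef2_lin = klin_simps[OF klin_coef2[OF klin_id]]
lemmas coef3_lin = klin_simps[OF klin_coef3[OF klin_id]]

lemma coef2_coef2 [simp]: "coef2 0 (coef2 k p) = coef2 k p"
  by (rule free2_eqI[where F = "\<lambda>p. coef2 0 (coef2 k p)"], (intro klin_intros)+) (simp add: coef2_t2 coef2_lin)

lemma coef2_lam: "coef2 k (lam * p) = (if k = 0 then 0 else coef2 (k - 1) p)"
  by (rule free2_eqI[where F = "\<lambda>p. coef2 k (lam * p)"], (intro klin_intros klin_if)+,
      (cases k; simp add: klin_intros))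
    (auto simp: coef2_t2 t2_arith)

lemma coef2_der2: "coef2 k (der2 p) = der2 (coef2 k p)"
  by (rule free2_eqI[where F = "\<lambda>p. coef2 k (der2 p)"], (intro klin_intros)+)
    (simp add: coef2_t2 der2_t2 coef2_lin klin_zero[OF klin_der2[OF klin_id]])

lemma coef2_e1_mult: "coef2 k (e1 b * p) = e1 b * coef2 k p"
  and coef2_mult_e2: "coef2 k (p * e2 b) = coef2 k p * e2 b"
  by (rule free2_eqI[where F = "\<lambda>p. coef2 k (e1 b * p)"], (intro klin_intros)+, simp add: coef2_t2 t2_arith)
    (rule free2_eqI[where F = "\<lambda>p. coef2 k (p * e2 b)"], (intro klin_intros)+, simp add: coef2_t2 t2_arith)

lemma coef2_bounded: "\<exists>n. \<forall>i>n. coef2 i p = 0" for p :: "('l, 'k::comm_ring_1) free2"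
proof -
  let ?S = "{p :: ('l, 'k) free2. \<exists>n. \<forall>i>n. coef2 i p = 0}"
  have "p \<in> ?S"
  proof (rule free2_memI[where F = "\<lambda>p. p", OF klin_id])
    show "ksubspace ?S"
      unfolding ksubspace_def
    proof (intro conjI ballI allI)
      fix p q :: "('l, 'k) free2" assume "p \<in> ?S" "q \<in> ?S"
      then obtain m n where "\<forall>i>m. coef2 i p = 0" "\<forall>i>n. coef2 i q = 0" by auto
      then show "p + q \<in> ?S"
        by (auto simp: coef2_lin intro!: exI[of _ "max m n"])
    next
      fix c and p :: "('l, 'k) free2" assume "p \<in> ?S"
      then obtain n where "\<forall>i>n. coef2 i p = 0" by auto
      then show "pm_smult c p \<in> ?S"
        by (auto simp: coef2_lin intro!: exI[of _ n])
    qed (auto simp: coef2_lin)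
    show "t2 f g n \<in> ?S" for f g n
      by (auto simp: coef2_t2 intro!: exI[of _ n])
  qed
  then show ?thesis by simp
qed

lemma coef2_expand:
  fixes p :: "('l, 'k::comm_ring_1) free2"
  assumes "finite I" "\<And>n. n \<notin> I \<Longrightarrow> coef2 n p = 0"
  shows "(\<Sum>n\<in>I. lam ^ n * coef2 n p) = p"
proof -
  \<comment> \<open>The bound must be allowed to vary: that the expansion is eventually exact
    defines a subspace containing every \<open>t2 f g n\<close>, whereas for a fixed bound high
    powers of \<lambda> would be lost.\<close>
  have 1: "\<exists>m. \<forall>n\<ge>m. (\<Sum>k<n. lam ^ k * coef2 k p) = p" for p :: "('l, 'k) free2"
  proof -
    let ?S = "{p :: ('l, 'k) free2. \<exists>m. \<forall>n\<ge>m. (\<Sum>k<n. lam ^ k * coef2 k p) = p}"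
    have "p \<in> ?S"
    proof (rule free2_memI[where F = "\<lambda>p. p", OF klin_id])
      show "ksubspace ?S"
        unfolding ksubspace_def
      proof (intro conjI ballI allI)
        fix p q :: "('l, 'k) free2" assume "p \<in> ?S" "q \<in> ?S"
        then obtain m n where "\<forall>i\<ge>m. (\<Sum>k<i. lam ^ k * coef2 k p) = p" "\<forall>i\<ge>n. (\<Sum>k<i. lam ^ k * coef2 k q) = q" by auto
        then show "p + q \<in> ?S"
          by (auto simp: coef2_lin distrib_left sum.distrib intro!: exI[of _ "max m n"])
      next
        fix c and p :: "('l, 'k) free2" assume "p \<in> ?S"
        then obtain m where "\<forall>i\<ge>m. (\<Sum>k<i. lam ^ k * coef2 k p) = p" by auto
        then show "pm_smult c p \<in> ?S"
          by (auto simp: coef2_lin pm_smult_mult_right simp flip: pm.scale_sum_right intro!: exI[of _ m])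
      qed (auto simp: coef2_lin)
      show "t2 f g n \<in> ?S" for f g n
      proof -
        have "(\<Sum>k<i. lam ^ k * coef2 k (t2 f g n)) = t2 f g n" if "i \<ge> Suc n" for i
        proof -
          have "(\<Sum>k<i. lam ^ k * coef2 k (t2 f g n)) = (\<Sum>k<i. if k = n then t2 f g n else 0)"
            by (rule sum.cong) (auto simp: coef2_t2 t2_lam_power)
          then show ?thesis using that by simp
        qed
        then show ?thesis by auto
      qed
    qed
    then show ?thesis by simp
  qed
  then obtain m where m: "\<And>n. n \<ge> m \<Longrightarrow> (\<Sum>k<n. lam ^ k * coef2 k p) = p" by blast
  obtain b where b: "I \<subseteq> {..<b}" using finite_nat_iff_bounded assms(1) by blast
  have "(\<Sum>n\<in>I. lam ^ n * coef2 n p) = (\<Sum>n<max m b. lam ^ n * coef2 n p)"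
    by (rule sum.mono_neutral_left) (use b assms(2) in auto)
  then show ?thesis using m by simp
qed

lemma coef2_lam_power: "coef2 0 p = p \<Longrightarrow> coef2 k (lam ^ m * p) = (if k = m then p else 0)"
proof (induction m arbitrary: k)
  case 0
  have "coef2 k (coef2 0 p) = (if k = 0 then coef2 0 p else 0)"
    by (rule free2_eqI[where F = "\<lambda>p. coef2 k (coef2 0 p)"], (intro klin_intros)+) (simp add: coef2_t2 coef2_lin)
  then show ?case using 0 by simp
next
  case (Suc m)
  then show ?case by (auto simp: mult.assoc coef2_lam)
qed

text \<open>Only powers of \<lambda> trigger the shifts in the inner actions and the adjoint; on
  elements free of \<lambda> these act factorwise and create no \<lambda>.\<close>

lemma coef2_inr: "coef2 0 (inr b (coef2 n p)) = inr b (coef2 n p)"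
  and coef2_inl: "coef2 0 (inl b (coef2 n p)) = inl b (coef2 n p)"
  and coef2_star: "coef2 0 (star (coef2 n p)) = star (coef2 n p)"
  by (rule free2_eqI[where F = "\<lambda>p. coef2 0 (inr b (coef2 n p))"], (intro klin_intros)+,
      simp add: coef2_t2 inr_t2 klin_zero[OF klin_inr[OF klin_id]] coef2_lin)
    (rule free2_eqI[where F = "\<lambda>p. coef2 0 (inl b (coef2 n p))"], (intro klin_intros)+,
      simp add: coef2_t2 inl_t2 klin_zero[OF klin_inl[OF klin_id]] coef2_lin,
     rule free2_eqI[where F = "\<lambda>p. coef2 0 (star (coef2 n p))"], (intro klin_intros)+,
      simp add: coef2_t2 star_e1_e2 klin_zero[OF klin_star[OF klin_id]] coef2_lin)

lemma coef3_lam3: "coef3 i j (lam3 * p) = (if i = 0 then 0 else coef3 (i - 1) j p)"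
  by (rule free3_eqI[where F = "\<lambda>p. coef3 i j (lam3 * p)"], (intro klin_intros klin_if)+,
      (cases i; simp add: klin_intros))
    (auto simp: coef3_t3 t3_arith)

lemma coef3_mu: "coef3 i j (mu * p) = (if j = 0 then 0 else coef3 i (j - 1) p)"
  by (rule free3_eqI[where F = "\<lambda>p. coef3 i j (mu * p)"], (intro klin_intros klin_if)+,
      (cases j; simp add: klin_intros))
    (auto simp: coef3_t3 t3_arith)

lemma coef3_lam3_power: "coef3 i j (lam3 ^ m * p) = (if m \<le> i then coef3 (i - m) j p else 0)"
  by (induction m arbitrary: i) (auto simp: mult.assoc coef3_lam3)

lemma coef3_sum_power:
  "coef3 i j ((lam3 + mu) ^ m * t3 f g h 0 0) = (if i + j = m then pm_smult (of_nat (m choose i)) (t3 f g h 0 0) else 0)"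
proof (induction m arbitrary: i j)
  case 0
  then show ?case by (simp add: coef3_t3)
next
  case (Suc m)
  have "coef3 i j ((lam3 + mu) ^ Suc m * t3 f g h 0 0) =
      (if i = 0 then 0 else coef3 (i - 1) j ((lam3 + mu) ^ m * t3 f g h 0 0))
      + (if j = 0 then 0 else coef3 i (j - 1) ((lam3 + mu) ^ m * t3 f g h 0 0))"
    by (simp add: distrib_right mult.assoc coef3_lin coef3_lam3 coef3_mu)
  then show ?case
    unfolding Suc by (cases i; cases j) (auto simp: pm_smult_add_left binomial_eq_0 simp del: coef3_lam3)
qed

text \<open>Writing an element as \<open>zero_mu p\<close> encodes that it is free of \<mu> in a way
  that is linear in \<open>p\<close>. For such elements the coefficients of the substitution
  \<lambda> + \<mu> are those of \<open>poly_add_vars\<close>.\<close>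

definition zero_mu :: "('l, 'k::comm_ring_1) free3 \<Rightarrow> ('l, 'k) free3" where
  "zero_mu = ext3 (\<lambda>f g h m n. if n = 0 then t3 f g h m 0 else 0)"

lemma klin_zero_mu [klin_intros]: "klin f \<Longrightarrow> klin (\<lambda>p. zero_mu (f p))"
  unfolding zero_mu_def by (intro klin_intros)

lemmas zero_mu_lin = klin_simps[OF klin_zero_mu[OF klin_id]]

lemma zero_mu_t3: "zero_mu (t3 f g h m n) = (if n = 0 then t3 f g h m 0 else 0)"
  unfolding zero_mu_def by (rule ext3_t3) (intro klin_intros)+

lemma coef3_sumvars_zero_mu: "coef3 i j (sumvars (zero_mu p)) = pm_smult (of_nat ((i + j) choose i)) (coef3 (i + j) 0 (zero_mu p))"
  by (rule free3_eqI[where F = "\<lambda>p. coef3 i j (sumvars (zero_mu p))"], (intro klin_intros)+)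
    (auto simp: zero_mu_t3 sumvars_t3 coef3_sum_power coef3_t3 coef3_lin klin_zero[OF klin_sumvars[OF klin_id]])

lemma zero_mu_mult: "zero_mu (i1 f * p) = i1 f * zero_mu p" "zero_mu (i3 f * p) = i3 f * zero_mu p"
  "zero_mu (lam3 * p) = lam3 * zero_mu p"
  by (rule free3_eqI[where F = "\<lambda>p. zero_mu (i1 f * p)"], (intro klin_intros)+, simp add: zero_mu_t3 t3_arith)
    (rule free3_eqI[where F = "\<lambda>p. zero_mu (i3 f * p)"], (intro klin_intros)+, simp add: zero_mu_t3 t3_arith,
     rule free3_eqI[where F = "\<lambda>p. zero_mu (lam3 * p)"], (intro klin_intros)+, simp add: zero_mu_t3 t3_arith)

lemma zero_mu_der3: "zero_mu (der3 p) = der3 (zero_mu p)"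
  by (rule free3_eqI[where F = "\<lambda>p. zero_mu (der3 p)"], (intro klin_intros)+)
    (simp add: zero_mu_t3 der3_t3 zero_mu_lin klin_zero[OF klin_der3[OF klin_id]])

lemma zero_mu_mid1: "zero_mu (mid1 y q) = mid1 y q"
proof (rule free2_eqI[where F = "\<lambda>q. zero_mu (mid1 y q)"], (intro klin_intros)+, rename_tac f g n)
  fix f g n
  have "zero_mu ((dlam3 ^^ n) (i2 y)) = (dlam3 ^^ n) (i2 y)"
    by (induction n) (simp_all add: dlam3_def zero_mu_lin zero_mu_der3 zero_mu_mult, simp add: conv_t3 zero_mu_t3)
  then show "zero_mu (mid1 y (t2 f g n)) = mid1 y (t2 f g n)"
    by (simp add: mid1_t2 mult.assoc zero_mu_mult)
qed

lemma coef3_sumvars_mid1: "coef3 i j (mid y q) = pm_smult (of_nat ((i + j) choose i)) (coef3 (i + j) 0 (mid1 y q))"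
  unfolding mid_def using coef3_sumvars_zero_mu[of i j "mid1 y q"] by (simp add: zero_mu_mid1)

lemma coef3_j12_i3: "coef3 i j (j12 q * i3 g * mu ^ n) = (if n = j then j12 (coef2 i q) * i3 g else 0)"
  by (rule free2_eqI[where F = "\<lambda>q. coef3 i j (j12 q * i3 g * mu ^ n)"], (intro klin_intros klin_if)+)
    (auto simp: j12_t2 t3_arith t3_powers coef3_t3 coef2_t2 mu_power_central klin_zero[OF klin_j12[OF klin_id]])

lemma coef3_i1_j23: "coef3 i j (i1 f * j23 q * lam3 ^ n) = (if n = i then i1 f * j23 (coef2 j q) else 0)"
  by (rule free2_eqI[where F = "\<lambda>q. coef3 i j (i1 f * j23 q * lam3 ^ n)"], (intro klin_intros klin_if)+)
    (auto simp: j23_t2 t3_arith t3_powers coef3_t3 coef2_t2 lam3_power_central klin_zero[OF klin_j23[OF klin_id]])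

context letter_bracket
begin

lemma coef3_brL: "coef3 i j (brL a p) = coef3 i 0 (brL a (coef2 j p))"
  by (rule free2_eqI[where F = "\<lambda>p. coef3 i j (brL a p)"], (intro klin_intros)+)
    (simp add: brL_t2 coef3_j12_i3 coef2_t2 klin_zero[OF klin_brL[OF klin_id]] coef3_lin
      coef3_j12_i3[where n = 0, simplified])

lemma coef3_brR: "coef3 i j (brR a p) = coef3 0 j (brR a (coef2 i p))"
  by (rule free2_eqI[where F = "\<lambda>p. coef3 i j (brR a p)"], (intro klin_intros)+)
    (simp add: brR_t2 coef3_i1_j23 coef2_t2 klin_zero[OF klin_brR[OF klin_id]] coef3_lin
      coef3_i1_j23[where n = 0, simplified])

text \<open>The third Jacobi term before \<lambda> is replaced by \<lambda> + \<mu>, meant for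
  arguments free of \<lambda>. The replacement is made coefficientwise in \<open>coef3_brM\<close>,
  which thereby takes the shape of \<open>jacobi_3\<close>.\<close>

definition brM1 :: "('v letter, 'k) free1 \<Rightarrow> ('v letter, 'k) free2 \<Rightarrow> ('v letter, 'k) free3" where
  "brM1 c = ext2 (\<lambda>x y n. lam3 ^ n * mid1 y (br x c))"

lemma klin_brM1 [klin_intros]: "klin f \<Longrightarrow> klin (\<lambda>p. brM1 c (f p))"
  unfolding brM1_def by (intro klin_intros)

lemma brM1_t2: "brM1 c (t2 x y n) = lam3 ^ n * mid1 y (br x c)"
  unfolding brM1_def by (rule ext2_t2) (intro klin_intros)+

lemma coef3_brM: "coef3 i j (brM p c) =
    (\<Sum>n\<le>i. pm_smult (of_nat ((i - n + j) choose (i - n))) (coef3 (i - n + j) 0 (brM1 c (coef2 n p))))"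
proof (rule free2_eqI[where F = "\<lambda>p. coef3 i j (brM p c)"], (intro klin_intros)+, rename_tac f g m)
  fix f g m
  have "(\<Sum>n\<le>i. pm_smult (of_nat ((i - n + j) choose (i - n))) (coef3 (i - n + j) 0 (brM1 c (coef2 n (t2 f g m))))) =
    (\<Sum>n\<le>i. if n = m then pm_smult (of_nat ((i - n + j) choose (i - n))) (coef3 (i - n + j) 0 (mid1 g (br f c))) else 0)"
    by (rule sum.cong) (auto simp: coef2_t2 brM1_t2 klin_zero[OF klin_brM1[OF klin_id]] coef3_lin)
  then show "coef3 i j (brM (t2 f g m) c) =
    (\<Sum>n\<le>i. pm_smult (of_nat ((i - n + j) choose (i - n))) (coef3 (i - n + j) 0 (brM1 c (coef2 n (t2 f g m)))))"
    by (simp add: brM_t2 coef3_lam3_power coef3_sumvars_mid1)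
qed

end

section \<open>Comparison with the tensor powers of the jet algebra\<close>

text \<open>Needed for \<open>tensor_der\<close> and \<open>tensor_map\<close>, which are given by
  functions of lists rather than of two arguments.\<close>

lemma (in kmodule) tensor_lift_eq_lift2:
  assumes M: "kmod M" and F: "\<And>x y. x \<in> carrier V \<Longrightarrow> y \<in> carrier V \<Longrightarrow> F x y \<in> carrier M"
    and f: "\<And>x y. x \<in> carrier V \<Longrightarrow> y \<in> carrier V \<Longrightarrow> f [x, y] = F x y"
    and p: "Poly_Mapping.keys p \<subseteq> tensor_words 2 V"
  shows "tensor_lift M f (tcls 2 V p) = tensor_lift2 M F (tcls 2 V p)"
proof -
  interpret M: Module.module "ring_of_type_algebra :: 'k ring" M by (rule M)
  have "(\<Oplus>\<^bsub>M\<^esub>xs\<in>Poly_Mapping.keys r. Poly_Mapping.lookup r xs \<odot>\<^bsub>M\<^esub> f xs) =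
      (\<Oplus>\<^bsub>M\<^esub>xs\<in>Poly_Mapping.keys r. Poly_Mapping.lookup r xs \<odot>\<^bsub>M\<^esub> F (xs ! 0) (xs ! 1))" if r: "r \<in> tcls 2 V p" for r
  proof -
    have "tcls 2 V p = (\<lambda>n. n + p) ` tensor_null 2 V"
      unfolding tcls_def by (rule qcls_eq[OF tcls_facts p])
    then obtain n where "n \<in> tensor_null 2 V" "r = n + p" using r by auto
    then have "Poly_Mapping.keys r \<subseteq> tensor_words 2 V"
      using tensor_null_keys p Poly_Mapping.keys_add[of n p] by blast
    then have word: "\<exists>x\<in>carrier V. \<exists>y\<in>carrier V. xs = [x, y]" if "xs \<in> Poly_Mapping.keys r" for xs
      using that tensor_words_2 by blast
    show ?thesis
    proof (rule M.M.finsum_cong'[OF refl])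
      show "(\<lambda>xs. Poly_Mapping.lookup r xs \<odot>\<^bsub>M\<^esub> F (xs ! 0) (xs ! 1)) \<in> Poly_Mapping.keys r \<rightarrow> carrier M"
      proof
        fix xs assume "xs \<in> Poly_Mapping.keys r"
        then obtain x y where "x \<in> carrier V" "y \<in> carrier V" "xs = [x, y]" using word by blast
        then show "Poly_Mapping.lookup r xs \<odot>\<^bsub>M\<^esub> F (xs ! 0) (xs ! 1) \<in> carrier M"
          using F by (intro M.smult_closed) simp_all
      qed
      fix xs assume "xs \<in> Poly_Mapping.keys r"
      then obtain x y where "x \<in> carrier V" "y \<in> carrier V" "xs = [x, y]" using word by blast
      then show "Poly_Mapping.lookup r xs \<odot>\<^bsub>M\<^esub> f xs = Poly_Mapping.lookup r xs \<odot>\<^bsub>M\<^esub> F (xs ! 0) (xs ! 1)"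
        by (simp add: f)
    qed
  qed
  then show ?thesis
    unfolding tensor_lift2_def tensor_lift_def by (auto intro!: arg_cong[of _ _ the_elem] image_cong)
qed

context assoc_algebra
begin

abbreviation "J \<equiv> jet_algebra A"
abbreviation "T2 \<equiv> tensor_power 2 (jet_algebra A)"
abbreviation "T3 \<equiv> tensor_power 3 (jet_algebra A)"
abbreviation "JD \<equiv> jet_der A"

lemma kmodule_jet: "kmodule J"
  by (rule kmodule.intro) (rule kmod_jet)

lemmas kmod_T = kmodule.kmod_tensor_power[OF kmodule_jet]
lemmas khom_T = kmodule.khom_tcls[OF kmodule_jet]

section \<open>Reduction from the free tensor powers to those of J\<close>

lemma jp_closed [simp]: "jp f \<in> carrier J"
  by (rule khom_closed[OF khom_jp])

text \<open>Positive powers of \<lambda> are sent to 0, so that the map is defined on the whole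
  ring; the other coefficients are reached by applying \<open>coef2\<close> first.\<close>

definition ph2 :: "('v letter, 'k) free2 \<Rightarrow> ('k, ('k, 'v) jet) tensor" where
  "ph2 p = tcls 2 J (ext (\<lambda>(u, v, m). if m = 0 then bas [jp (bas u), jp (bas v)] else 0) p)"

definition ph3 :: "('v letter, 'k) free3 \<Rightarrow> ('k, ('k, 'v) jet) tensor" where
  "ph3 p = tcls 3 J (ext (\<lambda>(u, v, w, m, n). if m = 0 \<and> n = 0 then bas [jp (bas u), jp (bas v), jp (bas w)] else 0) p)"

lemma khom_ph2: "khom T2 ph2" and khom_ph3: "khom T3 ph3"
  unfolding ph2_def ph3_def by (rule khom_compose[OF khom_T klin_ext])+

lemmas ph2_zero = khom_zero[OF kmod_T khom_ph2]
lemmas ph3_zero = khom_zero[OF kmod_T khom_ph3]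

lemma khom_pure2: "khom T2 (\<lambda>f. tcls 2 J (bas [jp f, y]))" "khom T2 (\<lambda>f. tcls 2 J (bas [y, jp f]))"
  using kmodule.tcls_lin[OF kmodule_jet jp_closed] khom_closed[OF khom_T]
  by (simp_all add: khom_def khom_add[OF khom_jp] khom_smult[OF khom_jp])

lemma khom_pure3: "khom T3 (\<lambda>f. tcls 3 J (bas [jp f, y, z]))" "khom T3 (\<lambda>f. tcls 3 J (bas [y, jp f, z]))"
  "khom T3 (\<lambda>f. tcls 3 J (bas [y, z, jp f]))"
  using kmodule.tcls_lin[OF kmodule_jet jp_closed] khom_closed[OF khom_T]
  by (simp_all add: khom_def khom_add[OF khom_jp] khom_smult[OF khom_jp])

lemma ph2_t2: "ph2 (t2 f g 0) = pure J [jp f, jp g]"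
proof -
  have "ph2 (t2 (bas u) g 0) = tcls 2 J (bas [jp (bas u), jp g])" for u g
    by (rule khom_eqI[where G = "\<lambda>g. ph2 (t2 (bas u) g 0)" and H = "\<lambda>g. tcls 2 J (bas [jp (bas u), jp g])",
          OF kmod_T[of 2] khom_compose[OF khom_ph2 klin_t2_2[OF klin_id]] khom_pure2(2)])
      (simp add: t2_bas ph2_def)
  then have "ph2 (t2 f g 0) = tcls 2 J (bas [jp f, jp g])"
    by (rule khom_eqI[where G = "\<lambda>f. ph2 (t2 f g 0)" and H = "\<lambda>f. tcls 2 J (bas [jp f, jp g])",
          OF kmod_T[of 2] khom_compose[OF khom_ph2 klin_t2_1[OF klin_id]] khom_pure2(1)])
  then show ?thesis
    by (subst kmodule.pure_eq_tcls[OF kmodule_jet, of _ 2]) (auto simp: kmodule.tensor_words_2[OF kmodule_jet])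
qed

lemma ph3_t3: "ph3 (t3 f g h 0 0) = pure J [jp f, jp g, jp h]"
proof -
  have "ph3 (t3 (bas u) (bas v) h 0 0) = tcls 3 J (bas [jp (bas u), jp (bas v), jp h])" for u v h
    by (rule khom_eqI[where G = "\<lambda>x. ph3 (t3 (bas u) (bas v) x 0 0)" and H = "\<lambda>x. tcls 3 J (bas [jp (bas u), jp (bas v), jp x])",
          OF kmod_T[of 3] khom_compose[OF khom_ph3 klin_t3(3)[OF klin_id]] khom_pure3(3)])
      (simp add: t3_bas ph3_def)
  then have "ph3 (t3 (bas u) g h 0 0) = tcls 3 J (bas [jp (bas u), jp g, jp h])" for u g h
    by (rule khom_eqI[where G = "\<lambda>x. ph3 (t3 (bas u) x h 0 0)" and H = "\<lambda>x. tcls 3 J (bas [jp (bas u), jp x, jp h])",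
          OF kmod_T[of 3] khom_compose[OF khom_ph3 klin_t3(2)[OF klin_id]] khom_pure3(2)])
  then have "ph3 (t3 f g h 0 0) = tcls 3 J (bas [jp f, jp g, jp h])"
    by (rule khom_eqI[where G = "\<lambda>x. ph3 (t3 x g h 0 0)" and H = "\<lambda>x. tcls 3 J (bas [jp x, jp g, jp h])",
          OF kmod_T[of 3] khom_compose[OF khom_ph3 klin_t3(1)[OF klin_id]] khom_pure3(1)])
  then show ?thesis
    by (subst kmodule.pure_eq_tcls[OF kmodule_jet, of _ 3]) (auto simp: kmodule.tensor_words_3[OF kmodule_jet])
qed

definition rj :: "('k, 'v) jet \<Rightarrow> ('v letter, 'k) free1" where
  "rj x = (SOME f. jp f = x)"

lemma jp_rj: "x \<in> carrier J \<Longrightarrow> jp (rj x) = x"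
  unfolding rj_def jet_carrier by (rule someI_ex) auto

text \<open>The bilinearity of \<open>F\<close> need not be assumed: it is inherited from the free level.\<close>

lemma tensor_lift2_ph2:
  assumes M: "kmod M" and G: "khom M G" and h: "klin h"
    and F: "\<And>f g. F (jp f) (jp g) = G (h (t2 f g 0))"
  shows "tensor_lift2 M F (ph2 p) = G (h (coef2 0 p))"
proof -
  have Gh: "khom M (\<lambda>p. G (h p))" by (rule khom_compose[OF G h])
  have bil: "bilinear_on J M F"
    unfolding bilinear_on_def jet_carrier
    by (auto simp: F khom_closed[OF G] t2_lin(1,2,6,7) khom_add[OF Gh] khom_smult[OF Gh]
        simp flip: khom_add[OF khom_jp] khom_smult[OF khom_jp])
  let ?e = "\<lambda>(u, v, m). if m = 0 then bas [jp (bas u), jp (bas v)] else 0"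
  have keys: "Poly_Mapping.keys (ext ?e p) \<subseteq> tensor_words 2 J"
    by (rule keys_ext_subset) (auto simp: kmodule.tensor_words_2[OF kmodule_jet] split: if_splits)
  define q where "q = (\<lambda>x y. h (t2 (rj x) (rj y) 0))"
  have q: "G (q x y) = F x y" if "x \<in> carrier J" "y \<in> carrier J" for x y
    using F[of "rj x" "rj y"] that by (simp add: q_def jp_rj)
  have "tensor_lift2 M F (ph2 p) = G (ext (\<lambda>xs. q (xs ! 0) (xs ! 1)) (ext ?e p))"
    unfolding ph2_def by (rule kmodule.tensor_lift2_tcls[OF kmodule_jet M G bil q keys])
  also have "\<dots> = G (h (coef2 0 p))"
  proof (rule khom_eqI[OF M, of "\<lambda>p. G (ext (\<lambda>xs. q (xs ! 0) (xs ! 1)) (ext ?e p))" "\<lambda>p. G (h (coef2 0 p))"])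
    fix x :: "'v letter list \<times> 'v letter list \<times> nat"
    obtain u v m where x: "x = (u, v, m)" by (cases x rule: prod_cases3)
    have "coef2 0 (bas x) = (if m = 0 then t2 (bas u) (bas v) 0 else 0 :: ('v letter, 'k) free2)"
      by (simp add: x coef2_bas t2_bas)
    then show "G (ext (\<lambda>xs. q (xs ! 0) (xs ! 1)) (ext ?e (bas x))) = G (h (coef2 0 (bas x)))"
      by (simp add: x q F klin_zero[OF klin_ext] klin_zero[OF h])
  qed (intro khom_compose[OF G] klin_intros klin_compose[OF h])+
  finally show ?thesis .
qed

end

lemma finsum_two:
  assumes "kmod M" "f 0 \<in> carrier M" "f 1 \<in> carrier M"
  shows "(\<Oplus>\<^bsub>M\<^esub>i\<in>{..<2::nat}. f i) = f 0 \<oplus>\<^bsub>M\<^esub> f 1"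
proof -
  interpret M: Module.module ring_of_type_algebra M by fact
  have "{..<2::nat} = Set.insert 0 (Set.insert 1 {})" by auto
  then show ?thesis using assms(2,3) by simp
qed

lemma khom_equaliser:
  assumes "kmod M" "khom M G" "khom M H"
  shows "ksubspace {p. G p = H p}"
  unfolding ksubspace_def
  using khom_zero[OF assms(1,2)] khom_zero[OF assms(1,3)]
  by (auto simp: khom_add[OF assms(2)] khom_add[OF assms(3)] khom_smult[OF assms(2)] khom_smult[OF assms(3)])

text \<open>The binomial expansion of \<open>(\<lambda> + \<partial>)\<^sup>n\<close>, with \<open>\<partial>\<close> acting on the second argument of \<open>S\<close>.\<close>

lemma shift_binomial:
  fixes S :: "('v letter, 'k::field_char_0) free2 \<Rightarrow> ('v letter, 'k) free1 \<Rightarrow> ('y::monoid_add \<Rightarrow>\<^sub>0 'k)"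
  assumes rec: "\<And>p c. S (lam * p) c = l * S p c + S p (free_jet_der c)"
  shows "S (lam ^ n * p) c = (\<Sum>k\<le>n. of_nat (n choose k) * (l ^ (n - k) * S p ((free_jet_der ^^ k) c)))"
proof (induction n arbitrary: p)
  case (Suc n)
  let ?s = "\<lambda>k. S p ((free_jet_der ^^ k) c)"
  have comm: "x * (of_nat k * y) = of_nat k * (x * y)" for k and x y :: "'y \<Rightarrow>\<^sub>0 'k"
    by (simp add: of_nat_mult_conv_smult pm_smult_mult_right)
  have "S (lam ^ Suc n * p) c = S (lam ^ n * (lam * p)) c"
    by (simp add: mult.assoc power_commutes lam_left)
  also have "\<dots> = (\<Sum>k\<le>n. of_nat (n choose k) * (l ^ (Suc n - k) * ?s k)) + (\<Sum>k\<le>n. of_nat (n choose k) * (l ^ (n - k) * ?s (Suc k)))"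
    unfolding Suc by (simp add: rec distrib_left sum.distrib Suc_diff_le power_Suc2 mult.assoc del: power_Suc)
  also have "(\<Sum>k\<le>n. of_nat (n choose k) * (l ^ (Suc n - k) * ?s k)) =
      (\<Sum>k\<le>Suc n. of_nat (n choose k) * (l ^ (Suc n - k) * ?s k))"
    by (simp add: binomial_eq_0)
  also have "\<dots> = l ^ Suc n * ?s 0 + (\<Sum>k\<le>n. of_nat (n choose Suc k) * (l ^ (n - k) * ?s (Suc k)))"
    unfolding sum.atMost_Suc_shift by simp
  also have "\<dots> + (\<Sum>k\<le>n. of_nat (n choose k) * (l ^ (n - k) * ?s (Suc k))) =
      (\<Sum>k\<le>Suc n. of_nat (Suc n choose k) * (l ^ (Suc n - k) * ?s k))"
    unfolding sum.atMost_Suc_shift by (simp add: distrib_right sum.distrib algebra_simps del: funpow.simps)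
  finally show ?case .
qed simp

context assoc_algebra
begin

section \<open>From polynomials over the free tensor powers to the operations of the axioms\<close>

definition Phi2 :: "('v letter, 'k) free2 \<Rightarrow> nat \<Rightarrow> ('k, ('k, 'v) jet) tensor" where
  "Phi2 p n = ph2 (coef2 n p)"

text \<open>Only the part free of \<mu> is read, since \<open>lambda_bracket_fst_L\<close> has
  values in polynomials in one variable.\<close>

definition Phi31 :: "('v letter, 'k) free3 \<Rightarrow> nat \<Rightarrow> ('k, ('k, 'v) jet) tensor" where
  "Phi31 p n = ph3 (coef3 n 0 p)"

lemmas kmod_P = kmod_poly_module[OF kmod_T]

lemma khom_Phi2: "khom (square_poly J) Phi2"
proof -
  have "Phi2 p \<in> up T2" for p
    using coef2_bounded[of p] khom_closed[OF khom_ph2] unfolding up_iff Phi2_def by (metis ph2_zero)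
  then show ?thesis
    by (simp add: khom_def poly_module_simps)
      (simp add: Phi2_def[abs_def] coef2_lin khom_add[OF khom_ph2] khom_smult[OF khom_ph2])
qed

lemma coef3_bounded: "\<exists>n. \<forall>i>n. coef3 i j p = 0" for p :: "('l, 'a::comm_ring_1) free3"
proof -
  let ?S = "{p :: ('l, 'a) free3. \<exists>n. \<forall>i>n. coef3 i j p = 0}"
  have "p \<in> ?S"
  proof (rule free3_memI[where F = "\<lambda>p. p", OF klin_id])
    show "ksubspace ?S"
      unfolding ksubspace_def
    proof (intro conjI ballI allI)
      fix p q :: "('l, 'a) free3" assume "p \<in> ?S" "q \<in> ?S"
      then obtain m n where "\<forall>i>m. coef3 i j p = 0" "\<forall>i>n. coef3 i j q = 0" by auto
      then show "p + q \<in> ?S"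
        by (auto simp: coef3_lin intro!: exI[of _ "max m n"])
    next
      fix c and p :: "('l, 'a) free3" assume "p \<in> ?S"
      then obtain n where "\<forall>i>n. coef3 i j p = 0" by auto
      then show "pm_smult c p \<in> ?S"
        by (auto simp: coef3_lin intro!: exI[of _ n])
    qed (auto simp: coef3_lin)
    show "t3 f g h m n \<in> ?S" for f g h m n
      by (auto simp: coef3_t3 intro!: exI[of _ m])
  qed
  then show ?thesis by simp
qed

lemma khom_Phi31: "khom (poly_module T3) Phi31"
proof -
  have "Phi31 p \<in> up T3" for p
    using coef3_bounded[of 0 p] khom_closed[OF khom_ph3] unfolding up_iff Phi31_def by (metis ph3_zero)
  then show ?thesis
    by (simp add: khom_def poly_module_simps)
      (simp add: Phi31_def[abs_def] coef3_lin khom_add[OF khom_ph3] khom_smult[OF khom_ph3])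
qed

lemma jp_kernel: "f \<in> jet_kernel \<Longrightarrow> jp f = jp 0"
  by (simp add: jp_eq_iff)

lemma Phi2_N2: "p \<in> N.N2 \<Longrightarrow> Phi2 p = \<zero>\<^bsub>square_poly J\<^esub>"
proof
  fix n assume "p \<in> N.N2"
  then have "coef2 n p \<in> {q. ph2 q = \<zero>\<^bsub>T2\<^esub>}"
  proof (rule N.N2_map[OF _ klin_coef2[OF klin_id] khom_kernel_subspace[OF kmod_T khom_ph2]])
    fix f g m assume "f \<in> jet_kernel \<or> g \<in> jet_kernel"
    then have "ph2 (t2 f g 0) = ph2 (t2 0 g 0) \<or> ph2 (t2 f g 0) = ph2 (t2 f 0 0)"
      unfolding ph2_t2 using jp_kernel by auto
    then show "coef2 n (t2 f g m) \<in> {q. ph2 q = \<zero>\<^bsub>T2\<^esub>}"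
      by (auto simp: coef2_t2 t2_lin ph2_zero)
  qed
  then show "Phi2 p n = \<zero>\<^bsub>square_poly J\<^esub> n"
    by (simp add: Phi2_def poly_module_simps)
qed

lemma ph3_N3: "p \<in> N.N3 \<Longrightarrow> ph3 (coef3 i j p) = \<zero>\<^bsub>T3\<^esub>"
proof -
  assume "p \<in> N.N3"
  then have "coef3 i j p \<in> {q. ph3 q = \<zero>\<^bsub>T3\<^esub>}"
  proof (rule N.N3_map[OF _ klin_coef3[OF klin_id] khom_kernel_subspace[OF kmod_T khom_ph3]])
    fix f g h m n assume "f \<in> jet_kernel \<or> g \<in> jet_kernel \<or> h \<in> jet_kernel"
    then have "ph3 (t3 f g h 0 0) = ph3 (t3 0 g h 0 0) \<or> ph3 (t3 f g h 0 0) = ph3 (t3 f 0 h 0 0)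
        \<or> ph3 (t3 f g h 0 0) = ph3 (t3 f g 0 0 0)"
      unfolding ph3_t3 using jp_kernel by auto
    then show "coef3 i j (t3 f g h m n) \<in> {q. ph3 q = \<zero>\<^bsub>T3\<^esub>}"
      by (auto simp: coef3_t3 t3_zero ph3_zero)
  qed
  then show ?thesis by simp
qed

lemma flip_ph2: "flip J (ph2 p) = ph2 (star (coef2 0 p))"
  unfolding flip_def
  by (rule tensor_lift2_ph2[OF kmod_T khom_ph2 klin_star[OF klin_id]]) (simp add: star_e1_e2 ph2_t2)

lemma outer_left_ph2: "outer_left J (jp b) (ph2 p) = ph2 (e1 b * coef2 0 p)"
  unfolding outer_left_def
  by (rule tensor_lift2_ph2[OF kmod_T khom_ph2 klin_mult_left[OF klin_id]]) (simp add: t2_arith ph2_t2 jp_mult)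

lemma outer_right_ph2: "outer_right J (ph2 p) (jp b) = ph2 (coef2 0 p * e2 b)"
  unfolding outer_right_def
  by (rule tensor_lift2_ph2[OF kmod_T khom_ph2 klin_mult_right[OF klin_id]]) (simp add: t2_arith ph2_t2 jp_mult)

lemma inner_left_ph2: "inner_left J (jp b) (ph2 p) = ph2 (inl b (coef2 0 p))"
  unfolding inner_left_def
  by (rule tensor_lift2_ph2[OF kmod_T khom_ph2 klin_inl[OF klin_id]]) (simp add: inl_t2 ph2_t2 jp_mult)

lemma inner_right_ph2: "inner_right J (ph2 p) (jp b) = ph2 (inr b (coef2 0 p))"
  unfolding inner_right_def
  by (rule tensor_lift2_ph2[OF kmod_T khom_ph2 klin_inr[OF klin_id]]) (simp add: inr_t2 ph2_t2 jp_mult)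

lemma tensor_snoc_ph2: "tensor_snoc J (ph2 p) (jp c) = ph3 (j12 (coef2 0 p) * i3 c)"
  unfolding tensor_snoc_def
  by (rule tensor_lift2_ph2[OF kmod_T khom_ph3 klin_mult_right[OF klin_j12[OF klin_id]]]) (simp add: j12_t2 t3_arith ph3_t3)

lemma tensor_cons_ph2: "tensor_cons J (jp c) (ph2 p) = ph3 (i1 c * j23 (coef2 0 p))"
  unfolding tensor_cons_def
  by (rule tensor_lift2_ph2[OF kmod_T khom_ph3 klin_mult_left[OF klin_j23[OF klin_id]]]) (simp add: j23_t2 t3_arith ph3_t3)

lemma tensor_mid_ph2: "tensor_mid J (ph2 p) (jp c) = ph3 (mid c (coef2 0 p))"
  unfolding tensor_mid_def
  by (rule tensor_lift2_ph2[OF kmod_T khom_ph3 klin_mid[OF klin_id]]) (simp add: mid_t2 ph3_t3)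

lemma tensor_lift_ph2:
  assumes M: "kmod M" and F: "\<And>x y. x \<in> carrier J \<Longrightarrow> y \<in> carrier J \<Longrightarrow> F x y \<in> carrier M"
    and f: "\<And>x y. x \<in> carrier J \<Longrightarrow> y \<in> carrier J \<Longrightarrow> f [x, y] = F x y"
  shows "tensor_lift M f (ph2 p) = tensor_lift2 M F (ph2 p)"
  unfolding ph2_def
proof (rule kmodule.tensor_lift_eq_lift2[OF kmodule_jet M, where F = F and f = f])
  show "Poly_Mapping.keys (ext (\<lambda>(u, v, m). if m = 0 then bas [jp (bas u), jp (bas v)] else 0) p) \<subseteq> tensor_words 2 J"
    by (rule keys_ext_subset) (auto simp: kmodule.tensor_words_2[OF kmodule_jet] split: if_splits)
qed (use F f in auto)

lemma tensor_der_ph2: "tensor_der 2 J JD (ph2 p) = ph2 (der2 (coef2 0 p))"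
proof -
  let ?F = "\<lambda>x y. pure J [JD x, y] \<oplus>\<^bsub>T2\<^esub> pure J [x, JD y]"
  have F: "?F (jp f) (jp g) = ph2 (der2 (t2 f g 0))" for f g
    by (simp add: der2_t2 khom_add[OF khom_ph2] ph2_t2 jp_der)
  have "tensor_der 2 J JD (ph2 p) = tensor_lift2 T2 ?F (ph2 p)"
    unfolding tensor_der_def
  proof (rule tensor_lift_ph2[OF kmod_T])
    fix x y assume "x \<in> carrier J" "y \<in> carrier J"
    then obtain f g where xy: "x = jp f" "y = jp g" by (auto simp: jet_carrier)
    show "?F x y \<in> carrier T2"
      unfolding xy F by (rule khom_closed[OF khom_ph2])
    have "pure J [jp h, jp k] \<in> carrier T2" for h k
      unfolding ph2_t2[symmetric] by (rule khom_closed[OF khom_ph2])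
    then show "(\<Oplus>\<^bsub>T2\<^esub>i\<in>{..<2}. pure J ([x, y][i := JD ([x, y] ! i)])) = ?F x y"
      unfolding xy by (subst finsum_two[OF kmod_T]) (simp_all add: jp_der)
  qed
  also have "\<dots> = ph2 (der2 (coef2 0 p))"
    by (rule tensor_lift2_ph2[OF kmod_T khom_ph2 klin_der2[OF klin_id] F])
  finally show ?thesis .
qed

text \<open>The embedding of \<open>A\<close> is linear by the degree 0 relations in
  \<open>J\<close>, so the lift may be evaluated on any representative; letter by letter it is then
  \<open>psi2\<close> followed by \<open>ph2\<close>.\<close>

lemma jet_embed_square_tcls:
  assumes "Poly_Mapping.keys p \<subseteq> tensor_words 2 A"
  shows "jet_embed_square A (tcls 2 A p) = ph2 (psi2 p)"
proof -
  let ?F = "\<lambda>x y. pure J [jet_embed A x, jet_embed A y]"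
  have F: "ph2 (t2 (bas [(x, 0)]) (bas [(y, 0)]) 0) = ?F x y" if "x \<in> carrier A" "y \<in> carrier A" for x y
    using that by (simp add: ph2_t2 jp_embed)
  have add: "jp (bas [(x \<oplus> y, 0)]) = jp (bas [(x, 0)] + bas [(y, 0)])" if "x \<in> carrier A" "y \<in> carrier A" for x y
    unfolding jp_eq_iff using jet_kernel_I(1)[OF that] by (simp add: diff_diff_eq)
  have smult: "jp (bas [(c \<odot> x, 0)]) = jp (pm_smult c (bas [(x, 0)]))" if "x \<in> carrier A" for c x
    unfolding jp_eq_iff using jet_kernel_I(2)[OF that] by simp
  have bil: "bilinear_on A T2 ?F"
  proof (rule bilinear_on_cong[OF _ kmod_V])
    show "bilinear_on A T2 (\<lambda>x y. pure J [jp (bas [(x, 0)]), jp (bas [(y, 0)])])"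
      unfolding bilinear_on_def using khom_closed[OF khom_ph2]
      by (auto simp: add smult khom_add[OF khom_ph2] khom_smult[OF khom_ph2] t2_lin(1,2,6,7)
          simp del: pm_smult_single simp flip: ph2_t2)
  qed (simp add: jp_embed)
  have "jet_embed_square A (tcls 2 A p) = tensor_lift2 T2 ?F (tcls 2 A p)"
    unfolding jet_embed_square_def tensor_map_def
    by (rule tensor_lift_eq_lift2[OF kmod_T _ _ assms]) (use bil in \<open>auto simp: bilinear_on_def\<close>)
  also have "\<dots> = ph2 (ext (\<lambda>xs. t2 (bas [(xs ! 0, 0)]) (bas [(xs ! 1, 0)]) 0) p)"
    by (rule tensor_lift2_tcls[OF kmod_T khom_ph2 bil F assms])
  finally show ?thesis by (simp add: psi2_def)
qed

lemma Phi2_lam: "Phi2 (lam * p) = poly_var_mult T2 (Phi2 p)"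
  by (rule HOL.ext) (simp add: Phi2_def poly_var_mult_def coef2_lam ph2_zero)

lemma der_plus_var_Phi2: "der_plus_var J JD (Phi2 p) = Phi2 (dlam p)"
proof -
  have "(\<lambda>n. tensor_der 2 J JD (Phi2 p n)) = Phi2 (der2 p)"
    by (rule HOL.ext) (simp add: Phi2_def tensor_der_ph2 coef2_der2)
  then show ?thesis
    unfolding der_plus_var_def dlam_def khom_add[OF khom_Phi2] Phi2_lam by simp
qed

lemma poly_monom_ph2: "coef2 0 p = p \<Longrightarrow> poly_monom T2 m (ph2 p) = Phi2 (lam ^ m * p)"
  by (rule HOL.ext) (simp add: poly_monom_def Phi2_def coef2_lam_power ph2_zero)

text \<open>\<open>poly_sum\<close> runs over coefficients whose class is nonzero, possibly fewer
  than those with nonzero representative. The extra terms on the right are killed by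
  \<open>G\<close>, as \<open>g n\<close> depends only on the class.\<close>

lemma poly_sum_Phi2:
  assumes W: "kmod W" and G: "khom W G" and h: "\<And>n. klin (h n)"
    and g: "\<And>n q. g n (ph2 q) = G (h n (coef2 0 q))"
    and I: "finite I" "\<And>n. n \<notin> I \<Longrightarrow> coef2 n p = 0"
  shows "poly_sum T2 W (Phi2 p) g = G (\<Sum>n\<in>I. h n (coef2 n p))"
proof -
  let ?T = "{n. Phi2 p n \<noteq> \<zero>\<^bsub>T2\<^esub>}"
  have T: "?T \<subseteq> I"
    using I(2) by (auto simp: Phi2_def ph2_zero)
  have zero: "G (h n (coef2 n p)) = \<zero>\<^bsub>W\<^esub>" if "n \<notin> ?T" for n
  proof -
    have "G (h n (coef2 n p)) = g n (Phi2 p n)" by (simp add: g Phi2_def)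
    also have "\<dots> = g n (ph2 0)" using that by (simp add: ph2_zero)
    finally show ?thesis by (simp add: g coef2_lin klin_zero[OF h] khom_zero[OF W G])
  qed
  have "(\<Sum>n\<in>I - ?T. h n (coef2 n p)) \<in> {q. G q = \<zero>\<^bsub>W\<^esub>}"
    by (rule subspace_sum[OF khom_kernel_subspace[OF W G]]) (use zero in blast)
  moreover have "(\<Sum>n\<in>I. h n (coef2 n p)) = (\<Sum>n\<in>I - ?T. h n (coef2 n p)) + (\<Sum>n\<in>?T. h n (coef2 n p))"
    by (rule sum.subset_diff[OF T I(1)])
  ultimately have "G (\<Sum>n\<in>I. h n (coef2 n p)) = G (\<Sum>n\<in>?T. h n (coef2 n p))"
    by (subst khom_eq_iff[OF W G]) simp
  then show ?thesis
    unfolding poly_sum_def khom_sum[OF W G] by (simp add: g Phi2_def)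
qed

lemma JD_pow: "(JD ^^ k) (jp c) = jp ((free_jet_der ^^ k) c)"
  by (induction k) (simp_all add: jp_der)

text \<open>The one-step recursion for \<lambda> already determines the whole binomial expansion, so
  this covers both inner actions and the middle insertion.\<close>

lemma shifted_sum_Phi2:
  fixes S :: "('v letter, 'k) free2 \<Rightarrow> ('v letter, 'k) free1 \<Rightarrow> ('y::monoid_add \<Rightarrow>\<^sub>0 'k)"
  assumes W: "kmod W" and G: "khom (poly_module W) G" and S: "\<And>c. klin (\<lambda>p. S p c)"
    and rec: "\<And>p c. S (lam * p) c = l * S p c + S p (free_jet_der c)"
    and h: "\<And>q c m. poly_monom W m (h (ph2 q) (jp c)) = G (l ^ m * S (coef2 0 q) c)"
  shows "shifted_sum T2 W JD (Phi2 p) h (jp c) = G (S p c)"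
proof -
  obtain b where b: "\<And>n. n > b \<Longrightarrow> coef2 n p = 0" using coef2_bounded[of p] by auto
  let ?h = "\<lambda>n q. \<Sum>k\<le>n. of_nat (n choose k) * (l ^ (n - k) * S q ((free_jet_der ^^ k) c))"
  have "shifted_sum T2 W JD (Phi2 p) h (jp c) = G (\<Sum>n\<le>b. ?h n (coef2 n p))"
    unfolding shifted_sum_def
  proof (rule poly_sum_Phi2[OF kmod_poly_module[OF W] G])
    show "klin (?h n)" for n
      by (intro klin_intros S)
    show "(\<Oplus>\<^bsub>poly_module W\<^esub>k\<in>{..n}. of_nat (n choose k) \<odot>\<^bsub>poly_module W\<^esub> poly_monom W (n - k) (h (ph2 q) ((JD ^^ k) (jp c))))
        = G (?h n (coef2 0 q))" for n q
      unfolding JD_pow h khom_sum[OF kmod_poly_module[OF W] G] of_nat_mult_conv_smult khom_smult[OF G] ..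
  qed (use b in auto)
  also have "(\<Sum>n\<le>b. ?h n (coef2 n p)) = (\<Sum>n\<le>b. S (lam ^ n * coef2 n p) c)"
    by (simp add: shift_binomial[where S = S, OF rec])
  also have "\<dots> = S (\<Sum>n\<le>b. lam ^ n * coef2 n p) c"
    by (simp add: klin_sum[OF S])
  also have "(\<Sum>n\<le>b. lam ^ n * coef2 n p) = p"
    by (rule coef2_expand) (use b in auto)
  finally show ?thesis .
qed

lemma shifted_sum_inner_right: "shifted_sum T2 T2 JD (Phi2 p) (inner_right J) (jp b) = Phi2 (inr b p)"
  by (rule shifted_sum_Phi2[OF kmod_T khom_Phi2, where S = "\<lambda>p b. inr b p" and l = lam])
    (simp_all add: klin_intros inr_lam inner_right_ph2 poly_monom_ph2 coef2_inr)

lemma shifted_sum_inner_left: "shifted_sum T2 T2 JD (Phi2 p) (\<lambda>q x. inner_left J x q) (jp b) = Phi2 (inl b p)"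
  by (rule shifted_sum_Phi2[OF kmod_T khom_Phi2, where S = "\<lambda>p b. inl b p" and l = lam])
    (simp_all add: klin_intros inl_lam inner_left_ph2 poly_monom_ph2 coef2_inl)

lemma shifted_sum_mid: "shifted_sum T2 T3 JD (Phi2 p) (tensor_mid J) (jp c) = Phi31 (mid1 c p)"
proof (rule shifted_sum_Phi2[OF kmod_T khom_Phi31, where S = "\<lambda>p c. mid1 c p" and l = lam3])
  fix q :: "('v letter, 'k) free2" and c :: "('v letter, 'k) free1" and m
  \<comment> \<open>On elements free of \<lambda> there is neither a shift by \<partial> nor
    anything to substitute, so \<open>mid\<close> and \<open>mid1\<close> agree and the result has
    degree 0.\<close>
  have 1: "mid c (coef2 0 q) = mid1 c (coef2 0 q)" and 2: "coef3 i 0 (mid1 c (coef2 0 q)) = (if i = 0 then mid1 c (coef2 0 q) else 0)" for i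
    by (rule free2_eqI[where F = "\<lambda>q. mid c (coef2 0 q)"], (intro klin_intros)+,
        simp add: coef2_t2 mid_t2 mid1_t2 conv_t3 t3_mult klin_zero[OF klin_mid[OF klin_id]] klin_zero[OF klin_mid1[OF klin_id]])
      (rule free2_eqI[where F = "\<lambda>q. coef3 i 0 (mid1 c (coef2 0 q))"], (intro klin_intros)+,
        auto simp: coef2_t2 mid1_t2 conv_t3 t3_mult coef3_t3 klin_zero[OF klin_mid1[OF klin_id]] coef3_lin)
  show "poly_monom T3 m (tensor_mid J (ph2 q) (jp c)) = Phi31 (lam3 ^ m * mid1 c (coef2 0 q))"
    by (rule HOL.ext) (auto simp: tensor_mid_ph2 poly_monom_def Phi31_def 1 2 coef3_lam3_power ph3_zero)
qed (simp_all add: klin_intros mid1_lam)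

text \<open>On each coefficient the adjoint is the flip, and a power of \<lambda> in front turns
  into a power of -\<lambda>-\<partial>; summing up, the right side of the skew-symmetry axiom is
  the adjoint.\<close>

lemma poly_sum_skew:
  "poly_sum T2 (square_poly J) (Phi2 p) (\<lambda>n r. ((\<lambda>p. \<ominus>\<^bsub>square_poly J\<^esub> der_plus_var J JD p) ^^ n) (poly_monom T2 0 (flip J r)))
    = Phi2 (star p)"
proof -
  obtain b where b: "\<And>n. n > b \<Longrightarrow> coef2 n p = 0" using coef2_bounded[of p] by auto
  have pow: "((\<lambda>p. \<ominus>\<^bsub>square_poly J\<^esub> der_plus_var J JD p) ^^ n) (Phi2 q) = Phi2 ((ndlam ^^ n) q)" for n q
    by (induction n) (simp_all add: der_plus_var_Phi2 khom_minus[OF kmod_P khom_Phi2])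
  have "poly_sum T2 (square_poly J) (Phi2 p) (\<lambda>n r. ((\<lambda>p. \<ominus>\<^bsub>square_poly J\<^esub> der_plus_var J JD p) ^^ n) (poly_monom T2 0 (flip J r)))
      = Phi2 (\<Sum>n\<le>b. (ndlam ^^ n) (star (coef2 n p)))"
  proof (rule poly_sum_Phi2[OF kmod_P khom_Phi2])
    show "klin (\<lambda>q. (ndlam ^^ n) (star q))" for n
      by (intro klin_intros klin_dlam')
  qed (use b in \<open>auto simp: flip_ph2 poly_monom_ph2 coef2_star pow\<close>)
  also have "(\<Sum>n\<le>b. (ndlam ^^ n) (star (coef2 n p))) = star (\<Sum>n\<le>b. lam ^ n * coef2 n p)"
  proof -
    have "star (lam ^ n * q) = (ndlam ^^ n) (star q)" for n and q :: "('v letter, 'k) free2"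
      by (induction n) (simp_all add: mult.assoc star_lam)
    then show ?thesis by (simp add: klin_sum[OF klin_star[OF klin_id]])
  qed
  also have "(\<Sum>n\<le>b. lam ^ n * coef2 n p) = p"
    by (rule coef2_expand) (use b in auto)
  finally show ?thesis .
qed

end

section \<open>The double Poisson vertex algebra structure\<close>

context double_poisson_algebra
begin

definition lbr :: "('k, ('k, 'v) jet) lambda_bracket" where
  "lbr x y = Phi2 (P.br (rj x) (rj y))"

text \<open>Replacing one argument at a time by another representative changes the bracket by an
  element of \<open>N2\<close>, which \<open>Phi2\<close> sends to zero.\<close>

lemma lbr_jp: "lbr (jp f) (jp g) = Phi2 (P.br f g)"
proof -
  have f: "rj (jp f) - f \<in> jet_kernel" for f
    using jp_rj[of "jp f"] by (simp add: jp_eq_iff)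
  have "P.br (rj (jp f) - f) (rj (jp g)) + P.br f (rj (jp g) - g) \<in> N.N2"
    by (intro subspace_add[OF N.subspace_N2] P.br_N2_left P.br_N2_right f)
  then have "Phi2 (P.br (rj (jp f)) (rj (jp g)) - P.br f g) = \<zero>\<^bsub>square_poly J\<^esub>"
    by (intro Phi2_N2) (simp add: P.br_simps)
  then show ?thesis
    unfolding lbr_def by (simp add: khom_eq_iff[OF kmod_P khom_Phi2])
qed

lemma lbr_bilinear: "bilinear_on J (square_poly J) lbr"
  unfolding bilinear_on_def jet_carrier
  by (auto simp: lbr_jp P.br_simps khom_closed[OF khom_Phi2] khom_add[OF khom_Phi2] khom_smult[OF khom_Phi2]
      simp flip: khom_add[OF khom_jp] khom_smult[OF khom_jp])

lemma outer_right_Phi2: "(\<lambda>n. outer_right J (Phi2 p n) (jp c)) = Phi2 (p * e2 c)"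
  and outer_left_Phi2: "(\<lambda>n. outer_left J (jp c) (Phi2 p n)) = Phi2 (e1 c * p)"
  by (rule HOL.ext, simp add: Phi2_def outer_right_ph2 outer_left_ph2 coef2_e1_mult coef2_mult_e2)+

lemma jacobi_1_jp: "jacobi_1 J lbr (jp a) (jp b) (jp c) i j = ph3 (coef3 i j (P.jac1 a b c))"
proof -
  have "jacobi_1 J lbr (jp a) (jp b) (jp c) i j = ph3 (coef3 i 0 (P.brL a (coef2 0 (coef2 j (P.br b c)))))"
    unfolding jacobi_1_def bracket_L_def lbr_jp[of b c] Phi2_def
  proof (rule tensor_lift2_ph2[OF kmod_T khom_ph3])
    show "klin (\<lambda>q. coef3 i 0 (P.brL a q))" by (intro klin_intros P.klin_brL)
    show "tensor_snoc J (lbr (jp a) (jp f) i) (jp g) = ph3 (coef3 i 0 (P.brL a (t2 f g 0)))" for f g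
      using coef3_j12_i3[of i 0 "P.br a f" g 0] by (simp add: lbr_jp Phi2_def tensor_snoc_ph2 P.brL_t2)
  qed
  then show ?thesis
    by (simp add: P.jac1_def P.coef3_brL[of i j])
qed

lemma jacobi_2_jp: "jacobi_2 J lbr (jp a) (jp b) (jp c) i j = ph3 (coef3 i j (P.jac2 a b c))"
proof -
  have "jacobi_2 J lbr (jp a) (jp b) (jp c) i j = ph3 (coef3 0 j (P.brR b (coef2 0 (coef2 i (P.br a c)))))"
    unfolding jacobi_2_def bracket_R_def lbr_jp[of a c] Phi2_def
  proof (rule tensor_lift2_ph2[OF kmod_T khom_ph3])
    show "klin (\<lambda>q. coef3 0 j (P.brR b q))" by (intro klin_intros P.klin_brR)
    show "tensor_cons J (jp f) (lbr (jp b) (jp g) j) = ph3 (coef3 0 j (P.brR b (t2 f g 0)))" for f g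
      using coef3_i1_j23[of 0 j f "P.br b g" 0] by (simp add: lbr_jp Phi2_def tensor_cons_ph2 P.brR_t2)
  qed
  then show ?thesis
    by (simp add: P.jac2_def P.coef3_brR[of i j])
qed

lemma jacobi_3_jp: "jacobi_3 J JD lbr (jp a) (jp b) (jp c) i j = ph3 (coef3 i j (P.jac3 a b c))"
proof -
  have "lambda_bracket_fst_L J JD lbr (ph2 q) (jp c) = Phi31 (P.brM1 c (coef2 0 q))" for q
    unfolding lambda_bracket_fst_L_def
  proof (rule tensor_lift2_ph2[OF kmod_P khom_Phi31])
    show "klin (P.brM1 c)" by (rule P.klin_brM1[OF klin_id])
  qed (simp add: lbr_jp shifted_sum_mid P.brM1_t2)
  then show ?thesis
    unfolding jacobi_3_def P.jac3_def P.coef3_brM khom_sum[OF kmod_T khom_ph3] poly_add_vars_def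
    by (simp add: lbr_jp Phi2_def Phi31_def khom_smult[OF khom_ph3])
qed

lemma dpva_lbr: "double_poisson_vertex_algebra J JD lbr"
proof (intro double_poisson_vertex_algebra.intro derivation_jet double_poisson_vertex_algebra_axioms.intro lbr_bilinear,
    unfold jet_carrier)
  fix a b c :: "('k, 'v) jet" and i j :: nat
  assume "a \<in> range jp" "b \<in> range jp"
  then obtain f g where [simp]: "a = jp f" "b = jp g" by auto
  show "lbr (JD a) b = \<ominus>\<^bsub>square_poly J\<^esub> poly_var_mult T2 (lbr a b)"
    by (simp add: jp_der lbr_jp P.br_der_left khom_minus[OF kmod_P khom_Phi2] Phi2_lam)
  show "lbr a (JD b) = der_plus_var J JD (lbr a b)"
    by (simp add: jp_der lbr_jp P.br_der_right der_plus_var_Phi2)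
  have "Phi2 (P.br f g - (- star (P.br g f))) = \<zero>\<^bsub>square_poly J\<^esub>"
    using P.br_skew[of f g] by (intro Phi2_N2) simp
  then show "lbr a b = \<ominus>\<^bsub>square_poly J\<^esub> poly_sum T2 (square_poly J) (lbr b a)
      (\<lambda>n r. ((\<lambda>p. \<ominus>\<^bsub>square_poly J\<^esub> der_plus_var J JD p) ^^ n) (poly_monom T2 0 (flip J r)))"
    unfolding khom_eq_iff[OF kmod_P khom_Phi2, symmetric]
    by (simp add: lbr_jp poly_sum_skew khom_minus[OF kmod_P khom_Phi2])
  assume "c \<in> range jp"
  then obtain h where [simp]: "c = jp h" by auto
  show "lbr a (b \<otimes>\<^bsub>J\<^esub> c) = (\<lambda>n. outer_right J (lbr a b n) c) \<oplus>\<^bsub>square_poly J\<^esub> (\<lambda>n. outer_left J b (lbr a c n))"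
    by (simp add: lbr_jp P.br_mult_right khom_add[OF khom_Phi2] outer_right_Phi2 outer_left_Phi2 flip: jp_mult)
  show "lbr (a \<otimes>\<^bsub>J\<^esub> b) c = shifted_sum T2 T2 JD (lbr a c) (inner_right J) b
      \<oplus>\<^bsub>square_poly J\<^esub> shifted_sum T2 T2 JD (lbr b c) (\<lambda>q x. inner_left J x q) a"
    by (simp add: lbr_jp P.br_mult_left khom_add[OF khom_Phi2] shifted_sum_inner_right shifted_sum_inner_left flip: jp_mult)
  show "jacobi_1 J lbr a b c i j \<ominus>\<^bsub>T3\<^esub> jacobi_2 J lbr a b c i j \<ominus>\<^bsub>T3\<^esub> jacobi_3 J JD lbr a b c i j = \<zero>\<^bsub>T3\<^esub>"
    using ph3_N3[OF P.br_jacobi[of f g h], of i j]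
    by (simp add: jacobi_1_jp jacobi_2_jp jacobi_3_jp P.jac_def coef3_lin khom_diff[OF kmod_T khom_ph3])
qed

section \<open>Uniqueness, and the formulation by double products\<close>

lemma extends_lbr_iff:
  "extends_bracket A br l \<longleftrightarrow>
    (\<forall>a\<in>carrier A. \<forall>b\<in>carrier A. l (jp (bas [(a, 0)])) (jp (bas [(b, 0)])) = Phi2 (P.br (bas [(a, 0)]) (bas [(b, 0)])))"
proof -
  have "poly_monom T2 0 (jet_embed_square A (br a b)) = Phi2 (P.br (bas [(a, 0)]) (bas [(b, 0)]))"
    if "a \<in> carrier A" "b \<in> carrier A" for a b
  proof -
    have "coef2 0 (psi2 q) = psi2 q" for q
      unfolding psi2_def klin_ext_apply[OF klin_coef2[OF klin_id]] by (simp add: coef2_t2)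
    then show ?thesis
      using jet_embed_square_tcls[OF rp(1)[OF that]] that
      by (simp add: rp(2) P.br_letters jB_0 poly_monom_ph2)
  qed
  then show ?thesis
    by (simp add: extends_bracket_def jp_embed)
qed

text \<open>The axioms for \<open>l\<close> are the rules obeyed by \<open>P.br\<close> on the free
  algebra, so agreement on letters of degree 0 spreads through the second argument and then through
  the first.\<close>

lemma lbr_unique:
  assumes l: "double_poisson_vertex_algebra J JD l" and e: "extends_bracket A br l"
  shows "l (jp f) (jp g) = Phi2 (P.br f g)"
proof -
  note bil = double_poisson_vertex_algebra.bilinear[OF l]
  have khom_left: "khom (square_poly J) (\<lambda>f. l (jp f) (jp g))" for g
    using bil jp_closed by (simp add: khom_def bilinear_on_def khom_add[OF khom_jp] khom_smult[OF khom_jp])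
  have khom_right: "khom (square_poly J) (\<lambda>g. l (jp f) (jp g))" for f
    using bil jp_closed by (simp add: khom_def bilinear_on_def khom_add[OF khom_jp] khom_smult[OF khom_jp])
  have bad_left: "l (jp f) (jp g) = Phi2 (P.br f g)" if "f \<in> jet_kernel" for f g
    using khom_zero[OF kmod_P khom_left] Phi2_N2[OF P.br_N2_left[OF that]] jp_kernel[OF that] by simp
  have bad_right: "l (jp f) (jp g) = Phi2 (P.br f g)" if "g \<in> jet_kernel" for f g
    using khom_zero[OF kmod_P khom_right] Phi2_N2[OF P.br_N2_right[OF that]] jp_kernel[OF that] by simp
  \<comment> \<open>The empty word is not a letter; its brackets are compared through the letter of
    the unit of \<open>A\<close>, which has the same image in \<open>J\<close>.\<close>
  have one: "jp 1 = jp (bas [(\<one>, 0)])"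
    using jp_eq_iff[of "bas [(\<one>, 0)]" 1] jet_kernel_I(4) by simp
  have Phi2_br_left: "khom (square_poly J) (\<lambda>f. Phi2 (P.br f g))" for g
    by (rule khom_compose[OF khom_Phi2 P.klin_br[OF klin_id]])
  have Phi2_br_right: "khom (square_poly J) (\<lambda>g. Phi2 (P.br f g))" for f
    by (rule khom_compose[OF khom_Phi2 P.klin_br'[OF klin_id]])
  \<comment> \<open>A letter outside the carrier lies in \<open>jet_kernel\<close>, so both sides
    vanish there.\<close>
  have letters: "l (jp (bas [(a, 0)])) (jp (bas [(b, 0)])) = Phi2 (P.br (bas [(a, 0)]) (bas [(b, 0)]))" for a b
  proof (cases "a \<in> carrier A \<and> b \<in> carrier A")
    case True
    then show ?thesis using e extends_lbr_iff by simp
  next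
    case False
    then show ?thesis using bad_left bad_right jet_kernel_I(5) by blast
  qed
  have unit: "Phi2 (P.br f (bas [(\<one>, 0)])) = Phi2 (P.br f 1)" "Phi2 (P.br (bas [(\<one>, 0)]) f) = Phi2 (P.br 1 f)" for f
    unfolding khom_eq_iff[OF kmod_P khom_Phi2]
    using Phi2_N2[OF P.br_N2_right[OF jet_kernel_I(4), of f]] Phi2_N2[OF P.br_N2_left[OF jet_kernel_I(4), of f]]
    by (simp_all add: P.br_simps)
  have 1: "l (jp (bas [(a, 0)])) (jp g) = Phi2 (P.br (bas [(a, 0)]) g)" for a g
  proof -
    let ?f = "bas [(a, 0)]"
    have "g \<in> {g. l (jp ?f) (jp g) = Phi2 (P.br ?f g)}"
    proof (rule free1_generated)
      show "ksubspace {g. l (jp ?f) (jp g) = Phi2 (P.br ?f g)}"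
        by (rule khom_equaliser[OF kmod_P khom_right Phi2_br_right])
      show "1 \<in> {g. l (jp ?f) (jp g) = Phi2 (P.br ?f g)}"
        using letters unit by (simp add: one)
    next
      fix g h assume "g \<in> {g. l (jp ?f) (jp g) = Phi2 (P.br ?f g)}" "h \<in> {g. l (jp ?f) (jp g) = Phi2 (P.br ?f g)}"
      then show "g * h \<in> {g. l (jp ?f) (jp g) = Phi2 (P.br ?f g)}"
        by (simp add: jp_mult double_poisson_vertex_algebra.leibniz_right[OF l] P.br_mult_right khom_add[OF khom_Phi2]
            outer_right_Phi2 outer_left_Phi2)
    next
      fix g assume "g \<in> {g. l (jp ?f) (jp g) = Phi2 (P.br ?f g)}"
      then show "free_jet_der g \<in> {g. l (jp ?f) (jp g) = Phi2 (P.br ?f g)}"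
        by (simp add: double_poisson_vertex_algebra.sesquilinear_right[OF l] P.br_der_right der_plus_var_Phi2 flip: jp_der)
    qed (simp add: letters)
    then show ?thesis by simp
  qed
  have "f \<in> {f. l (jp f) (jp g) = Phi2 (P.br f g)}"
  proof (rule free1_generated)
    show "ksubspace {f. l (jp f) (jp g) = Phi2 (P.br f g)}"
      by (rule khom_equaliser[OF kmod_P khom_left Phi2_br_left])
    show "1 \<in> {f. l (jp f) (jp g) = Phi2 (P.br f g)}"
      using 1 unit by (simp add: one)
  next
    fix f h assume "f \<in> {f. l (jp f) (jp g) = Phi2 (P.br f g)}" "h \<in> {f. l (jp f) (jp g) = Phi2 (P.br f g)}"
    then show "f * h \<in> {f. l (jp f) (jp g) = Phi2 (P.br f g)}"
      by (simp add: jp_mult double_poisson_vertex_algebra.leibniz_left[OF l] P.br_mult_left khom_add[OF khom_Phi2]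
          shifted_sum_inner_right shifted_sum_inner_left)
  next
    fix f assume "f \<in> {f. l (jp f) (jp g) = Phi2 (P.br f g)}"
    then show "free_jet_der f \<in> {f. l (jp f) (jp g) = Phi2 (P.br f g)}"
      by (simp add: double_poisson_vertex_algebra.sesquilinear_left[OF l] P.br_der_left khom_minus[OF kmod_P khom_Phi2]
          Phi2_lam flip: jp_der)
  qed (simp add: 1)
  then show ?thesis by simp
qed

text \<open>In characteristic 0 the factor n! is invertible, so a double product vanishes exactly
  when the coefficient does; for n = 0 the factor is 1.\<close>

lemma double_product_iff:
  assumes l: "double_poisson_vertex_algebra J JD l"
  shows "extends_bracket A br l \<longleftrightarrow>
    (\<forall>a\<in>carrier A. \<forall>b\<in>carrier A. \<forall>n. double_product J l n (jet_embed A a) (jet_embed A b) =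
      (if n = 0 then jet_embed_square A (br a b) else \<zero>\<^bsub>T2\<^esub>))"
proof -
  have fact_smult: "fact n \<odot>\<^bsub>T2\<^esub> x = (if n = 0 then t else \<zero>\<^bsub>T2\<^esub>) \<longleftrightarrow> x = (if n = 0 then t else \<zero>\<^bsub>T2\<^esub>)"
    if "x \<in> carrier T2" for n :: nat and x t
  proof -
    obtain p where p: "x = tcls 2 J p"
      using \<open>x \<in> carrier T2\<close> by (auto simp: kmodule.tensor_power_carrier[OF kmodule_jet])
    have 1: "fact n \<odot>\<^bsub>T2\<^esub> x = tcls 2 J (pm_smult (fact n) p)"
      by (simp add: p khom_smult[OF khom_T])
    show ?thesis
    proof (cases "n = 0")
      case False
      have "inverse (fact n) \<odot>\<^bsub>T2\<^esub> (fact n \<odot>\<^bsub>T2\<^esub> x) = x"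
        unfolding 1 khom_smult[OF khom_T, symmetric] by (simp add: p pm_smult_smult)
      moreover have "c \<odot>\<^bsub>T2\<^esub> \<zero>\<^bsub>T2\<^esub> = \<zero>\<^bsub>T2\<^esub>" for c
        using khom_smult[OF khom_T, of 2 c 0] by (simp add: khom_zero[OF kmod_T khom_T])
      ultimately show ?thesis
        using False by metis
    qed (use khom_smult[OF khom_T, of 2 1 p] in \<open>simp add: p\<close>)
  qed
  have closed: "l (jet_embed A a) (jet_embed A b) n \<in> carrier T2" if "a \<in> carrier A" "b \<in> carrier A" for a b n
    using double_poisson_vertex_algebra.bilinear[OF l] that
    by (auto simp: bilinear_on_def jp_embed poly_module_simps up_iff)
  show ?thesis
    unfolding extends_bracket_def double_product_def poly_monom_def fun_eq_iff
    by (simp add: fact_smult closed cong: ball_cong)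
qed

end

theorem lemma4p5:
  fixes A :: "('k::field_char_0, 'v) module"
    and br :: "'v \<Rightarrow> 'v \<Rightarrow> ('k, 'v) tensor"
  assumes "double_poisson_algebra A br"
  shows "(\<exists>lbr. double_poisson_vertex_algebra (jet_algebra A) (jet_der A) lbr \<and>
            extends_bracket A br lbr \<and>
            (\<forall>lbr'. double_poisson_vertex_algebra (jet_algebra A) (jet_der A) lbr' \<and>
                    extends_bracket A br lbr' \<longrightarrow>
               (\<forall>x\<in>carrier (jet_algebra A). \<forall>y\<in>carrier (jet_algebra A). lbr' x y = lbr x y)))
       \<and> (\<forall>lbr. double_poisson_vertex_algebra (jet_algebra A) (jet_der A) lbr \<longrightarrow>
            (extends_bracket A br lbr \<longleftrightarrow>
              (\<forall>a\<in>carrier A. \<forall>b\<in>carrier A. \<forall>n.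
                 double_product (jet_algebra A) lbr n (jet_embed A a) (jet_embed A b) =
                   (if n = 0 then jet_embed_square A (br a b)
                    else \<zero>\<^bsub>tensor_power 2 (jet_algebra A)\<^esub>))))"
proof -
  interpret double_poisson_algebra A br by fact
  have ext: "extends_bracket A br lbr"
    by (simp add: extends_lbr_iff lbr_jp)
  have unique: "\<forall>x\<in>carrier J. \<forall>y\<in>carrier J. lbr' x y = lbr x y"
    if "double_poisson_vertex_algebra J JD lbr' \<and> extends_bracket A br lbr'" for lbr'
    using that by (auto simp: jet_carrier lbr_jp lbr_unique)
  show ?thesis
    using dpva_lbr ext unique double_product_iff by blast
qed

end
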